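(* Let $X_0$ be an $\mathcal{F}_0$-measurable, square integrable and centered real random variable, $X_i=X_0\circ T^i$ for $i\in\mathbb{Z}$, $S_n=X_1+\cdots+X_n$ ($S_0=0$), and $S_p^{(i)}=S_{pi}-S_{p(i-1)}$ for positive integers $i,p$. Assume that the following three conditions hold. ($\mathbf{C}_1$) $\displaystyle\lim_{m\to\infty}\limsup_{p\to\infty}\frac{1}{\sqrt{mp}}\sum_{i=2}^{m+1}\mathbb{E}_0\big|\mathbb{E}_{(i-2)p}(S_p^{(i)})\big|=0$ a.s. ($\mathbf{C}_2$) There exists a $T$-invariant random variable $\eta$ that is $\mathcal{F}_0$-measurable and such that $$\lim_{m\to\infty}\limsup_{p\to\infty}\mathbb{E}_0\Big|\sum_{i=1}^m\frac{1}{mp}\mathbb{E}_{(i-1)p}\big((S_p^{(i+1)})^2\big)-\eta\Big|=0\ \text{ a.s.}$$ and $$\lim_{m\to\infty}\limsup_{p\to\infty}\mathbb{E}_0\Big|\sum_{i=1}^m\frac{1}{mp}\mathbb{E}_{(i-1)p}\big((S_p^{(i)}+S_p^{(i+1)})^2\big)-2\eta\Big|=0\ \text{ a.s.}$$ ($\mathbf{C}_3$) For each $\varepsilon>0$, $\displaystyle\lim_{m\to\infty}\limsup_{p\to\infty}\frac1m\sum_{i=1}^m\frac1p\mathbb{E}_0\big((S_p^{(i)})^2\mathbf{1}_{|S_p^{(i)}|/\sqrt p>\varepsilon\sqrt m}\big)=0$ a.s. Then, on a set of probability one, for any continuous and bounded function $f:\mathbb{R}\to\mathbb{R}$, $$\lim_{n\to\infty}\mathbb{E}_0(f(n^{-1/2}S_n))=\int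 f(x\sqrt\eta)\,g(x)\,dx,$$ where $g$ is the density of a standard normal random variable.
   Context: $(\Omega,\mathcal{A},\mathbb{P})$ is a probability space and $T:\Omega\to\Omega$ is a bijective bimeasurable transformation preserving $\mathbb{P}$. $\mathcal{F}_0\subseteq\mathcal{A}$ is a $\sigma$-algebra with $\mathcal{F}_0\subseteq T^{-1}(\mathcal{F}_0)$, and $\mathcal{F}_i=T^{-i}(\mathcal{F}_0)$ for $i\in\mathbb{Z}$. It is assumed that there exists a regular version $P_{T|\mathcal{F}_0}$ of the conditional distribution of $T$ given $\mathcal{F}_0$; for integrable $f:\Omega\to\mathbb{R}$ write $K(f)=P_{T|\mathcal{F}_0}(f)$ (a version of $\mathbb{E}(f\circ T|\mathcal{F}_0)$). All conditional expectations with respect to $\mathcal{F}_k$ are taken through these conditional probabilities: $\mathbb{E}_0(X)=K(X\circ T^{-1})$ and $\mathbb{E}_k(X)=K(X\circ T^{-k-1})\circ T^k$, which are versions of $\mathbb{E}(X|\mathcal{F}_0)$ and $\mathbb{E}(X|\mathcal{F}_k)$. *)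

theory Defs
  imports "HOL-Probability.Probability"
begin

text \<open>Integer powers \<open>T\<^sup>k\<close> of a bijection \<open>T\<close> of the set \<open>\<Omega>\<close>.\<close>

definition int_iter :: "'a set \<Rightarrow> ('a \<Rightarrow> 'a) \<Rightarrow> int \<Rightarrow> 'a \<Rightarrow> 'a" where
  "int_iter \<Omega> T k = (if 0 \<le> k then T ^^ nat k else inv_into \<Omega> T ^^ nat (- k))"

text \<open>
  The dynamical setting. The kernel \<open>\<kappa>\<close> is the regular version of the conditional distribution
  of \<open>T\<close> given \<open>F0\<close>: \<open>\<kappa> \<omega>\<close> is a probability measure on the \<open>\<sigma>\<close>-algebra of \<open>M\<close>, it depends
  \<open>F0\<close>-measurably on \<open>\<omega>\<close>, and \<open>\<kappa> \<omega> A\<close> is a version of the conditional probability of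
  \<open>T \<in> A\<close> given \<open>F0\<close>, for each measurable \<open>A\<close>.
\<close>

locale quenched_setting = prob_space M
  for M :: "'a measure" +
  fixes T :: "'a \<Rightarrow> 'a"
    and F0 :: "'a measure"
    and \<kappa> :: "'a \<Rightarrow> 'a measure"
  assumes bij_T: "bij_betw T (space M) (space M)"
    and measurable_T: "T \<in> measurable M M"
    and measurable_inv_T: "inv_into (space M) T \<in> measurable M M"
    and preserving_T: "distr M M T = M"
    and subalgebra_F0: "subalgebra M F0"
    and F0_subset_vimage: "sets F0 \<subseteq> sets (vimage_algebra (space M) T F0)"
    and kernel_measurable: "\<kappa> \<in> measurable F0 (prob_algebra M)"
    and kernel_version:
      "\<And>A. A \<in> sets M \<Longrightarrow>
        AE \<omega> in M. measure (\<kappa> \<omega>) A = real_cond_exp M F0 (indicator (T -` A \<inter> space M)) \<omega>"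

text \<open>
  \<open>K(f)\<close>, a version of \<open>E(f \<circ> T | F0)\<close> for integrable \<open>f\<close>. The integral is the Bochner integral,
  so \<open>K(f)(\<omega>)\<close> is \<open>0\<close> at those \<open>\<omega>\<close> for which \<open>f\<close> is not \<open>\<kappa> \<omega>\<close>-integrable; for integrable \<open>f\<close>
  they form a null set.
\<close>

definition kernel_op :: "('a \<Rightarrow> 'a measure) \<Rightarrow> ('a \<Rightarrow> real) \<Rightarrow> 'a \<Rightarrow> real" where
  "kernel_op \<kappa> f \<omega> = (\<integral>x. f x \<partial>\<kappa> \<omega>)"

text \<open>
  \<open>E\<^sub>k(X) = K(X \<circ> T\<^bsup>-k-1\<^esup>) \<circ> T\<^sup>k\<close>, the chosen everywhere defined version of the conditional
  expectation of \<open>X\<close> given \<open>F\<^sub>k = T\<^bsup>-k\<^esup>(F0)\<close>.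
\<close>

definition kexp ::
  "'a measure \<Rightarrow> ('a \<Rightarrow> 'a) \<Rightarrow> ('a \<Rightarrow> 'a measure) \<Rightarrow> int \<Rightarrow> ('a \<Rightarrow> real) \<Rightarrow> 'a \<Rightarrow> real" where
  "kexp M T \<kappa> k X \<omega> =
    kernel_op \<kappa> (\<lambda>x. X (int_iter (space M) T (- k - 1) x)) (int_iter (space M) T k \<omega>)"

definition stat_seq :: "'a measure \<Rightarrow> ('a \<Rightarrow> 'a) \<Rightarrow> ('a \<Rightarrow> real) \<Rightarrow> int \<Rightarrow> 'a \<Rightarrow> real" where
  "stat_seq M T X0 i \<omega> = X0 (int_iter (space M) T i \<omega>)"

definition psum :: "'a measure \<Rightarrow> ('a \<Rightarrow> 'a) \<Rightarrow> ('a \<Rightarrow> real) \<Rightarrow> nat \<Rightarrow> 'a \<Rightarrow> real" where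
  "psum M T X0 n \<omega> = (\<Sum>j=1..n. stat_seq M T X0 (int j) \<omega>)"

text \<open>The block sum \<open>S\<^sub>p\<^bsup>(i)\<^esup>\<close>; only \<open>i \<ge> 1\<close> is meaningful.\<close>

definition block_sum ::
  "'a measure \<Rightarrow> ('a \<Rightarrow> 'a) \<Rightarrow> ('a \<Rightarrow> real) \<Rightarrow> nat \<Rightarrow> nat \<Rightarrow> 'a \<Rightarrow> real" where
  "block_sum M T X0 p i \<omega> = psum M T X0 (p * i) \<omega> - psum M T X0 (p * (i - 1)) \<omega>"

end

theory Submission
  imports Defs
begin

text \<open>
  Write \<open>P\<^sub>\<omega>\<close> for the image of the kernel \<open>\<kappa> \<omega>\<close> under the inverse of \<open>T\<close>, so that
  \<open>E\<^sub>0(X)(\<omega>)\<close> is the integral of \<open>X\<close> with respect to \<open>P\<^sub>\<omega>\<close>. The claim is an ordinary central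
  limit theorem under \<open>P\<^sub>\<omega>\<close>, for almost every fixed \<open>\<omega>\<close>, and by the continuity theorem of Levy it
  suffices to find the limit of the characteristic functions of \<open>S\<^sub>n / sqrt n\<close> under \<open>P\<^sub>\<omega>\<close>.
  Under \<open>P\<^sub>\<omega>\<close> the variable \<open>\<eta>\<close> is almost surely the constant \<open>c = \<eta> \<omega>\<close> (\<open>cond_law_const\<close>), and
  the tower property holds for \<open>P\<^sub>\<omega>\<close> and countably many test functions simultaneously
  (\<open>cond_law_tower\<close>); a continuity argument extends this to the real parameter \<open>t\<close> of the
  characteristic function.

  Cut the sum over \<open>m p\<close> terms into \<open>m\<close> blocks and let \<open>Y\<^sub>i\<close> be the sum over the block number
  \<open>i + 1\<close> divided by \<open>sqrt (m p)\<close>, \<open>i = 0, ..., m\<close>. Conditional means are small only across a gap of one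
  block, so neighbouring blocks remain correlated, and the role of the conditional variance is
  played by the conditional expectation, given the past of \<open>Y\<^sub>i\<close>, of
  \<open>Y\<^sub>i\<^sup>2 + 2 Y\<^sub>i Y\<^sub>i\<^sub>+\<^sub>1 = (Y\<^sub>i + Y\<^sub>i\<^sub>+\<^sub>1)\<^sup>2 - Y\<^sub>i\<^sub>+\<^sub>1\<^sup>2\<close>. Let \<open>A\<^sub>i\<close> and \<open>B\<^sub>i\<close> be the conditional
  expectations of the two squares; the second condition says that their sums over \<open>i\<close> are close to
  \<open>2 c\<close> and \<open>c\<close>. One follows the process
  \<open>G\<^sub>j = exp (\<i> t (Y\<^sub>0 + ... + Y\<^sub>j\<^sub>-\<^sub>1) + t\<^sup>2/2 \<psi>(V\<^sub>j))\<close> with \<open>V\<^sub>j = (A\<^sub>0 - B\<^sub>0) + ... + (A\<^sub>j\<^sub>-\<^sub>1 - B\<^sub>j\<^sub>-\<^sub>1)\<close> and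
  \<open>\<psi>\<close> the truncation to an interval \<open>[-N, N]\<close>, which keeps \<open>G\<^sub>j\<close> bounded without stopping times.
  The corrected process \<open>G\<^sub>j (1 + \<i> t Y\<^sub>j)\<close> telescopes: by a second order expansion its increments
  are \<open>G\<^sub>j (\<i> t Y\<^sub>j\<^sub>+\<^sub>1 + t\<^sup>2/2 (A\<^sub>j - B\<^sub>j - (Y\<^sub>j + Y\<^sub>j\<^sub>+\<^sub>1)\<^sup>2 + Y\<^sub>j\<^sub>+\<^sub>1\<^sup>2))\<close> up to errors
  (\<open>lindeberg_telescope\<close>). Since \<open>G\<^sub>j\<close> is determined by the past, conditioning cancels the quadratic
  part and turns the linear part into a conditional mean across a gap, which the first condition
  controls; the errors are controlled by the Lindeberg condition. As \<open>V\<^sub>m\<close> is close to \<open>c\<close>, the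
  outcome is an explicit bound for the distance of the characteristic function of
  \<open>Y\<^sub>0 + ... + Y\<^sub>m\<^sub>-\<^sub>1\<close> from \<open>exp (- t\<^sup>2 c / 2)\<close> (\<open>char_bound\<close>).

  Letting first \<open>p\<close> and then \<open>m\<close> tend to infinity gives the limit along \<open>n = m p\<close>
  (\<open>block_char_limit\<close>). For general \<open>n\<close> one takes \<open>p = n div m\<close>; the difference of the normalised
  sums at \<open>n\<close> and at \<open>m p\<close> tends to \<open>0\<close> pathwise because \<open>X\<^sub>n / sqrt n\<close> tends to \<open>0\<close> almost surely, by
  square integrability and the Borel-Cantelli lemma (\<open>char_limit\<close>).
\<close>

section \<open>Analytic preliminaries\<close>

definition clip :: "real \<Rightarrow> real \<Rightarrow> real" where
  "clip N v = max (- N) (min N v)"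

definition tail_sq :: "real \<Rightarrow> real \<Rightarrow> real" where
  "tail_sq \<epsilon> y = (if \<epsilon> < \<bar>y\<bar> then y\<^sup>2 else 0)"

lemma tail_sq_nonneg [simp]: "0 \<le> tail_sq \<epsilon> y"
  by (simp add: tail_sq_def)

lemma tail_sq_le: "tail_sq \<epsilon> y \<le> y\<^sup>2"
  by (simp add: tail_sq_def)

text \<open>
  A quantity of first order in \<open>y\<close> is small below the
  threshold, and above it the quotient \<open>\<bar>y\<bar> / \<epsilon> > 1\<close> makes it quadratic.
\<close>
lemma abs_le_tail_sq:
  assumes "0 < \<epsilon>"
  shows "\<bar>y\<bar> \<le> \<epsilon> + tail_sq \<epsilon> y / \<epsilon>"
proof (cases "\<epsilon> < \<bar>y\<bar>")
  case True
  then have "\<bar>y\<bar> * \<epsilon> \<le> \<bar>y\<bar> * \<bar>y\<bar>" by (intro mult_left_mono) auto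
  then have "\<bar>y\<bar> \<le> y\<^sup>2 / \<epsilon>"
    using assms by (simp add: field_simps power2_eq_square)
  then show ?thesis using True assms by (simp add: tail_sq_def)
qed (simp add: tail_sq_def)

lemma sq_le_tail_sq:
  assumes "0 < \<epsilon>"
  shows "y\<^sup>2 \<le> \<epsilon>\<^sup>2 + tail_sq \<epsilon> y"
proof (cases "\<epsilon> < \<bar>y\<bar>")
  case False
  then have "y\<^sup>2 \<le> \<epsilon>\<^sup>2" by (metis abs_ge_zero not_less power2_abs power_mono)
  then show ?thesis by (simp add: tail_sq_def)
qed (simp add: tail_sq_def)

lemma cube_min_le_tail_sq:
  assumes "0 < \<epsilon>" "r \<le> \<bar>t * y\<bar> ^ 3 / 6" "r \<le> (t * y)\<^sup>2"
  shows "r \<le> \<bar>t\<bar> ^ 3 * (\<epsilon> * y\<^sup>2) + t\<^sup>2 * tail_sq \<epsilon> y"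
proof (cases "\<epsilon> < \<bar>y\<bar>")
  case True
  then have "r \<le> t\<^sup>2 * tail_sq \<epsilon> y" using assms by (simp add: tail_sq_def power_mult_distrib)
  moreover have "0 \<le> \<bar>t\<bar> ^ 3 * (\<epsilon> * y\<^sup>2)" using assms by simp
  ultimately show ?thesis by linarith
next
  case False
  have "\<bar>y\<bar> * \<bar>y\<bar>\<^sup>2 \<le> \<epsilon> * \<bar>y\<bar>\<^sup>2" using False by (intro mult_right_mono) auto
  then have *: "\<bar>t\<bar> ^ 3 * (\<bar>y\<bar> * \<bar>y\<bar>\<^sup>2) \<le> \<bar>t\<bar> ^ 3 * (\<epsilon> * \<bar>y\<bar>\<^sup>2)" by (intro mult_left_mono) auto
  have "r \<le> \<bar>t * y\<bar> ^ 3" using assms(2) by (rule order_trans) simp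
  also have "\<dots> = \<bar>t\<bar> ^ 3 * (\<bar>y\<bar> * \<bar>y\<bar>\<^sup>2)" by (simp only: abs_mult power_mult_distrib power3_eq_cube power2_eq_square mult_ac)
  finally show ?thesis using * by (simp add: tail_sq_def False)
qed

text \<open>
  If \<open>\<bar>z\<bar>\<close> is at most \<open>\<epsilon>\<close>, the quadratic bound for \<open>r\<close> is used; otherwise the larger of \<open>\<bar>y\<bar>\<close> and
  \<open>\<bar>z\<bar>\<close> exceeds \<open>\<epsilon>\<close> and the linear bound for \<open>r\<close> leaves the square of that larger one.
\<close>
lemma mixed_min_le_tail_sq:
  assumes "0 < \<epsilon>" "r \<le> (t * y)\<^sup>2 / 2" "r \<le> 2 * \<bar>t * y\<bar>"
  shows "\<bar>z\<bar> * r \<le> t\<^sup>2 * (\<epsilon> * y\<^sup>2) + 2 * \<bar>t\<bar> * (tail_sq \<epsilon> y + tail_sq \<epsilon> z)"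
proof -
  have n: "0 \<le> t\<^sup>2 * (\<epsilon> * y\<^sup>2)" "0 \<le> 2 * \<bar>t\<bar> * tail_sq \<epsilon> y" "0 \<le> 2 * \<bar>t\<bar> * tail_sq \<epsilon> z"
    using assms(1) by auto
  have "\<bar>z\<bar> * r \<le> \<bar>z\<bar> * (2 * \<bar>t * y\<bar>)" by (intro mult_left_mono assms) auto
  then have *: "\<bar>z\<bar> * r \<le> 2 * \<bar>t\<bar> * (\<bar>z\<bar> * \<bar>y\<bar>)" by (simp add: abs_mult ac_simps)
  consider "\<bar>z\<bar> \<le> \<epsilon>" | "\<epsilon> < \<bar>z\<bar>" "\<bar>y\<bar> \<le> \<bar>z\<bar>" | "\<epsilon> < \<bar>y\<bar>" "\<bar>z\<bar> \<le> \<bar>y\<bar>" by linarith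
  then show ?thesis
  proof cases
    case 1
    have "\<bar>z\<bar> * r \<le> \<bar>z\<bar> * (t * y)\<^sup>2"
      by (rule mult_left_mono) (use assms(2) zero_le_power2[of "t * y"] in \<open>linarith, simp\<close>)
    also have "\<dots> \<le> \<epsilon> * (t * y)\<^sup>2" using 1 by (intro mult_right_mono) auto
    also have "\<dots> = t\<^sup>2 * (\<epsilon> * y\<^sup>2)" by (simp add: power_mult_distrib)
    finally show ?thesis using n unfolding distrib_left power_mult_distrib by linarith
  next
    case 2
    have "2 * \<bar>t\<bar> * (\<bar>z\<bar> * \<bar>y\<bar>) \<le> 2 * \<bar>t\<bar> * (\<bar>z\<bar> * \<bar>z\<bar>)" using 2 by (intro mult_left_mono) auto
    also have "\<dots> = 2 * \<bar>t\<bar> * tail_sq \<epsilon> z" using 2 by (simp add: tail_sq_def power2_eq_square)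
    finally show ?thesis using n * unfolding distrib_left by linarith
  next
    case 3
    have "2 * \<bar>t\<bar> * (\<bar>z\<bar> * \<bar>y\<bar>) \<le> 2 * \<bar>t\<bar> * (\<bar>y\<bar> * \<bar>y\<bar>)" using 3 by (intro mult_left_mono mult_right_mono) auto
    also have "\<dots> = 2 * \<bar>t\<bar> * tail_sq \<epsilon> y" using 3 by (simp add: tail_sq_def power2_eq_square)
    finally show ?thesis using n * unfolding distrib_left by linarith
  qed
qed

lemma iexp_remainder1:
  "cmod (iexp x - (1 + \<i> * x)) \<le> x\<^sup>2 / 2"
  "cmod (iexp x - (1 + \<i> * x)) \<le> 2 * \<bar>x\<bar>"
  using iexp_approx1[of x 1] iexp_approx2[of x 1] by (simp_all add: numeral_2_eq_2)

lemma iexp_remainder2: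
  "cmod (iexp x - (1 + \<i> * x - (x\<^sup>2 / 2 :: real))) \<le> \<bar>x\<bar> ^ 3 / 6"
  "cmod (iexp x - (1 + \<i> * x - (x\<^sup>2 / 2 :: real))) \<le> x\<^sup>2"
proof -
  have "(\<Sum>k\<le>2. (\<i> * x) ^ k / fact k) = 1 + \<i> * x - (x\<^sup>2 / 2 :: real)"
    by (simp add: numeral_2_eq_2 power2_eq_square mult_ac flip: power_Suc) (simp add: field_simps)
  then show "cmod (iexp x - (1 + \<i> * x - (x\<^sup>2 / 2 :: real))) \<le> \<bar>x\<bar> ^ 3 / 6"
    "cmod (iexp x - (1 + \<i> * x - (x\<^sup>2 / 2 :: real))) \<le> x\<^sup>2"
    using iexp_approx1[of x 2] iexp_approx2[of x 2] by (simp_all add: fact_numeral)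
qed

lemma exp_remainder1: "\<bar>exp d - 1\<bar> \<le> \<bar>d\<bar> * exp \<bar>d\<bar>" for d :: real
  using Taylor_exp_field[of d 0] by (simp add: mult.commute)

lemma exp_remainder2: "\<bar>exp d - 1 - d\<bar> \<le> d\<^sup>2 * exp \<bar>d\<bar>" for d :: real
  using Taylor_exp_field[of d 1] by (simp add: mult.commute power2_eq_square algebra_simps)

definition step_const :: "real \<Rightarrow> real \<Rightarrow> real" where
  "step_const t N = 4 * (1 + \<bar>t\<bar>) ^ 4 * exp (t\<^sup>2 * N) * (1 + N)"

lemma step_const_nonneg: "0 \<le> N \<Longrightarrow> 0 \<le> step_const t N"
  by (simp add: step_const_def)

text \<open>
  One step of the expansion. With \<open>d = t\<^sup>2 D / 2\<close> the factor \<open>w = exp (\<i> t y + d)\<close> is compared with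
  \<open>1 + \<i> t y + d - (t y)\<^sup>2 / 2\<close>, and, multiplied by the size of the next variable \<open>z\<close>, with
  \<open>1 + \<i> t y\<close>. The mixed terms \<open>y d\<close> and \<open>z d\<close> are of order \<open>\<epsilon> \<bar>d\<bar>\<close> below the threshold \<open>\<epsilon>\<close> and are
  absorbed by the truncated squares above it, because \<open>d\<close> is bounded. The bound \<open>\<Theta>\<close> of \<open>D\<^sup>2\<close> is kept
  as a separate quantity since it can only be estimated after conditioning.
\<close>
lemma exp_step_remainder:
  fixes t y z D N n \<epsilon> \<Theta> :: real
  assumes \<epsilon>: "0 < \<epsilon>" "\<epsilon> \<le> 1" and N: "0 \<le> N" "\<bar>D\<bar> \<le> 2 * N" and n: "\<bar>D\<bar> \<le> n" and \<Theta>: "D\<^sup>2 \<le> \<Theta>"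
  defines "d \<equiv> t\<^sup>2 * D / 2"
  defines "w \<equiv> exp (\<i> * (t * y) + complex_of_real d)"
  shows "cmod (w - (1 + \<i> * (t * y) + (d - (t * y)\<^sup>2 / 2 :: real))) + \<bar>t\<bar> * \<bar>z\<bar> * cmod (w - (1 + \<i> * (t * y)))
    \<le> step_const t N *
       (\<Theta> + \<epsilon> * n + \<epsilon> * y\<^sup>2 + (1 + 1 / \<epsilon>) * (tail_sq \<epsilon> y + tail_sq \<epsilon> z))"
proof -
  define q where "q = 1 + \<bar>t\<bar>"
  define E where "E = exp (t\<^sup>2 * N)"
  define ly where "ly = tail_sq \<epsilon> y"
  define lz where "lz = tail_sq \<epsilon> z"
  have q: "1 \<le> q" "\<bar>t\<bar> \<le> q" by (auto simp: q_def)
  have E: "1 \<le> E" using N by (simp add: E_def)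
  have l: "0 \<le> ly" "0 \<le> lz" by (simp_all add: ly_def lz_def)
  have n0: "0 \<le> n" using n by linarith
  have d_le: "\<bar>d\<bar> \<le> t\<^sup>2 * N" "\<bar>d\<bar> \<le> t\<^sup>2 * n"
  proof -
    have "\<bar>d\<bar> = t\<^sup>2 * (\<bar>D\<bar> / 2)" by (simp add: d_def abs_mult)
    moreover have "t\<^sup>2 * (\<bar>D\<bar> / 2) \<le> t\<^sup>2 * N" "t\<^sup>2 * (\<bar>D\<bar> / 2) \<le> t\<^sup>2 * n"
      using N n by (intro mult_left_mono; simp)+
    ultimately show "\<bar>d\<bar> \<le> t\<^sup>2 * N" "\<bar>d\<bar> \<le> t\<^sup>2 * n" by auto
  qed
  have d_sq: "d\<^sup>2 \<le> \<bar>t\<bar> ^ 4 * \<Theta>"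
  proof -
    have "d\<^sup>2 = \<bar>t\<bar> ^ 4 * (D\<^sup>2 / 4)" by (simp add: d_def power_mult_distrib power_divide)
    also have "\<dots> \<le> \<bar>t\<bar> ^ 4 * \<Theta>" using \<Theta> zero_le_power2[of D] by (intro mult_left_mono) (linarith, simp)
    finally show ?thesis .
  qed
  have expd: "exp \<bar>d\<bar> \<le> E" using d_le by (simp add: E_def)
  have w: "w = iexp (t * y) * complex_of_real (exp d)"
    by (simp add: w_def exp_add exp_of_real)
  have cross: "\<bar>x\<bar> * \<bar>d\<bar> \<le> t\<^sup>2 * (\<epsilon> * n) + t\<^sup>2 * N * (tail_sq \<epsilon> x / \<epsilon>)" for x
  proof -
    have "\<bar>x\<bar> * \<bar>d\<bar> \<le> (\<epsilon> + tail_sq \<epsilon> x / \<epsilon>) * \<bar>d\<bar>"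
      using abs_le_tail_sq[OF \<epsilon>(1)] by (intro mult_right_mono) auto
    also have "\<dots> = \<epsilon> * \<bar>d\<bar> + (tail_sq \<epsilon> x / \<epsilon>) * \<bar>d\<bar>" by (simp add: algebra_simps)
    also have "\<dots> \<le> \<epsilon> * (t\<^sup>2 * n) + (tail_sq \<epsilon> x / \<epsilon>) * (t\<^sup>2 * N)"
      using d_le \<epsilon> by (intro add_mono mult_left_mono) auto
    finally show ?thesis by (simp add: algebra_simps)
  qed
  have r1: "cmod (w - (1 + \<i> * (t * y) + (d - (t * y)\<^sup>2 / 2 :: real)))
    \<le> cmod (iexp (t * y) - (1 + \<i> * (t * y) - ((t * y)\<^sup>2 / 2 :: real))) + d\<^sup>2 * exp \<bar>d\<bar> + \<bar>t\<bar> * (\<bar>y\<bar> * \<bar>d\<bar>)"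
  proof -
    have "w - (1 + \<i> * (t * y) + (d - (t * y)\<^sup>2 / 2 :: real))
      = (iexp (t * y) - (1 + \<i> * (t * y) - ((t * y)\<^sup>2 / 2 :: real)))
        + iexp (t * y) * complex_of_real (exp d - 1 - d) + (iexp (t * y) - 1) * complex_of_real d"
      by (simp add: w algebra_simps)
    also have "cmod \<dots> \<le> cmod (iexp (t * y) - (1 + \<i> * (t * y) - ((t * y)\<^sup>2 / 2 :: real)))
        + cmod (iexp (t * y) * complex_of_real (exp d - 1 - d)) + cmod ((iexp (t * y) - 1) * complex_of_real d)"
      by (intro order_trans[OF norm_triangle_ineq] add_mono order_refl)
    also have "cmod (iexp (t * y) * complex_of_real (exp d - 1 - d)) = \<bar>exp d - 1 - d\<bar>"
      by (simp only: norm_mult norm_of_real norm_exp_i_times mult_1_left)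
    also have "cmod ((iexp (t * y) - 1) * complex_of_real d) \<le> \<bar>t * y\<bar> * \<bar>d\<bar>"
      unfolding norm_mult using iexp_approx1[of "t * y" 0] by (intro mult_mono) (auto simp: abs_mult)
    finally show ?thesis using exp_remainder2[of d] by (simp add: abs_mult)
  qed
  have r2: "cmod (w - (1 + \<i> * (t * y))) \<le> cmod (iexp (t * y) - (1 + \<i> * (t * y))) + \<bar>d\<bar> * exp \<bar>d\<bar>"
  proof -
    have "w - (1 + \<i> * (t * y)) = (iexp (t * y) - (1 + \<i> * (t * y))) + iexp (t * y) * complex_of_real (exp d - 1)"
      by (simp add: w algebra_simps)
    also have "cmod \<dots> \<le> cmod (iexp (t * y) - (1 + \<i> * (t * y))) + cmod (iexp (t * y) * complex_of_real (exp d - 1))"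
      by (rule norm_triangle_ineq)
    also have "cmod (iexp (t * y) * complex_of_real (exp d - 1)) = \<bar>exp d - 1\<bar>"
      by (simp only: norm_mult norm_of_real norm_exp_i_times mult_1_left)
    finally show ?thesis using exp_remainder1[of d] by simp
  qed
  have b1: "cmod (iexp (t * y) - (1 + \<i> * (t * y) - ((t * y)\<^sup>2 / 2 :: real))) \<le> \<bar>t\<bar> ^ 3 * (\<epsilon> * y\<^sup>2) + t\<^sup>2 * ly"
    unfolding ly_def by (rule cube_min_le_tail_sq[OF \<epsilon>(1)]) (use iexp_remainder2[of "t * y"] in auto)
  have b2: "\<bar>z\<bar> * cmod (iexp (t * y) - (1 + \<i> * (t * y))) \<le> t\<^sup>2 * (\<epsilon> * y\<^sup>2) + 2 * \<bar>t\<bar> * (ly + lz)"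
    unfolding ly_def lz_def by (rule mixed_min_le_tail_sq[OF \<epsilon>(1)]) (use iexp_remainder1[of "t * y"] in auto)
  have p: "\<bar>t\<bar> \<le> q ^ 4" "t\<^sup>2 \<le> q ^ 4" "\<bar>t\<bar> ^ 3 \<le> q ^ 4" "\<bar>t\<bar> ^ 4 \<le> q ^ 4" "\<bar>t\<bar> * t\<^sup>2 \<le> q ^ 4" "\<bar>t\<bar> * \<bar>t\<bar> \<le> q ^ 4"
  proof -
    have *: "\<bar>t\<bar> ^ k \<le> q ^ 4" if "k \<le> 4" for k
      using power_mono[OF q(2), of k] power_increasing[OF that q(1)] by simp
    show "\<bar>t\<bar> \<le> q ^ 4" "t\<^sup>2 \<le> q ^ 4" "\<bar>t\<bar> ^ 3 \<le> q ^ 4" "\<bar>t\<bar> ^ 4 \<le> q ^ 4" "\<bar>t\<bar> * t\<^sup>2 \<le> q ^ 4" "\<bar>t\<bar> * \<bar>t\<bar> \<le> q ^ 4"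
      using *[of 1] *[of 2] *[of 3] *[of 4] by (auto simp: power2_eq_square power3_eq_cube)
  qed
  define Q where "Q = q ^ 4 * E"
  have QE: "x \<le> Q" "x * E \<le> Q" if "x \<le> q ^ 4" for x
    using that E q mult_mono[of x "q ^ 4" 1 E] by (auto simp: Q_def intro: order_trans)
  have Q0: "0 \<le> Q" using E q by (simp add: Q_def)
  have s: "0 \<le> \<epsilon> * n" "0 \<le> \<epsilon> * y\<^sup>2" "0 \<le> \<Theta>" "0 \<le> ly / \<epsilon>" "0 \<le> lz / \<epsilon>" "0 \<le> N * (ly / \<epsilon>)" "0 \<le> N * (lz / \<epsilon>)"
    using \<epsilon> n0 l N order_trans[OF zero_le_power2 \<Theta>] by auto
  have t1: "\<bar>t\<bar> ^ 3 * (\<epsilon> * y\<^sup>2) \<le> Q * (\<epsilon> * y\<^sup>2)" "t\<^sup>2 * ly \<le> Q * ly"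
    using QE(1)[OF p(3)] QE(1)[OF p(2)] s l by (auto intro: mult_right_mono)
  have t2: "d\<^sup>2 * exp \<bar>d\<bar> \<le> Q * \<Theta>"
  proof -
    have "d\<^sup>2 * exp \<bar>d\<bar> \<le> (\<bar>t\<bar> ^ 4 * \<Theta>) * E" using d_sq expd s by (intro mult_mono) auto
    also have "\<dots> = (\<bar>t\<bar> ^ 4 * E) * \<Theta>" by simp
    also have "\<dots> \<le> Q * \<Theta>" using QE(2)[OF p(4)] s by (intro mult_right_mono) auto
    finally show ?thesis .
  qed
  have t3: "\<bar>t\<bar> * (\<bar>y\<bar> * \<bar>d\<bar>) \<le> Q * (\<epsilon> * n) + Q * (N * (ly / \<epsilon>))"
  proof -
    have "\<bar>t\<bar> * (\<bar>y\<bar> * \<bar>d\<bar>) \<le> \<bar>t\<bar> * (t\<^sup>2 * (\<epsilon> * n) + t\<^sup>2 * N * (ly / \<epsilon>))"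
      unfolding ly_def by (intro mult_left_mono cross) auto
    also have "\<dots> = (\<bar>t\<bar> * t\<^sup>2) * (\<epsilon> * n) + (\<bar>t\<bar> * t\<^sup>2) * (N * (ly / \<epsilon>))" by (simp add: algebra_simps)
    also have "\<dots> \<le> Q * (\<epsilon> * n) + Q * (N * (ly / \<epsilon>))"
      using QE(1)[OF p(5)] s by (intro add_mono mult_right_mono)
    finally show ?thesis .
  qed
  have t4: "\<bar>t\<bar> * (\<bar>z\<bar> * cmod (iexp (t * y) - (1 + \<i> * (t * y)))) \<le> Q * (\<epsilon> * y\<^sup>2) + 2 * Q * (ly + lz)"
  proof -
    have "\<bar>t\<bar> * (\<bar>z\<bar> * cmod (iexp (t * y) - (1 + \<i> * (t * y)))) \<le> \<bar>t\<bar> * (t\<^sup>2 * (\<epsilon> * y\<^sup>2) + 2 * \<bar>t\<bar> * (ly + lz))"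
      by (intro mult_left_mono b2) auto
    also have "\<dots> = (\<bar>t\<bar> * t\<^sup>2) * (\<epsilon> * y\<^sup>2) + 2 * (\<bar>t\<bar> * \<bar>t\<bar>) * (ly + lz)" by (simp add: algebra_simps)
    also have "\<dots> \<le> Q * (\<epsilon> * y\<^sup>2) + 2 * Q * (ly + lz)"
      using QE(1)[OF p(5)] QE(1)[OF p(6)] s l by (intro add_mono mult_right_mono) auto
    finally show ?thesis .
  qed
  have t5: "\<bar>t\<bar> * (\<bar>z\<bar> * (\<bar>d\<bar> * exp \<bar>d\<bar>)) \<le> Q * (\<epsilon> * n) + Q * (N * (lz / \<epsilon>))"
  proof -
    have "\<bar>t\<bar> * (\<bar>z\<bar> * (\<bar>d\<bar> * exp \<bar>d\<bar>)) = \<bar>t\<bar> * (\<bar>z\<bar> * \<bar>d\<bar>) * exp \<bar>d\<bar>" by simp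
    also have "\<dots> \<le> \<bar>t\<bar> * (t\<^sup>2 * (\<epsilon> * n) + t\<^sup>2 * N * (lz / \<epsilon>)) * E"
      unfolding lz_def using expd n0 N \<epsilon> by (intro mult_mono mult_left_mono cross) auto
    also have "\<dots> = ((\<bar>t\<bar> * t\<^sup>2) * E) * (\<epsilon> * n) + ((\<bar>t\<bar> * t\<^sup>2) * E) * (N * (lz / \<epsilon>))" by (simp add: algebra_simps)
    also have "\<dots> \<le> Q * (\<epsilon> * n) + Q * (N * (lz / \<epsilon>))"
      using QE(2)[OF p(5)] s by (intro add_mono mult_right_mono)
    finally show ?thesis .
  qed
  have "\<bar>t\<bar> * \<bar>z\<bar> * cmod (w - (1 + \<i> * (t * y)))
    \<le> \<bar>t\<bar> * (\<bar>z\<bar> * cmod (iexp (t * y) - (1 + \<i> * (t * y)))) + \<bar>t\<bar> * (\<bar>z\<bar> * (\<bar>d\<bar> * exp \<bar>d\<bar>))"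
    using mult_left_mono[OF r2, of "\<bar>t\<bar> * \<bar>z\<bar>"] by (simp add: algebra_simps)
  then have "cmod (w - (1 + \<i> * (t * y) + (d - (t * y)\<^sup>2 / 2 :: real))) + \<bar>t\<bar> * \<bar>z\<bar> * cmod (w - (1 + \<i> * (t * y)))
    \<le> Q * (\<epsilon> * y\<^sup>2) + Q * ly + Q * \<Theta> + (Q * (\<epsilon> * n) + Q * (N * (ly / \<epsilon>)))
      + (Q * (\<epsilon> * y\<^sup>2) + 2 * Q * (ly + lz)) + (Q * (\<epsilon> * n) + Q * (N * (lz / \<epsilon>)))"
    using r1 b1 t1 t2 t3 t4 t5 by linarith
  also have "\<dots> = Q * (\<Theta> + 2 * (\<epsilon> * n) + 2 * (\<epsilon> * y\<^sup>2) + (3 * ly + N * (ly / \<epsilon>)) + (2 * lz + N * (lz / \<epsilon>)))"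
    by (simp add: algebra_simps)
  also have "\<dots> \<le> Q * (4 * (1 + N) * (\<Theta> + \<epsilon> * n + \<epsilon> * y\<^sup>2 + (1 + 1 / \<epsilon>) * (ly + lz)))"
  proof (rule mult_left_mono[OF _ Q0])
    have big: "x * 1 \<le> x * (4 * (1 + N))" if "0 \<le> x" for x
      using that N by (intro mult_left_mono) auto
    have bb: "2 * x \<le> x * (4 * (1 + N))" if "0 \<le> x" for x
      using that N mult_nonneg_nonneg[OF that N(1)] by (simp add: algebra_simps)
    have cc: "3 * x + N * (x / \<epsilon>) \<le> x * (4 * (1 + N)) + x / \<epsilon> * (4 * (1 + N))" if "0 \<le> x" for x
    proof -
      have "3 * x \<le> x * (4 * (1 + N))"
        using that N mult_nonneg_nonneg[OF that N(1)] by (simp add: algebra_simps)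
      moreover have "N * (x / \<epsilon>) \<le> (4 * (1 + N)) * (x / \<epsilon>)"
        using that N \<epsilon> by (intro mult_right_mono) auto
      ultimately show ?thesis by (simp add: mult.commute)
    qed
    have "\<Theta> + 2 * (\<epsilon> * n) + 2 * (\<epsilon> * y\<^sup>2) + (3 * ly + N * (ly / \<epsilon>)) + (2 * lz + N * (lz / \<epsilon>))
      \<le> \<Theta> * (4 * (1 + N)) + \<epsilon> * n * (4 * (1 + N)) + \<epsilon> * y\<^sup>2 * (4 * (1 + N))
        + (ly * (4 * (1 + N)) + ly / \<epsilon> * (4 * (1 + N))) + (lz * (4 * (1 + N)) + lz / \<epsilon> * (4 * (1 + N)))"
      using big[of \<Theta>] bb[of "\<epsilon> * n"] bb[of "\<epsilon> * y\<^sup>2"] cc[of ly] cc[of lz] s l by linarith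
    also have "\<dots> = 4 * (1 + N) * (\<Theta> + \<epsilon> * n + \<epsilon> * y\<^sup>2 + (1 + 1 / \<epsilon>) * (ly + lz))"
      by (simp add: algebra_simps add_divide_distrib)
    finally show "\<Theta> + 2 * (\<epsilon> * n) + 2 * (\<epsilon> * y\<^sup>2) + (3 * ly + N * (ly / \<epsilon>)) + (2 * lz + N * (lz / \<epsilon>))
      \<le> 4 * (1 + N) * (\<Theta> + \<epsilon> * n + \<epsilon> * y\<^sup>2 + (1 + 1 / \<epsilon>) * (ly + lz))" .
  qed
  also have "\<dots> = 4 * q ^ 4 * E * (1 + N) * (\<Theta> + \<epsilon> * n + \<epsilon> * y\<^sup>2 + (1 + 1 / \<epsilon>) * (ly + lz))"
    by (simp only: Q_def mult_ac)
  finally show ?thesis unfolding step_const_def q_def E_def ly_def lz_def .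
qed

lemma clip_bounds: "0 \<le> N \<Longrightarrow> \<bar>clip N v\<bar> \<le> N"
  by (auto simp: clip_def)

lemma clip_lipschitz: "\<bar>clip N u - clip N v\<bar> \<le> \<bar>u - v\<bar>"
  by (auto simp: clip_def max_def min_def)

lemma clip_id: "\<bar>v\<bar> \<le> N \<Longrightarrow> clip N v = v"
  by (auto simp: clip_def)

lemma borel_measurable_clip [measurable]: "clip N \<in> borel_measurable borel"
  unfolding clip_def[abs_def] by measurable

lemma abs_exp_diff_le:
  fixes u v :: real
  assumes "u \<le> B" "v \<le> B"
  shows "\<bar>exp u - exp v\<bar> \<le> exp B * \<bar>u - v\<bar>"
proof -
  have *: "exp y - exp x \<le> exp B * (y - x)" if "x \<le> y" "y \<le> B" for x y :: real
  proof -
    have "exp y - exp x = exp y * (1 - exp (x - y))" by (simp add: algebra_simps flip: exp_add)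
    also have "\<dots> \<le> exp y * (y - x)" using exp_ge_add_one_self[of "x - y"] by (intro mult_left_mono) (linarith, simp)
    also have "\<dots> \<le> exp B * (y - x)" using that by (intro mult_right_mono) auto
    finally show ?thesis .
  qed
  show ?thesis using *[of u v] *[of v u] assms by (cases u v rule: le_cases) (auto simp: abs_if)
qed

lemma norm_integral_le_integral:
  fixes f :: "'a \<Rightarrow> 'b::{banach, second_countable_topology}"
  assumes "integrable M f" "integrable M g" "\<And>x. norm (f x) \<le> g x"
  shows "norm (\<integral>x. f x \<partial>M) \<le> (\<integral>x. g x \<partial>M)"
  using assms by (intro order_trans[OF integral_norm_bound] integral_mono) auto

lemma real_eq_if_eq_on_rat:
  fixes f g :: "real \<Rightarrow> real"
  assumes "continuous_on UNIV f" "continuous_on UNIV g" "\<And>q. f (real_of_rat q) = g (real_of_rat q)"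
  shows "f t = g t"
proof -
  have "closed {t. f t = g t}" using assms(1,2) by (rule closed_Collect_eq)
  moreover have "\<rat> \<subseteq> {t. f t = g t}" using assms(3) by (auto elim: Rats_cases)
  ultimately have "closure \<rat> \<subseteq> {t. f t = g t}" by (intro closure_minimal)
  then show ?thesis by (auto simp: Rats_closure_real)
qed

lemma continuous_integral_weight:
  fixes h :: "real \<Rightarrow> 'a \<Rightarrow> real"
  assumes X: "integrable P X" and h: "\<And>t. h t \<in> borel_measurable P"
    and cont: "\<And>x. continuous_on UNIV (\<lambda>t. h t x)" and bound: "\<And>t x. \<bar>h t x\<bar> \<le> exp (t\<^sup>2 * N / 2)" and N: "0 \<le> N"
  shows "continuous_on UNIV (\<lambda>t. \<integral>x. h t x * X x \<partial>P)"
  unfolding continuous_on_sequentially comp_def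
proof (intro ballI allI impI)
  fix u :: "nat \<Rightarrow> real" and t assume "(\<forall>n. u n \<in> UNIV) \<and> u \<longlonglongrightarrow> t"
  then have u: "u \<longlonglongrightarrow> t" by simp
  then obtain R where R: "\<bar>u n\<bar> \<le> R" for n
    using convergent_imp_Bseq[of u] by (auto simp: convergent_def Bseq_def)
  have XM: "X \<in> borel_measurable P" using X by auto
  show "(\<lambda>n. \<integral>x. h (u n) x * X x \<partial>P) \<longlonglongrightarrow> (\<integral>x. h t x * X x \<partial>P)"
  proof (rule integral_dominated_convergence[where w="\<lambda>x. exp (R\<^sup>2 * N / 2) * \<bar>X x\<bar>"])
    show "AE x in P. (\<lambda>n. h (u n) x * X x) \<longlonglongrightarrow> h t x * X x"
    proof (rule AE_I2)
      fix x
      have "(\<lambda>n. h (u n) x) \<longlonglongrightarrow> h t x"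
        using cont[of x] u unfolding continuous_on_sequentially comp_def by auto
      then show "(\<lambda>n. h (u n) x * X x) \<longlonglongrightarrow> h t x * X x" by (rule tendsto_mult_right)
    qed
    show "AE x in P. norm (h (u n) x * X x) \<le> exp (R\<^sup>2 * N / 2) * \<bar>X x\<bar>" for n
    proof (rule AE_I2)
      fix x
      have "(u n)\<^sup>2 \<le> R\<^sup>2" using R[of n] by (metis abs_ge_zero power2_abs power_mono)
      then have "exp ((u n)\<^sup>2 * N / 2) \<le> exp (R\<^sup>2 * N / 2)" using N by (simp add: mult_right_mono)
      then have "\<bar>h (u n) x\<bar> \<le> exp (R\<^sup>2 * N / 2)" using bound[of "u n" x] by linarith
      then show "norm (h (u n) x * X x) \<le> exp (R\<^sup>2 * N / 2) * \<bar>X x\<bar>" by (simp add: abs_mult mult_right_mono)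
    qed
  qed (use X XM h in auto)
qed

lemma sum_square_le: "(x + y)\<^sup>2 \<le> 2 * x\<^sup>2 + 2 * (y :: real)\<^sup>2"
  using zero_le_power2[of "x - y"] by (simp add: power2_eq_square algebra_simps)

lemma integrable_sq_add:
  fixes f g :: "'a \<Rightarrow> real"
  assumes [measurable]: "f \<in> borel_measurable M" "g \<in> borel_measurable M"
    and "integrable M (\<lambda>x. (f x)\<^sup>2)" "integrable M (\<lambda>x. (g x)\<^sup>2)"
  shows "integrable M (\<lambda>x. (f x + g x)\<^sup>2)"
proof (rule Bochner_Integration.integrable_bound)
  show "integrable M (\<lambda>x. 2 * (f x)\<^sup>2 + 2 * (g x)\<^sup>2)" using assms by simp
  show "AE x in M. norm ((f x + g x)\<^sup>2) \<le> norm (2 * (f x)\<^sup>2 + 2 * (g x)\<^sup>2)"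
    using sum_square_le by auto
qed measurable

section \<open>The telescoping Lindeberg expansion\<close>

text \<open>
  The process \<open>G\<^sub>i\<close> of the introduction along one trajectory.
\<close>
definition lind_weight ::
  "real \<Rightarrow> real \<Rightarrow> (nat \<Rightarrow> real) \<Rightarrow> (nat \<Rightarrow> real) \<Rightarrow> (nat \<Rightarrow> real) \<Rightarrow> nat \<Rightarrow> complex" where
  "lind_weight t N y a b i =
    exp (\<i> * (t * (\<Sum>l<i. y l)) + complex_of_real (t\<^sup>2 / 2 * clip N (\<Sum>l<i. a l - b l)))"

lemma lind_weight_0 [simp]: "0 \<le> N \<Longrightarrow> lind_weight t N y a b 0 = 1"
  by (simp add: lind_weight_def clip_def)

lemma lind_weight_Suc:
  "lind_weight t N y a b (Suc i) = lind_weight t N y a b i *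
    exp (\<i> * (t * y i) + complex_of_real (t\<^sup>2 * (clip N (\<Sum>l<Suc i. a l - b l) - clip N (\<Sum>l<i. a l - b l)) / 2))"
  by (simp add: lind_weight_def algebra_simps diff_divide_distrib flip: exp_add)

lemma norm_lind_weight:
  "cmod (lind_weight t N y a b i) = exp (t\<^sup>2 / 2 * clip N (\<Sum>l<i. a l - b l))"
  by (simp add: lind_weight_def)

lemma norm_lind_weight_le:
  assumes "0 \<le> N"
  shows "cmod (lind_weight t N y a b i) \<le> exp (t\<^sup>2 * N / 2)"
proof -
  have "t\<^sup>2 / 2 * clip N (\<Sum>l<i. a l - b l) \<le> t\<^sup>2 / 2 * N"
    using clip_bounds[OF assms, of "\<Sum>l<i. a l - b l"] by (intro mult_left_mono) auto
  then show ?thesis by (simp add: norm_lind_weight)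
qed

text \<open>
  Replacing an increment of the clipped partial sums by \<open>a i - b i\<close> costs nothing while the total
  mass \<open>n = (\<Sum>i<m. a i + b i)\<close> stays below \<open>N\<close>. If \<open>n > N \<ge> 3 c + 1\<close>, then \<open>n\<close> itself is at most
  \<open>N (n - 3 c)\<close>. So in both cases the cost is controlled by the distance of \<open>n\<close> from \<open>3 c\<close>, the
  value around which it concentrates.
\<close>
lemma clip_increments:
  fixes a b :: "nat \<Rightarrow> real"
  assumes ab: "\<And>i. i < m \<Longrightarrow> 0 \<le> a i" "\<And>i. i < m \<Longrightarrow> 0 \<le> b i" and c: "0 \<le> c" "3 * c + 1 \<le> N"
  shows "(\<Sum>i<m. \<bar>clip N (\<Sum>l<Suc i. a l - b l) - clip N (\<Sum>l<i. a l - b l) - (a i - b i)\<bar>)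
    \<le> 2 * N * \<bar>(\<Sum>i<m. a i + b i) - 3 * c\<bar>"
proof (cases "(\<Sum>i<m. a i + b i) \<le> N")
  case True
  have *: "\<bar>\<Sum>l<i. a l - b l\<bar> \<le> N" if "i \<le> m" for i
  proof -
    have "\<bar>\<Sum>l<i. a l - b l\<bar> \<le> (\<Sum>l<i. \<bar>a l - b l\<bar>)" by (rule sum_abs)
    also have "\<dots> \<le> (\<Sum>l<i. a l + b l)" using ab that by (intro sum_mono) (auto simp: abs_le_iff)
    also have "\<dots> \<le> (\<Sum>l<m. a l + b l)" using ab that by (intro sum_mono2) auto
    finally show ?thesis using True by simp
  qed
  have "clip N (\<Sum>l<Suc i. a l - b l) - clip N (\<Sum>l<i. a l - b l) - (a i - b i) = 0" if "i < m" for i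
  proof -
    have "clip N (\<Sum>l<i. a l - b l) = (\<Sum>l<i. a l - b l)" "clip N (\<Sum>l<Suc i. a l - b l) = (\<Sum>l<Suc i. a l - b l)"
      using that * by (auto intro!: clip_id simp del: sum.lessThan_Suc)
    then show ?thesis by simp
  qed
  then show ?thesis using c by simp
next
  case False
  define n where "n = (\<Sum>i<m. a i + b i)"
  have "\<bar>clip N (\<Sum>l<Suc i. a l - b l) - clip N (\<Sum>l<i. a l - b l) - (a i - b i)\<bar> \<le> 2 * (a i + b i)" if "i < m" for i
  proof -
    have "\<bar>clip N (\<Sum>l<Suc i. a l - b l) - clip N (\<Sum>l<i. a l - b l)\<bar> \<le> \<bar>a i - b i\<bar>"
      using clip_lipschitz[of N "\<Sum>l<Suc i. a l - b l" "\<Sum>l<i. a l - b l"] by simp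
    then show ?thesis using ab[OF that] by (auto simp: abs_if split: if_splits)
  qed
  then have "(\<Sum>i<m. \<bar>clip N (\<Sum>l<Suc i. a l - b l) - clip N (\<Sum>l<i. a l - b l) - (a i - b i)\<bar>) \<le> (\<Sum>i<m. 2 * (a i + b i))"
    by (intro sum_mono) auto
  also have "\<dots> = 2 * n" by (simp add: n_def sum_distrib_left)
  also have "n \<le> N * \<bar>n - 3 * c\<bar>"
  proof -
    have n: "3 * c + 1 \<le> n" using False c by (simp add: n_def)
    have "0 \<le> 3 * c * (n - 3 * c - 1)" using n c by (intro mult_nonneg_nonneg) auto
    then have "n \<le> (3 * c + 1) * (n - 3 * c)" by (simp add: algebra_simps)
    also have "\<dots> \<le> N * (n - 3 * c)" using c n by (intro mult_right_mono) auto
    finally show ?thesis using n by simp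
  qed
  finally show ?thesis by (simp add: n_def)
qed

text \<open>
  The boundary factors \<open>1 + \<i> t y\<close> shift the linear term by one index: the factor \<open>y i\<close> of \<open>G i\<close>,
  which is correlated with the variable just before it, is exchanged for \<open>y (Suc i)\<close>, which comes
  after a gap, at the price of the product \<open>t\<^sup>2 y i y (Suc i)\<close>. This is why the square of
  \<open>y i + y (Suc i)\<close> shows up.
\<close>
lemma lindeberg_telescope:
  fixes y a b :: "nat \<Rightarrow> real" and t N c \<epsilon> :: real
  assumes ab: "\<And>i. i < m \<Longrightarrow> 0 \<le> a i" "\<And>i. i < m \<Longrightarrow> 0 \<le> b i"
    and c: "0 \<le> c" "3 * c + 1 \<le> N" and \<epsilon>: "0 < \<epsilon>" "\<epsilon> \<le> 1"
  defines "G \<equiv> lind_weight t N y a b"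
  shows "cmod (G m * (1 + \<i> * (t * y m)) - (1 + \<i> * (t * y 0))
      - (\<Sum>i<m. G i * (\<i> * (t * y (Suc i))
           + (t\<^sup>2 / 2 * ((a i - b i) - (y i + y (Suc i))\<^sup>2 + (y (Suc i))\<^sup>2) :: real))))
    \<le> exp (t\<^sup>2 * N / 2) * (t\<^sup>2 * N * \<bar>(\<Sum>i<m. a i + b i) - 3 * c\<bar>
      + step_const t N * (\<Sum>i<m. min (a i + b i) (2 * N) * (a i + b i) + \<epsilon> * (a i + b i)
          + \<epsilon> * (y i)\<^sup>2 + (1 + 1 / \<epsilon>) * (tail_sq \<epsilon> (y i) + tail_sq \<epsilon> (y (Suc i)))))"
proof -
  define D where "D i = clip N (\<Sum>l<Suc i. a l - b l) - clip N (\<Sum>l<i. a l - b l)" for i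
  define w where "w i = exp (\<i> * (t * y i) + complex_of_real (t\<^sup>2 * D i / 2))" for i
  define S where "S i = G i * (\<i> * (t * y (Suc i))
           + (t\<^sup>2 / 2 * ((a i - b i) - (y i + y (Suc i))\<^sup>2 + (y (Suc i))\<^sup>2) :: real))" for i
  define e where "e i = (w i - (1 + \<i> * (t * y i) + (t\<^sup>2 * D i / 2 - (t * y i)\<^sup>2 / 2 :: real)))
        + \<i> * (t * y (Suc i)) * (w i - (1 + \<i> * (t * y i))) + (t\<^sup>2 / 2 * (D i - (a i - b i)) :: real)" for i
  define X where "X i = min (a i + b i) (2 * N) * (a i + b i) + \<epsilon> * (a i + b i)
          + \<epsilon> * (y i)\<^sup>2 + (1 + 1 / \<epsilon>) * (tail_sq \<epsilon> (y i) + tail_sq \<epsilon> (y (Suc i)))" for i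
  have N: "0 \<le> N" using c by simp
  have G_Suc: "G (Suc i) = G i * w i" for i
    unfolding G_def w_def D_def by (rule lind_weight_Suc)
  have step: "G (Suc i) * (1 + \<i> * (t * y (Suc i))) - G i * (1 + \<i> * (t * y i)) - S i = G i * e i" for i
  proof -
    have ring: "g * v * (1 + Y') - g * (1 + Y) - g * (Y' + U) = g * ((v - (1 + Y + P)) + Y' * (v - (1 + Y)) + R)"
      if "U = P + Y' * Y - R" for g v Y Y' U P R :: complex
      unfolding that by (simp add: algebra_simps)
    have "t\<^sup>2 / 2 * ((a i - b i) - (y i + y (Suc i))\<^sup>2 + (y (Suc i))\<^sup>2)
      = (t\<^sup>2 * D i / 2 - (t * y i)\<^sup>2 / 2) + - (t * y (Suc i) * (t * y i)) - t\<^sup>2 / 2 * (D i - (a i - b i))"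
      by (simp add: power2_eq_square field_simps)
    then have "complex_of_real (t\<^sup>2 / 2 * ((a i - b i) - (y i + y (Suc i))\<^sup>2 + (y (Suc i))\<^sup>2))
      = complex_of_real (t\<^sup>2 * D i / 2 - (t * y i)\<^sup>2 / 2) + complex_of_real (- (t * y (Suc i) * (t * y i)))
        - complex_of_real (t\<^sup>2 / 2 * (D i - (a i - b i)))"
      by (simp only: of_real_add of_real_diff)
    also have "complex_of_real (- (t * y (Suc i) * (t * y i))) = \<i> * complex_of_real (t * y (Suc i)) * (\<i> * complex_of_real (t * y i))"
      by (simp add: complex_eq_iff)
    finally show ?thesis unfolding G_Suc S_def e_def by (rule ring)
  qed
  have "G m * (1 + \<i> * (t * y m)) - (1 + \<i> * (t * y 0)) - (\<Sum>i<m. S i)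
    = (\<Sum>i<m. G (Suc i) * (1 + \<i> * (t * y (Suc i))) - G i * (1 + \<i> * (t * y i)) - S i)"
    using sum_lessThan_telescope[of "\<lambda>i. G i * (1 + \<i> * (t * y i))" m]
    by (simp only: sum_subtractf[of _ S]) (simp add: G_def N)
  also have "\<dots> = (\<Sum>i<m. G i * e i)" by (simp only: step)
  also have "cmod \<dots> \<le> (\<Sum>i<m. exp (t\<^sup>2 * N / 2) * (t\<^sup>2 / 2 * \<bar>D i - (a i - b i)\<bar> + step_const t N * X i))"
  proof (rule sum_norm_le)
    fix i assume "i \<in> {..<m}"
    then have i: "i < m" by simp
    have D_le: "\<bar>D i\<bar> \<le> 2 * N"
      using clip_bounds[OF N, of "\<Sum>l<Suc i. a l - b l"] clip_bounds[OF N, of "\<Sum>l<i. a l - b l"]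
      unfolding D_def by linarith
    have D_le': "\<bar>D i\<bar> \<le> a i + b i"
      using clip_lipschitz[of N "\<Sum>l<Suc i. a l - b l" "\<Sum>l<i. a l - b l"] ab[OF i]
      unfolding D_def by simp
    have D_sq: "(D i)\<^sup>2 \<le> min (a i + b i) (2 * N) * (a i + b i)"
    proof -
      have "(D i)\<^sup>2 = \<bar>D i\<bar> * \<bar>D i\<bar>" by (simp add: power2_eq_square)
      also have "\<dots> \<le> min (a i + b i) (2 * N) * (a i + b i)"
        using D_le D_le' ab[OF i] N by (intro mult_mono) auto
      finally show ?thesis .
    qed
    have "cmod (e i) \<le> cmod (w i - (1 + \<i> * (t * y i) + (t\<^sup>2 * D i / 2 - (t * y i)\<^sup>2 / 2 :: real)))
        + cmod (\<i> * (t * y (Suc i)) * (w i - (1 + \<i> * (t * y i)))) + cmod (complex_of_real (t\<^sup>2 / 2 * (D i - (a i - b i))))"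
      unfolding e_def by (intro order_trans[OF norm_triangle_ineq] add_mono order_refl)
    also have "cmod (\<i> * (t * y (Suc i)) * (w i - (1 + \<i> * (t * y i)))) = \<bar>t\<bar> * \<bar>y (Suc i)\<bar> * cmod (w i - (1 + \<i> * (t * y i)))"
      by (simp add: norm_mult mult.assoc)
    also have "cmod (complex_of_real (t\<^sup>2 / 2 * (D i - (a i - b i)))) = t\<^sup>2 / 2 * \<bar>D i - (a i - b i)\<bar>"
      by (simp only: norm_of_real) (simp add: abs_mult)
    finally have "cmod (e i) \<le> t\<^sup>2 / 2 * \<bar>D i - (a i - b i)\<bar> + step_const t N * X i"
      using exp_step_remainder[OF \<epsilon> N D_le D_le' D_sq, of t "y i" "y (Suc i)"]
      unfolding X_def w_def by linarith
    then show "cmod (G i * e i) \<le> exp (t\<^sup>2 * N / 2) * (t\<^sup>2 / 2 * \<bar>D i - (a i - b i)\<bar> + step_const t N * X i)"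
      unfolding norm_mult G_def by (intro mult_mono norm_lind_weight_le N) auto
  qed
  also have "\<dots> = exp (t\<^sup>2 * N / 2) * (t\<^sup>2 / 2 * (\<Sum>i<m. \<bar>D i - (a i - b i)\<bar>) + step_const t N * (\<Sum>i<m. X i))"
    by (simp only: sum_distrib_left sum.distrib distrib_left)
  also have "\<dots> \<le> exp (t\<^sup>2 * N / 2) * (t\<^sup>2 / 2 * (2 * N * \<bar>(\<Sum>i<m. a i + b i) - 3 * c\<bar>) + step_const t N * (\<Sum>i<m. X i))"
    unfolding D_def by (intro mult_left_mono add_right_mono clip_increments ab c) auto
  finally show ?thesis unfolding S_def X_def by (simp add: algebra_simps)
qed

section \<open>A quantitative characteristic function bound for arrays\<close>

lemma tail_sq_meas [measurable]: "tail_sq \<epsilon> \<in> borel_measurable borel"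
  unfolding tail_sq_def[abs_def] by measurable

text \<open>
  Its value is immaterial; what matters is that it is the same for all arrays, all numbers of
  blocks and all thresholds.
\<close>
definition array_const :: "real \<Rightarrow> real \<Rightarrow> real" where
  "array_const t N = exp (t\<^sup>2 * N / 2) * (3 * \<bar>t\<bar> + t\<^sup>2 * (N + 1) + 20 * (1 + N) * step_const t N)"

lemma array_const_nonneg: "0 \<le> N \<Longrightarrow> 0 \<le> array_const t N"
  by (simp add: array_const_def step_const_nonneg)

text \<open>
  The data for one array row: \<open>A i\<close>, \<open>B i\<close> and \<open>C i\<close> behave like the conditional expectations of
  \<open>(Y i + Y (Suc i))\<^sup>2\<close>, \<open>(Y (Suc i))\<^sup>2\<close> and \<open>Y (Suc i)\<close> given the past of \<open>Y i\<close>. Conditioning is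
  required only in the form of the integral identities against the particular past-measurable
  weights that are used: this makes the assumptions a countable collection once \<open>t\<close> is treated
  by continuity, so that they can hold outside one null set.
\<close>
locale lindeberg_array = prob_space P for P :: "'a measure" +
  fixes Y A B C :: "nat \<Rightarrow> 'a \<Rightarrow> real" and m :: nat and t N c :: real
  assumes c: "0 \<le> c" "3 * c + 1 \<le> N"
    and Y_meas: "\<And>i. i \<le> m \<Longrightarrow> Y i \<in> borel_measurable P"
    and Y_sq: "\<And>i. i \<le> m \<Longrightarrow> integrable P (\<lambda>x. (Y i x)\<^sup>2)"
    and A_int: "\<And>i. i < m \<Longrightarrow> integrable P (A i)" and A_nonneg: "\<And>i x. i < m \<Longrightarrow> 0 \<le> A i x"
    and B_int: "\<And>i. i < m \<Longrightarrow> integrable P (B i)" and B_nonneg: "\<And>i x. i < m \<Longrightarrow> 0 \<le> B i x"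
    and C_int: "\<And>i. i < m \<Longrightarrow> integrable P (C i)"
    and A_weight: "\<And>i. i < m \<Longrightarrow>
      (\<integral>x. lind_weight t N (\<lambda>l. Y l x) (\<lambda>l. A l x) (\<lambda>l. B l x) i * complex_of_real ((Y i x + Y (Suc i) x)\<^sup>2) \<partial>P) =
      (\<integral>x. lind_weight t N (\<lambda>l. Y l x) (\<lambda>l. A l x) (\<lambda>l. B l x) i * complex_of_real (A i x) \<partial>P)"
    and B_weight: "\<And>i. i < m \<Longrightarrow>
      (\<integral>x. lind_weight t N (\<lambda>l. Y l x) (\<lambda>l. A l x) (\<lambda>l. B l x) i * complex_of_real ((Y (Suc i) x)\<^sup>2) \<partial>P) =
      (\<integral>x. lind_weight t N (\<lambda>l. Y l x) (\<lambda>l. A l x) (\<lambda>l. B l x) i * complex_of_real (B i x) \<partial>P)"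
    and C_weight: "\<And>i. i < m \<Longrightarrow>
      (\<integral>x. lind_weight t N (\<lambda>l. Y l x) (\<lambda>l. A l x) (\<lambda>l. B l x) i * complex_of_real (Y (Suc i) x) \<partial>P) =
      (\<integral>x. lind_weight t N (\<lambda>l. Y l x) (\<lambda>l. A l x) (\<lambda>l. B l x) i * complex_of_real (C i x) \<partial>P)"
    and A_trunc: "\<And>i. i < m \<Longrightarrow>
      (\<integral>x. min (A i x + B i x) (2 * N) * (Y i x + Y (Suc i) x)\<^sup>2 \<partial>P) =
      (\<integral>x. min (A i x + B i x) (2 * N) * A i x \<partial>P)"
    and B_trunc: "\<And>i. i < m \<Longrightarrow>
      (\<integral>x. min (A i x + B i x) (2 * N) * (Y (Suc i) x)\<^sup>2 \<partial>P) =
      (\<integral>x. min (A i x + B i x) (2 * N) * B i x \<partial>P)"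
    and B_mean: "\<And>i. i < m \<Longrightarrow> (\<integral>x. (Y (Suc i) x)\<^sup>2 \<partial>P) = (\<integral>x. B i x \<partial>P)"
begin

definition "\<delta>A = expectation (\<lambda>x. \<bar>(\<Sum>i<m. A i x) - 2 * c\<bar>)"
definition "\<delta>B = expectation (\<lambda>x. \<bar>(\<Sum>i<m. B i x) - c\<bar>)"
definition "\<delta>C = (\<Sum>i<m. expectation (\<lambda>x. \<bar>C i x\<bar>))"
definition "\<Lambda> \<epsilon> = (\<Sum>i\<le>m. expectation (\<lambda>x. tail_sq \<epsilon> (Y i x)))"

definition "G i x = lind_weight t N (\<lambda>l. Y l x) (\<lambda>l. A l x) (\<lambda>l. B l x) i"
definition "\<Theta> i x = min (A i x + B i x) (2 * N)"

lemma N: "1 \<le> N" "0 \<le> N" using c by auto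

lemma A_meas: "i < m \<Longrightarrow> A i \<in> borel_measurable P"
  and B_meas: "i < m \<Longrightarrow> B i \<in> borel_measurable P"
  using A_int B_int by auto

lemma Y_integrable: "i \<le> m \<Longrightarrow> integrable P (Y i)"
  using square_integrable_imp_integrable[OF Y_meas Y_sq] .

lemma tail_integrable: "i \<le> m \<Longrightarrow> integrable P (\<lambda>x. tail_sq \<epsilon> (Y i x))"
  by (rule Bochner_Integration.integrable_bound[OF Y_sq[of i]])
     (auto intro!: measurable_compose[OF Y_meas] simp: tail_sq_le)

lemma G_meas: "i \<le> m \<Longrightarrow> G i \<in> borel_measurable P"
proof -
  assume i: "i \<le> m"
  have [measurable]: "(\<lambda>x. \<Sum>l<i. Y l x) \<in> borel_measurable P" "(\<lambda>x. \<Sum>l<i. A l x - B l x) \<in> borel_measurable P"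
    using i by (auto intro!: borel_measurable_sum borel_measurable_diff Y_meas A_meas B_meas)
  show ?thesis unfolding G_def[abs_def] lind_weight_def by measurable
qed

lemma norm_G: "cmod (G i x) \<le> exp (t\<^sup>2 * N / 2)"
  unfolding G_def by (rule norm_lind_weight_le) (rule N)

lemma G_integrable:
  fixes Z :: "'a \<Rightarrow> real"
  assumes "i \<le> m" "integrable P Z"
  shows "integrable P (\<lambda>x. G i x * complex_of_real (Z x))"
proof (rule Bochner_Integration.integrable_bound)
  show "integrable P (\<lambda>x. exp (t\<^sup>2 * N / 2) * Z x)" using assms by simp
  show "(\<lambda>x. G i x * complex_of_real (Z x)) \<in> borel_measurable P"
    using G_meas[OF assms(1)] assms(2) by measurable
  show "AE x in P. cmod (G i x * complex_of_real (Z x)) \<le> norm (exp (t\<^sup>2 * N / 2) * Z x)"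
    using norm_G by (auto simp: norm_mult abs_mult intro!: mult_right_mono)
qed

lemma norm_expectation_G:
  assumes "i \<le> m" "integrable P Z"
  shows "cmod (\<integral>x. G i x * complex_of_real (Z x) \<partial>P) \<le> exp (t\<^sup>2 * N / 2) * expectation (\<lambda>x. \<bar>Z x\<bar>)"
proof -
  have "cmod (\<integral>x. G i x * complex_of_real (Z x) \<partial>P) \<le> (\<integral>x. exp (t\<^sup>2 * N / 2) * \<bar>Z x\<bar> \<partial>P)"
  proof (rule norm_integral_le_integral[OF G_integrable[OF assms]])
    show "integrable P (\<lambda>x. exp (t\<^sup>2 * N / 2) * \<bar>Z x\<bar>)" using assms by simp
    show "cmod (G i x * complex_of_real (Z x)) \<le> exp (t\<^sup>2 * N / 2) * \<bar>Z x\<bar>" for x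
      using norm_G by (auto simp: norm_mult intro!: mult_right_mono)
  qed
  then show ?thesis by simp
qed

lemma sum_sq_integrable: "i < m \<Longrightarrow> integrable P (\<lambda>x. (Y i x + Y (Suc i) x)\<^sup>2)"
  by (intro integrable_sq_add Y_meas Y_sq) auto

lemma \<Theta>_bounds:
  assumes "i < m"
  shows "0 \<le> \<Theta> i x" "\<Theta> i x \<le> 2 * N" "\<Theta> i x \<le> A i x + B i x"
  using assms A_nonneg[of i x] B_nonneg[of i x] N by (auto simp: \<Theta>_def)

lemma \<Theta>_integrable:
  fixes Z :: "'a \<Rightarrow> real"
  assumes i: "i < m" and Z: "integrable P Z"
  shows "integrable P (\<lambda>x. \<Theta> i x * Z x)"
proof (rule Bochner_Integration.integrable_bound)
  show "integrable P (\<lambda>x. 2 * N * Z x)" using Z by simp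
  show "(\<lambda>x. \<Theta> i x * Z x) \<in> borel_measurable P"
    using A_meas[OF i] B_meas[OF i] Z unfolding \<Theta>_def by measurable
  show "AE x in P. norm (\<Theta> i x * Z x) \<le> norm (2 * N * Z x)"
    using \<Theta>_bounds[OF i] N by (auto simp: abs_mult intro!: mult_right_mono)
qed

lemma \<Lambda>_bound: "i \<le> m \<Longrightarrow> expectation (\<lambda>x. tail_sq \<epsilon> (Y i x)) \<le> \<Lambda> \<epsilon>"
  unfolding \<Lambda>_def by (rule member_le_sum) (auto intro!: Bochner_Integration.integral_nonneg)

lemma \<Lambda>_nonneg: "0 \<le> \<Lambda> \<epsilon>"
  unfolding \<Lambda>_def by (auto intro!: sum_nonneg Bochner_Integration.integral_nonneg)

lemma expectation_abs_Y:
  assumes "0 < \<epsilon>" "i \<le> m"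
  shows "expectation (\<lambda>x. \<bar>Y i x\<bar>) \<le> \<epsilon> + \<Lambda> \<epsilon> / \<epsilon>"
proof -
  have "expectation (\<lambda>x. \<bar>Y i x\<bar>) \<le> expectation (\<lambda>x. \<epsilon> + tail_sq \<epsilon> (Y i x) / \<epsilon>)"
    using assms Y_integrable tail_integrable abs_le_tail_sq by (intro integral_mono) auto
  also have "\<dots> = \<epsilon> + expectation (\<lambda>x. tail_sq \<epsilon> (Y i x)) / \<epsilon>"
    using tail_integrable[OF assms(2)] by (simp add: prob_space)
  also have "\<dots> \<le> \<epsilon> + \<Lambda> \<epsilon> / \<epsilon>" using \<Lambda>_bound[OF assms(2)] assms(1) by (simp add: divide_right_mono)
  finally show ?thesis .
qed

lemma sum_Y_sq:
  assumes "0 < \<epsilon>" "\<epsilon> \<le> 1"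
  shows "(\<Sum>i<m. expectation (\<lambda>x. (Y i x)\<^sup>2)) \<le> 1 + \<Lambda> \<epsilon> + (\<Sum>i<m. expectation (\<lambda>x. A i x + B i x))"
proof -
  have "(\<Sum>i<m. expectation (\<lambda>x. (Y i x)\<^sup>2)) \<le> (\<Sum>i<Suc m. expectation (\<lambda>x. (Y i x)\<^sup>2))"
    by (simp add: Bochner_Integration.integral_nonneg)
  also have "\<dots> = expectation (\<lambda>x. (Y 0 x)\<^sup>2) + (\<Sum>i<m. expectation (\<lambda>x. (Y (Suc i) x)\<^sup>2))"
    by (rule sum.lessThan_Suc_shift)
  also have "(\<Sum>i<m. expectation (\<lambda>x. (Y (Suc i) x)\<^sup>2)) \<le> (\<Sum>i<m. expectation (\<lambda>x. A i x + B i x))"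
  proof (rule sum_mono)
    fix i assume "i \<in> {..<m}" then have i: "i < m" by simp
    show "expectation (\<lambda>x. (Y (Suc i) x)\<^sup>2) \<le> expectation (\<lambda>x. A i x + B i x)"
      unfolding B_mean[OF i] using i A_int B_int A_nonneg by (intro integral_mono) auto
  qed
  also have "expectation (\<lambda>x. (Y 0 x)\<^sup>2) \<le> expectation (\<lambda>x. \<epsilon>\<^sup>2 + tail_sq \<epsilon> (Y 0 x))"
    using assms Y_sq[of 0] tail_integrable[of 0] sq_le_tail_sq by (intro integral_mono) auto
  also have "\<dots> = \<epsilon>\<^sup>2 + expectation (\<lambda>x. tail_sq \<epsilon> (Y 0 x))"
    using tail_integrable[of 0] by (simp add: prob_space)
  also have "\<dots> \<le> 1 + \<Lambda> \<epsilon>" using \<Lambda>_bound[of 0] assms by (intro add_mono) (auto simp: power_le_one)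
  finally show ?thesis by simp
qed

text \<open>
  The sum of the squared predictable increments is small: since \<open>\<Theta> i\<close> is determined by the past,
  \<open>A i + B i\<close> may be replaced by the squares that it predicts. Below the threshold these are of
  order \<open>\<epsilon>\<^sup>2\<close> and \<open>\<Theta> i \<le> A i + B i\<close> is used, above it \<open>\<Theta> i \<le> 2 N\<close> and the truncated squares
  are used.
\<close>
lemma expectation_\<Theta>:
  assumes \<epsilon>: "0 < \<epsilon>" "\<epsilon> \<le> 1"
  shows "(\<Sum>i<m. expectation (\<lambda>x. \<Theta> i x * (A i x + B i x)))
    \<le> 5 * \<epsilon> * (\<Sum>i<m. expectation (\<lambda>x. A i x + B i x)) + 10 * N * \<Lambda> \<epsilon>"
proof -
  define l where "l i = expectation (\<lambda>x. tail_sq \<epsilon> (Y i x))" for i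
  have l: "0 \<le> l i" for i unfolding l_def by (auto intro!: Bochner_Integration.integral_nonneg)
  have "expectation (\<lambda>x. \<Theta> i x * (A i x + B i x)) \<le> 5 * \<epsilon> * expectation (\<lambda>x. A i x + B i x) + N * (4 * l i + 6 * l (Suc i))"
    if i: "i < m" for i
  proof -
    have "expectation (\<lambda>x. \<Theta> i x * (A i x + B i x))
      = expectation (\<lambda>x. \<Theta> i x * A i x) + expectation (\<lambda>x. \<Theta> i x * B i x)"
      unfolding distrib_left using i by (intro Bochner_Integration.integral_add \<Theta>_integrable A_int B_int)
    also have "\<dots> = expectation (\<lambda>x. \<Theta> i x * (Y i x + Y (Suc i) x)\<^sup>2) + expectation (\<lambda>x. \<Theta> i x * (Y (Suc i) x)\<^sup>2)"
      using A_trunc[OF i] B_trunc[OF i] unfolding \<Theta>_def by simp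
    also have "\<dots> = expectation (\<lambda>x. \<Theta> i x * (Y i x + Y (Suc i) x)\<^sup>2 + \<Theta> i x * (Y (Suc i) x)\<^sup>2)"
      using i by (intro Bochner_Integration.integral_add[symmetric] \<Theta>_integrable sum_sq_integrable Y_sq) auto
    also have "\<dots> \<le> expectation (\<lambda>x. 5 * \<epsilon> * (A i x + B i x) + N * (4 * tail_sq \<epsilon> (Y i x) + 6 * tail_sq \<epsilon> (Y (Suc i) x)))"
    proof (rule integral_mono)
      show "integrable P (\<lambda>x. \<Theta> i x * (Y i x + Y (Suc i) x)\<^sup>2 + \<Theta> i x * (Y (Suc i) x)\<^sup>2)"
        using i by (intro Bochner_Integration.integrable_add \<Theta>_integrable sum_sq_integrable Y_sq) auto
      show "integrable P (\<lambda>x. 5 * \<epsilon> * (A i x + B i x) + N * (4 * tail_sq \<epsilon> (Y i x) + 6 * tail_sq \<epsilon> (Y (Suc i) x)))"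
        using i A_int B_int tail_integrable by auto
      fix x
      define y z where "y = Y i x" and "z = Y (Suc i) x"
      have "(y + z)\<^sup>2 + z\<^sup>2 \<le> 2 * y\<^sup>2 + 3 * z\<^sup>2"
        using zero_le_power2[of "y - z"] by (simp add: power2_eq_square algebra_simps)
      also have "\<dots> \<le> 5 * \<epsilon>\<^sup>2 + (2 * tail_sq \<epsilon> y + 3 * tail_sq \<epsilon> z)"
        using sq_le_tail_sq[OF \<epsilon>(1), of y] sq_le_tail_sq[OF \<epsilon>(1), of z] by linarith
      finally have "\<Theta> i x * ((y + z)\<^sup>2 + z\<^sup>2) \<le> \<Theta> i x * (5 * \<epsilon>\<^sup>2) + \<Theta> i x * (2 * tail_sq \<epsilon> y + 3 * tail_sq \<epsilon> z)"
        unfolding distrib_left[symmetric] using \<Theta>_bounds[OF i] by (intro mult_left_mono) auto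
      also have "\<dots> \<le> (A i x + B i x) * (5 * \<epsilon>) + 2 * N * (2 * tail_sq \<epsilon> y + 3 * tail_sq \<epsilon> z)"
        using \<Theta>_bounds[OF i] A_nonneg[OF i] B_nonneg[OF i] \<epsilon> N by (intro add_mono mult_mono) (auto simp: power2_eq_square mult_left_le)
      finally show "\<Theta> i x * (Y i x + Y (Suc i) x)\<^sup>2 + \<Theta> i x * (Y (Suc i) x)\<^sup>2
        \<le> 5 * \<epsilon> * (A i x + B i x) + N * (4 * tail_sq \<epsilon> (Y i x) + 6 * tail_sq \<epsilon> (Y (Suc i) x))"
        unfolding y_def z_def by (simp add: algebra_simps)
    qed
    also have "\<dots> = 5 * \<epsilon> * expectation (\<lambda>x. A i x + B i x) + N * (4 * l i + 6 * l (Suc i))"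
      using i A_int B_int tail_integrable[of i \<epsilon>] tail_integrable[of "Suc i" \<epsilon>] unfolding l_def by simp
    finally show ?thesis .
  qed
  then have "(\<Sum>i<m. expectation (\<lambda>x. \<Theta> i x * (A i x + B i x)))
    \<le> (\<Sum>i<m. 5 * \<epsilon> * expectation (\<lambda>x. A i x + B i x) + N * (4 * l i + 6 * l (Suc i)))"
    by (intro sum_mono) auto
  also have "\<dots> = 5 * \<epsilon> * (\<Sum>i<m. expectation (\<lambda>x. A i x + B i x)) + N * (4 * (\<Sum>i<m. l i) + 6 * (\<Sum>i<m. l (Suc i)))"
    by (simp only: sum.distrib sum_distrib_left distrib_left)
  also have "N * (4 * (\<Sum>i<m. l i) + 6 * (\<Sum>i<m. l (Suc i))) \<le> N * (4 * \<Lambda> \<epsilon> + 6 * \<Lambda> \<epsilon>)"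
  proof -
    have "\<Lambda> \<epsilon> = sum l {..<Suc m}" by (simp add: \<Lambda>_def l_def lessThan_Suc_atMost)
    then have "sum l {..<m} \<le> \<Lambda> \<epsilon>" "(\<Sum>i<m. l (Suc i)) \<le> \<Lambda> \<epsilon>"
      using l[of m] l[of 0] sum.lessThan_Suc_shift[of l m] by simp_all
    then show ?thesis using N by (intro mult_left_mono) auto
  qed
  finally show ?thesis by simp
qed

text \<open>
  The telescoping expansion is integrated. Conditioning removes the quadratic part and replaces
  \<open>Y (Suc i)\<close> by \<open>C i\<close>, so the expectation of \<open>G m\<close> is close to \<open>1\<close>. As the sum of \<open>A i - B i\<close> is
  close to \<open>c \<le> N\<close>, where clipping has no effect, \<open>G m\<close> is in turn close to the exponential of the
  sum times \<open>exp (t\<^sup>2 c / 2)\<close>.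
\<close>
theorem char_bound:
  assumes \<epsilon>: "0 < \<epsilon>" "\<epsilon> \<le> 1"
  shows "cmod ((\<integral>x. iexp (t * (\<Sum>i<m. Y i x)) \<partial>P) * exp (t\<^sup>2 * c / 2) - 1)
    \<le> array_const t N * (\<delta>A + \<delta>B + \<delta>C + \<epsilon> + (1 + 1 / \<epsilon>) * \<Lambda> \<epsilon>)"
proof -
  define K0 where "K0 = exp (t\<^sup>2 * N / 2)"
  define K where "K = step_const t N"
  define En where "En = (\<Sum>i<m. expectation (\<lambda>x. A i x + B i x))"
  define \<delta> where "\<delta> = \<delta>A + \<delta>B"
  define L where "L = (1 + 1 / \<epsilon>) * \<Lambda> \<epsilon>"
  have K0: "1 \<le> K0" "0 \<le> K0" using N by (auto simp: K0_def)
  have K: "0 \<le> K" using N step_const_nonneg by (simp add: K_def)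
  have L: "0 \<le> L" "\<Lambda> \<epsilon> \<le> L" "\<Lambda> \<epsilon> / \<epsilon> \<le> L"
    using \<epsilon> \<Lambda>_nonneg[of \<epsilon>] by (auto simp: L_def distrib_right)
  have sumA: "integrable P (\<lambda>x. \<Sum>i<m. A i x)" and sumB: "integrable P (\<lambda>x. \<Sum>i<m. B i x)"
    using A_int B_int by auto
  have \<delta>AB: "0 \<le> \<delta>A" "0 \<le> \<delta>B" "0 \<le> \<delta>C"
    unfolding \<delta>A_def \<delta>B_def \<delta>C_def by (auto intro!: sum_nonneg Bochner_Integration.integral_nonneg)
  have \<delta>: "0 \<le> \<delta>" using \<delta>AB by (simp add: \<delta>_def)
  have int_n: "integrable P (\<lambda>x. \<Sum>i<m. A i x + B i x)" using A_int B_int by auto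
  have \<delta>_n: "expectation (\<lambda>x. \<bar>(\<Sum>i<m. A i x + B i x) - 3 * c\<bar>) \<le> \<delta>"
  proof -
    have "expectation (\<lambda>x. \<bar>(\<Sum>i<m. A i x + B i x) - 3 * c\<bar>)
      \<le> expectation (\<lambda>x. \<bar>(\<Sum>i<m. A i x) - 2 * c\<bar> + \<bar>(\<Sum>i<m. B i x) - c\<bar>)"
      using int_n sumA sumB by (intro integral_mono) (auto simp: sum.distrib)
    also have "\<dots> = \<delta>" unfolding \<delta>_def \<delta>A_def \<delta>B_def
      using sumA sumB by (intro Bochner_Integration.integral_add) auto
    finally show ?thesis .
  qed
  have \<delta>_v: "expectation (\<lambda>x. \<bar>c - (\<Sum>i<m. A i x - B i x)\<bar>) \<le> \<delta>"
  proof -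
    have "expectation (\<lambda>x. \<bar>c - (\<Sum>i<m. A i x - B i x)\<bar>)
      \<le> expectation (\<lambda>x. \<bar>(\<Sum>i<m. A i x) - 2 * c\<bar> + \<bar>(\<Sum>i<m. B i x) - c\<bar>)"
      using A_int B_int sumA sumB by (intro integral_mono) (auto simp: sum_subtractf)
    also have "\<dots> = \<delta>" unfolding \<delta>_def \<delta>A_def \<delta>B_def
      using sumA sumB by (intro Bochner_Integration.integral_add) auto
    finally show ?thesis .
  qed
  have En: "En \<le> N + \<delta>"
  proof -
    have "En = expectation (\<lambda>x. \<Sum>i<m. A i x + B i x)"
      unfolding En_def using A_int B_int by (subst Bochner_Integration.integral_sum) auto
    also have "\<dots> \<le> expectation (\<lambda>x. 3 * c + \<bar>(\<Sum>i<m. A i x + B i x) - 3 * c\<bar>)"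
      using int_n by (intro integral_mono) auto
    also have "\<dots> = 3 * c + expectation (\<lambda>x. \<bar>(\<Sum>i<m. A i x + B i x) - 3 * c\<bar>)"
      using int_n by (simp add: prob_space)
    finally show ?thesis using \<delta>_n c by simp
  qed

  \<comment> \<open>The main term of the telescoping expansion, split into products of the weight with one variable each so that the conditioning identities apply.\<close>
  define M1 where "M1 i x = \<i> * t * (G i x * complex_of_real (Y (Suc i) x))
      + complex_of_real (t\<^sup>2 / 2) * (G i x * complex_of_real (A i x) - G i x * complex_of_real (B i x)
        - G i x * complex_of_real ((Y i x + Y (Suc i) x)\<^sup>2) + G i x * complex_of_real ((Y (Suc i) x)\<^sup>2))" for i x
  have M1_int: "integrable P (M1 i)" if i: "i < m" for i
    unfolding M1_def using i
    by (intro Bochner_Integration.integrable_add Bochner_Integration.integrable_diff integrable_mult_right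
        G_integrable A_int B_int sum_sq_integrable Y_sq Y_integrable) auto
  have M1_E: "expectation (M1 i) = \<i> * t * expectation (\<lambda>x. G i x * complex_of_real (C i x))" if i: "i < m" for i
  proof -
    note I = G_integrable[OF less_imp_le[OF i] A_int[OF i]] G_integrable[OF less_imp_le[OF i] B_int[OF i]]
       G_integrable[OF less_imp_le[OF i] sum_sq_integrable[OF i]] G_integrable[OF less_imp_le[OF i] Y_sq[OF Suc_leI[OF i]]]
       G_integrable[OF less_imp_le[OF i] Y_integrable[OF Suc_leI[OF i]]]
    have "expectation (M1 i) = \<i> * t * expectation (\<lambda>x. G i x * complex_of_real (Y (Suc i) x))
      + complex_of_real (t\<^sup>2 / 2) * (expectation (\<lambda>x. G i x * complex_of_real (A i x)) - expectation (\<lambda>x. G i x * complex_of_real (B i x))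
        - expectation (\<lambda>x. G i x * complex_of_real ((Y i x + Y (Suc i) x)\<^sup>2)) + expectation (\<lambda>x. G i x * complex_of_real ((Y (Suc i) x)\<^sup>2)))"
      unfolding M1_def using I by (simp del: of_real_power of_real_add)
    also have "\<dots> = \<i> * t * expectation (\<lambda>x. G i x * complex_of_real (C i x))"
      using A_weight[OF i] B_weight[OF i] C_weight[OF i] unfolding G_def[symmetric] by simp
    finally show ?thesis .
  qed

  define W where "W x = G m x * (1 + \<i> * (t * Y m x)) - (1 + \<i> * (t * Y 0 x)) - (\<Sum>i<m. M1 i x)" for x
  define X where "X i x = \<Theta> i x * (A i x + B i x) + \<epsilon> * (A i x + B i x)
          + \<epsilon> * (Y i x)\<^sup>2 + (1 + 1 / \<epsilon>) * (tail_sq \<epsilon> (Y i x) + tail_sq \<epsilon> (Y (Suc i) x))" for i x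
  have GY: "integrable P (\<lambda>x. G m x * complex_of_real (Y m x))" by (intro G_integrable Y_integrable) auto
  have G1: "integrable P (\<lambda>x. G m x)" using G_integrable[of m "\<lambda>_. 1"] by simp
  have W_eq: "W x = G m x + \<i> * t * (G m x * complex_of_real (Y m x)) - (1 + \<i> * t * complex_of_real (Y 0 x)) - (\<Sum>i<m. M1 i x)" for x
    by (simp add: W_def algebra_simps)
  have W_int: "integrable P W" unfolding W_eq
    using GY G1 M1_int Y_integrable[of 0]
    by (intro Bochner_Integration.integrable_diff Bochner_Integration.integrable_add Bochner_Integration.integrable_sum
        integrable_mult_right integrable_of_real) auto
  have W_E: "expectation W = expectation (G m) + \<i> * t * expectation (\<lambda>x. G m x * complex_of_real (Y m x))
      - (1 + \<i> * t * complex_of_real (expectation (Y 0))) - (\<Sum>i<m. expectation (M1 i))"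
  proof -
    have i1: "integrable P (\<lambda>x. G m x + \<i> * t * (G m x * complex_of_real (Y m x)))"
      and i2: "integrable P (\<lambda>x. 1 + \<i> * t * complex_of_real (Y 0 x))"
      and i3: "integrable P (\<lambda>x. \<Sum>i<m. M1 i x)"
      using GY G1 M1_int Y_integrable[of 0]
      by (intro Bochner_Integration.integrable_add Bochner_Integration.integrable_sum
          integrable_mult_right integrable_of_real integrable_const; simp)+
    have "expectation W = expectation (\<lambda>x. G m x + \<i> * t * (G m x * complex_of_real (Y m x)))
      - expectation (\<lambda>x. 1 + \<i> * t * complex_of_real (Y 0 x)) - expectation (\<lambda>x. \<Sum>i<m. M1 i x)"
      unfolding W_eq using i1 i2 i3
      by (simp only: Bochner_Integration.integral_diff Bochner_Integration.integrable_diff)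
    moreover have "expectation (\<lambda>x. G m x + \<i> * t * (G m x * complex_of_real (Y m x)))
      = expectation (G m) + \<i> * t * expectation (\<lambda>x. G m x * complex_of_real (Y m x))"
      using GY G1 by (subst Bochner_Integration.integral_add) auto
    moreover have "expectation (\<lambda>x. 1 + \<i> * t * complex_of_real (Y 0 x)) = 1 + \<i> * t * complex_of_real (expectation (Y 0))"
      using Y_integrable[of 0] by (subst Bochner_Integration.integral_add) (auto simp: prob_space)
    moreover have "expectation (\<lambda>x. \<Sum>i<m. M1 i x) = (\<Sum>i<m. expectation (M1 i))"
      using M1_int by (subst Bochner_Integration.integral_sum) auto
    ultimately show ?thesis by simp
  qed
  have W_bound: "cmod (W x) \<le> K0 * (t\<^sup>2 * N * \<bar>(\<Sum>i<m. A i x + B i x) - 3 * c\<bar> + K * (\<Sum>i<m. X i x))" for x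
  proof -
    have *: "(\<Sum>i<m. M1 i x) = (\<Sum>i<m. G i x * (\<i> * (t * Y (Suc i) x)
           + (t\<^sup>2 / 2 * ((A i x - B i x) - (Y i x + Y (Suc i) x)\<^sup>2 + (Y (Suc i) x)\<^sup>2) :: real)))"
      by (intro sum.cong refl) (simp add: M1_def algebra_simps)
    show ?thesis unfolding W_def * K0_def K_def X_def G_def \<Theta>_def
      by (rule lindeberg_telescope) (use c \<epsilon> A_nonneg B_nonneg in auto)
  qed
  have X_int: "integrable P (X i)" if "i < m" for i
    unfolding X_def using that A_int B_int Y_sq tail_integrable
    by (intro Bochner_Integration.integrable_add integrable_mult_right \<Theta>_integrable) auto
  have X_E: "(\<Sum>i<m. expectation (X i)) \<le> 20 * (1 + N) * (\<delta> + \<epsilon> + L)"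
  proof -
    have "expectation (X i) = expectation (\<lambda>x. \<Theta> i x * (A i x + B i x)) + \<epsilon> * expectation (\<lambda>x. A i x + B i x)
       + \<epsilon> * expectation (\<lambda>x. (Y i x)\<^sup>2)
       + (1 + 1 / \<epsilon>) * (expectation (\<lambda>x. tail_sq \<epsilon> (Y i x)) + expectation (\<lambda>x. tail_sq \<epsilon> (Y (Suc i) x)))" if i: "i < m" for i
    proof -
      have "integrable P (\<lambda>x. \<Theta> i x * (A i x + B i x))" "integrable P (\<lambda>x. A i x + B i x)" "integrable P (\<lambda>x. (Y i x)\<^sup>2)"
        "integrable P (\<lambda>x. tail_sq \<epsilon> (Y i x))" "integrable P (\<lambda>x. tail_sq \<epsilon> (Y (Suc i) x))"
        using i A_int B_int Y_sq tail_integrable by (auto intro!: \<Theta>_integrable)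
      then show ?thesis unfolding X_def by (simp only: Bochner_Integration.integral_add Bochner_Integration.integrable_add integrable_mult_right integral_mult_right_zero)
    qed
    then have "(\<Sum>i<m. expectation (X i)) = (\<Sum>i<m. expectation (\<lambda>x. \<Theta> i x * (A i x + B i x))) + \<epsilon> * En
       + \<epsilon> * (\<Sum>i<m. expectation (\<lambda>x. (Y i x)\<^sup>2))
       + (1 + 1 / \<epsilon>) * ((\<Sum>i<m. expectation (\<lambda>x. tail_sq \<epsilon> (Y i x))) + (\<Sum>i<m. expectation (\<lambda>x. tail_sq \<epsilon> (Y (Suc i) x))))"
      by (simp add: En_def sum.distrib flip: sum_distrib_left)
    also have "\<dots> \<le> (5 * \<epsilon> * En + 10 * N * \<Lambda> \<epsilon>) + \<epsilon> * En + \<epsilon> * (1 + \<Lambda> \<epsilon> + En) + (1 + 1 / \<epsilon>) * (\<Lambda> \<epsilon> + \<Lambda> \<epsilon>)"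
    proof -
      define l where "l i = expectation (\<lambda>x. tail_sq \<epsilon> (Y i x))" for i
      have l: "0 \<le> l i" for i unfolding l_def by (auto intro!: Bochner_Integration.integral_nonneg)
      have "\<Lambda> \<epsilon> = sum l {..<Suc m}" by (simp add: \<Lambda>_def l_def lessThan_Suc_atMost)
      then have "sum l {..<m} \<le> \<Lambda> \<epsilon>" "(\<Sum>i<m. l (Suc i)) \<le> \<Lambda> \<epsilon>"
        using l[of m] l[of 0] sum.lessThan_Suc_shift[of l m] by simp_all
      then show ?thesis using expectation_\<Theta>[OF \<epsilon>] sum_Y_sq[OF \<epsilon>] \<epsilon> unfolding En_def[symmetric] l_def
        by (intro add_mono mult_left_mono order_refl) auto
    qed
    also have "\<dots> = 7 * (\<epsilon> * En) + 10 * N * \<Lambda> \<epsilon> + \<epsilon> + \<epsilon> * \<Lambda> \<epsilon> + 2 * L"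
      by (simp add: L_def algebra_simps)
    also have "\<dots> \<le> 7 * (N * \<epsilon> + \<delta>) + 10 * (N * L) + \<epsilon> + L + 2 * L"
    proof -
      have "\<epsilon> * En \<le> \<epsilon> * (N + \<delta>)" using En \<epsilon> by (intro mult_left_mono) auto
      also have "\<dots> \<le> N * \<epsilon> + \<delta>" using mult_left_le[of \<epsilon> \<delta>] \<epsilon> \<delta> by (simp add: algebra_simps)
      finally have 1: "\<epsilon> * En \<le> N * \<epsilon> + \<delta>" .
      have 2: "\<epsilon> * \<Lambda> \<epsilon> \<le> L" using \<epsilon> L(2) \<Lambda>_nonneg[of \<epsilon>] by (meson mult_left_le_one_le order_trans less_imp_le)
      have 3: "N * \<Lambda> \<epsilon> \<le> N * L" using L N by (intro mult_left_mono) auto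
      show ?thesis unfolding mult.assoc by (intro add_mono mult_left_mono order_refl 1 2 3) auto
    qed
    also have "\<dots> \<le> 20 * (1 + N) * (\<delta> + \<epsilon> + L)"
    proof -
      have "0 \<le> N * \<delta>" "0 \<le> N * \<epsilon>" "0 \<le> N * L" using N \<delta> \<epsilon> L by auto
      then show ?thesis using \<delta> \<epsilon> L by (simp add: algebra_simps)
    qed
    finally show ?thesis .
  qed
  have W_E_bound: "cmod (expectation W) \<le> K0 * (t\<^sup>2 * N * \<delta> + K * (20 * (1 + N) * (\<delta> + \<epsilon> + L)))"
  proof -
    have i1: "integrable P (\<lambda>x. t\<^sup>2 * N * \<bar>(\<Sum>i<m. A i x + B i x) - 3 * c\<bar>)" and i2: "integrable P (\<lambda>x. \<Sum>i<m. X i x)"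
      using int_n X_int by auto
    have "cmod (expectation W) \<le> expectation (\<lambda>x. K0 * (t\<^sup>2 * N * \<bar>(\<Sum>i<m. A i x + B i x) - 3 * c\<bar> + K * (\<Sum>i<m. X i x)))"
      by (rule norm_integral_le_integral[OF W_int _ W_bound]) (use i1 i2 in auto)
    also have "\<dots> = K0 * (t\<^sup>2 * N * expectation (\<lambda>x. \<bar>(\<Sum>i<m. A i x + B i x) - 3 * c\<bar>) + K * (\<Sum>i<m. expectation (X i)))"
      using i1 i2 X_int by simp
    also have "\<dots> \<le> K0 * (t\<^sup>2 * N * \<delta> + K * (20 * (1 + N) * (\<delta> + \<epsilon> + L)))"
      using \<delta>_n X_E K0 K N by (intro mult_left_mono add_mono) auto
    finally show ?thesis .
  qed
  have EY: "expectation (\<lambda>x. \<bar>Y i x\<bar>) \<le> \<epsilon> + L" if "i \<le> m" for i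
    using expectation_abs_Y[OF \<epsilon>(1) that] L by linarith
  have G_E: "cmod (expectation (G m) - 1) \<le> K0 * (t\<^sup>2 * N * \<delta> + K * (20 * (1 + N) * (\<delta> + \<epsilon> + L)))
     + \<bar>t\<bar> * (K0 * (\<epsilon> + L)) + \<bar>t\<bar> * (\<epsilon> + L) + \<bar>t\<bar> * (K0 * \<delta>C)"
  proof -
    have e: "expectation (G m) - 1 = expectation W - \<i> * t * expectation (\<lambda>x. G m x * complex_of_real (Y m x))
      + \<i> * t * complex_of_real (expectation (Y 0)) + \<i> * t * (\<Sum>i<m. expectation (\<lambda>x. G i x * complex_of_real (C i x)))"
      unfolding W_E using M1_E by (simp add: sum_distrib_left)
    have "cmod (\<i> * t * expectation (\<lambda>x. G m x * complex_of_real (Y m x))) \<le> \<bar>t\<bar> * (K0 * (\<epsilon> + L))"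
    proof -
      have "cmod (expectation (\<lambda>x. G m x * complex_of_real (Y m x))) \<le> K0 * expectation (\<lambda>x. \<bar>Y m x\<bar>)"
        unfolding K0_def by (rule norm_expectation_G) (auto intro: Y_integrable)
      also have "\<dots> \<le> K0 * (\<epsilon> + L)" using EY[of m] K0 by (intro mult_left_mono) auto
      finally show ?thesis by (simp add: norm_mult mult_left_mono)
    qed
    moreover have "cmod (\<i> * t * complex_of_real (expectation (Y 0))) \<le> \<bar>t\<bar> * (\<epsilon> + L)"
    proof -
      have "\<bar>expectation (Y 0)\<bar> \<le> \<epsilon> + L" using EY[of 0, OF le0] integral_abs_bound[of P "Y 0"] by linarith
      then show ?thesis by (simp add: norm_mult mult_left_mono)
    qed
    moreover have "cmod (\<i> * t * (\<Sum>i<m. expectation (\<lambda>x. G i x * complex_of_real (C i x)))) \<le> \<bar>t\<bar> * (K0 * \<delta>C)"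
    proof -
      have "cmod (\<Sum>i<m. expectation (\<lambda>x. G i x * complex_of_real (C i x))) \<le> (\<Sum>i<m. K0 * expectation (\<lambda>x. \<bar>C i x\<bar>))"
        unfolding K0_def by (intro sum_norm_le norm_expectation_G C_int) auto
      also have "\<dots> = K0 * \<delta>C" by (simp add: \<delta>C_def sum_distrib_left)
      finally show ?thesis by (simp add: norm_mult mult_left_mono)
    qed
    moreover have "cmod (w - u + v + z) \<le> cmod w + cmod u + cmod v + cmod z" for w u v z :: complex
      by (smt (verit) norm_triangle_ineq norm_triangle_ineq4)
    ultimately show ?thesis using W_E_bound unfolding e by (smt (verit, best))
  qed
  \<comment> \<open>Undo the weight: clipping does not change \<open>c\<close>, and clipping is a contraction.\<close>
  have U: "cmod (expectation (\<lambda>x. iexp (t * (\<Sum>i<m. Y i x))) * exp (t\<^sup>2 * c / 2) - expectation (G m)) \<le> K0 * (t\<^sup>2 / 2 * \<delta>)"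
  proof -
    have [measurable]: "(\<lambda>x. \<Sum>l<m. Y l x) \<in> borel_measurable P"
      by (auto intro!: borel_measurable_sum Y_meas)
    have iU: "integrable P (\<lambda>x. iexp (t * (\<Sum>i<m. Y i x)))"
      by (rule integrable_const_bound[where B=1]) (auto simp: norm_exp_i_times simp flip: of_real_mult)
    have "cmod (expectation (\<lambda>x. iexp (t * (\<Sum>i<m. Y i x))) * exp (t\<^sup>2 * c / 2) - expectation (G m))
      = cmod (expectation (\<lambda>x. iexp (t * (\<Sum>i<m. Y i x)) * exp (t\<^sup>2 * c / 2) - G m x))"
      using iU G1 by simp
    also have "\<dots> \<le> expectation (\<lambda>x. K0 * (t\<^sup>2 / 2 * \<bar>c - (\<Sum>i<m. A i x - B i x)\<bar>))"
    proof (rule norm_integral_le_integral)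
      show "integrable P (\<lambda>x. iexp (t * (\<Sum>i<m. Y i x)) * exp (t\<^sup>2 * c / 2) - G m x)"
        using iU G1 by auto
      show "integrable P (\<lambda>x. K0 * (t\<^sup>2 / 2 * \<bar>c - (\<Sum>i<m. A i x - B i x)\<bar>))"
        using A_int B_int
        by (intro integrable_mult_right integrable_abs Bochner_Integration.integrable_diff
            Bochner_Integration.integrable_sum integrable_const) auto
      fix x
      define v where "v = (\<Sum>i<m. A i x - B i x)"
      have "iexp (t * (\<Sum>i<m. Y i x)) * exp (t\<^sup>2 * c / 2) - G m x
        = iexp (t * (\<Sum>i<m. Y i x)) * complex_of_real (exp (t\<^sup>2 * c / 2) - exp (t\<^sup>2 / 2 * clip N v))"
        by (simp only: G_def lind_weight_def v_def exp_add exp_of_real of_real_diff right_diff_distrib)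
      also have "cmod \<dots> = \<bar>exp (t\<^sup>2 * c / 2) - exp (t\<^sup>2 / 2 * clip N v)\<bar>"
        by (simp only: norm_mult norm_of_real norm_exp_i_times mult_1_left)
      also have "\<dots> \<le> K0 * \<bar>t\<^sup>2 * c / 2 - t\<^sup>2 / 2 * clip N v\<bar>"
      proof (unfold K0_def, rule abs_exp_diff_le)
        show "t\<^sup>2 * c / 2 \<le> t\<^sup>2 * N / 2" using c by (intro divide_right_mono mult_left_mono) auto
        have "t\<^sup>2 / 2 * clip N v \<le> t\<^sup>2 / 2 * N" using clip_bounds[OF N(2), of v] by (intro mult_left_mono) auto
        then show "t\<^sup>2 / 2 * clip N v \<le> t\<^sup>2 * N / 2" by simp
      qed
      also have "\<bar>t\<^sup>2 * c / 2 - t\<^sup>2 / 2 * clip N v\<bar> = t\<^sup>2 / 2 * \<bar>clip N c - clip N v\<bar>"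
      proof -
        have "clip N c = c" using c by (intro clip_id) auto
        then have "t\<^sup>2 * c / 2 - t\<^sup>2 / 2 * clip N v = t\<^sup>2 / 2 * (clip N c - clip N v)"
          by (simp add: right_diff_distrib)
        then have "\<bar>t\<^sup>2 * c / 2 - t\<^sup>2 / 2 * clip N v\<bar> = \<bar>t\<^sup>2 / 2 * (clip N c - clip N v)\<bar>"
          by (rule arg_cong)
        then show ?thesis by (simp add: abs_mult)
      qed
      also have "\<dots> \<le> t\<^sup>2 / 2 * \<bar>c - v\<bar>" by (intro mult_left_mono clip_lipschitz) auto
      finally show "cmod (iexp (t * (\<Sum>i<m. Y i x)) * exp (t\<^sup>2 * c / 2) - G m x) \<le> K0 * (t\<^sup>2 / 2 * \<bar>c - (\<Sum>i<m. A i x - B i x)\<bar>)"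
        using K0 by (simp add: v_def mult_left_mono)
    qed
    also have "\<dots> = K0 * (t\<^sup>2 / 2 * expectation (\<lambda>x. \<bar>c - (\<Sum>i<m. A i x - B i x)\<bar>))" by simp
    also have "\<dots> \<le> K0 * (t\<^sup>2 / 2 * \<delta>)" using \<delta>_v K0 by (intro mult_left_mono) auto
    finally show ?thesis .
  qed
  have "cmod (expectation (\<lambda>x. iexp (t * (\<Sum>i<m. Y i x))) * exp (t\<^sup>2 * c / 2) - 1)
    \<le> K0 * (t\<^sup>2 / 2 * \<delta>) + (K0 * (t\<^sup>2 * N * \<delta> + K * (20 * (1 + N) * (\<delta> + \<epsilon> + L)))
     + \<bar>t\<bar> * (K0 * (\<epsilon> + L)) + \<bar>t\<bar> * (\<epsilon> + L) + \<bar>t\<bar> * (K0 * \<delta>C))"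
    using norm_triangle_mono[OF U G_E] by simp
  also have "\<dots> \<le> K0 * (3 * \<bar>t\<bar> + t\<^sup>2 * (N + 1) + 20 * (1 + N) * K) * (\<delta> + \<delta>C + \<epsilon> + L)"
  proof -
    define R where "R = \<delta> + \<delta>C + \<epsilon> + L"
    have R: "\<delta> \<le> R" "\<delta> + \<epsilon> + L \<le> R" "\<epsilon> + L \<le> R" "\<delta>C \<le> R" "0 \<le> \<epsilon> + L" "0 \<le> R"
      using \<delta> \<delta>AB \<epsilon> L by (auto simp: R_def)
    have "K0 * (t\<^sup>2 / 2 * \<delta>) \<le> K0 * (t\<^sup>2 * R)" using R K0 \<delta> by (intro mult_left_mono mult_mono) auto
    moreover have "K0 * (t\<^sup>2 * N * \<delta> + K * (20 * (1 + N) * (\<delta> + \<epsilon> + L))) \<le> K0 * (t\<^sup>2 * N * R + K * (20 * (1 + N) * R))"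
      using R K0 K N by (intro mult_left_mono add_mono) auto
    moreover have "\<bar>t\<bar> * (K0 * (\<epsilon> + L)) \<le> \<bar>t\<bar> * (K0 * R)" using R K0 by (intro mult_left_mono) auto
    moreover have "\<bar>t\<bar> * (\<epsilon> + L) \<le> \<bar>t\<bar> * (K0 * R)"
      using R K0 mult_mono[of 1 K0 "\<epsilon> + L" R] by (intro mult_left_mono) auto
    moreover have "\<bar>t\<bar> * (K0 * \<delta>C) \<le> \<bar>t\<bar> * (K0 * R)" using R K0 by (intro mult_left_mono) auto
    moreover have "K0 * (3 * \<bar>t\<bar> + t\<^sup>2 * (N + 1) + 20 * (1 + N) * K) * R
      = K0 * (t\<^sup>2 * R) + K0 * (t\<^sup>2 * N * R + K * (20 * (1 + N) * R)) + 3 * (\<bar>t\<bar> * (K0 * R))"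
      by (simp add: algebra_simps)
    ultimately show ?thesis unfolding R_def by linarith
  qed
  finally show ?thesis by (simp add: array_const_def K0_def K_def \<delta>_def L_def add_ac)
qed

end

section \<open>Conditional laws and conditional expectations\<close>

context quenched_setting
begin

text \<open>
  The kernel gives the conditional law of \<open>T\<close>; composing it with the inverse of \<open>T\<close> gives the
  conditional law of the identity, so that \<open>E\<^sub>0(X)(\<omega>)\<close> is the integral of \<open>X\<close> under \<open>cond_law \<omega>\<close>.
\<close>
definition cond_law :: "'a \<Rightarrow> 'a measure" where
  "cond_law \<omega> = distr (\<kappa> \<omega>) M (inv_into (space M) T)"

lemma space_F0: "space F0 = space M"
  using subalgebra_F0 by (simp add: subalgebra_def)

lemma cond_law_measurable: "cond_law \<in> measurable F0 (prob_algebra M)"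
  unfolding cond_law_def[abs_def]
  by (rule measurable_compose[OF kernel_measurable measurable_distr_prob_space[OF measurable_inv_T]])

lemma cond_law_measurable_M: "cond_law \<in> measurable M (subprob_algebra M)"
  by (rule measurable_prob_algebraD, rule measurable_from_subalg[OF subalgebra_F0 cond_law_measurable])

lemma sets_cond_law [simp, measurable_cong]: "sets (cond_law \<omega>) = sets M"
  by (simp add: cond_law_def)

lemma space_cond_law [simp]: "space (cond_law \<omega>) = space M"
  by (simp add: cond_law_def)

lemma prob_space_cond_law: "\<omega> \<in> space M \<Longrightarrow> prob_space (cond_law \<omega>)"
  using measurable_space[OF cond_law_measurable, of \<omega>] by (simp add: space_F0 space_prob_algebra)

lemma sets_kernel: "\<omega> \<in> space M \<Longrightarrow> sets (\<kappa> \<omega>) = sets M"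
  using measurable_space[OF kernel_measurable, of \<omega>] by (simp add: space_F0 space_prob_algebra)

lemma inv_T_kernel_measurable: "\<omega> \<in> space M \<Longrightarrow> inv_into (space M) T \<in> measurable (\<kappa> \<omega>) M"
  using measurable_inv_T measurable_cong_sets[OF sets_kernel refl] by blast

lemma inv_T_T: "x \<in> space M \<Longrightarrow> inv_into (space M) T (T x) = x"
  using bij_T by (simp add: bij_betw_def inv_into_f_f)

lemma T_space: "x \<in> space M \<Longrightarrow> T x \<in> space M"
  using measurable_space[OF measurable_T] .

lemma T_funpow_measurable [measurable]: "T ^^ k \<in> measurable M M"
  by (rule measurable_compose_n[OF measurable_T])

lemma inv_T_funpow_measurable [measurable]: "inv_into (space M) T ^^ k \<in> measurable M M"
  by (rule measurable_compose_n[OF measurable_inv_T])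

lemma T_funpow_space: "x \<in> space M \<Longrightarrow> (T ^^ k) x \<in> space M"
  using measurable_space[OF T_funpow_measurable] .

lemma inv_T_T_funpow: "x \<in> space M \<Longrightarrow> (inv_into (space M) T ^^ k) ((T ^^ k) x) = x"
proof (induction k)
  case (Suc k)
  have "(inv_into (space M) T ^^ Suc k) ((T ^^ Suc k) x) = (inv_into (space M) T ^^ k) (inv_into (space M) T (T ((T ^^ k) x)))"
    by (simp add: funpow_swap1)
  also have "\<dots> = x" using Suc by (simp add: inv_T_T T_funpow_space)
  finally show ?case .
qed simp

lemma distr_T_funpow: "distr M M (T ^^ k) = M"
proof (induction k)
  case 0
  have "distr M M (T ^^ 0) = distr M M (\<lambda>x. x)" by (rule distr_cong) auto
  then show ?case by (simp add: distr_id)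
next
  case (Suc k)
  have "distr M M (T ^^ Suc k) = distr (distr M M (T ^^ k)) M T"
    using distr_distr[OF measurable_T T_funpow_measurable, of k] by (simp only: funpow.simps)
  then show ?case using Suc preserving_T by (simp only:)
qed

lemma int_iter_nat: "int_iter \<Omega> T (int k) = T ^^ k"
  by (simp add: int_iter_def)

lemma int_iter_neg: "int_iter (space M) T (- int k - 1) = (inv_into (space M) T ^^ k) \<circ> inv_into (space M) T"
proof -
  have "nat (1 + int k) = Suc k" by simp
  moreover have "\<not> 0 \<le> - int k - 1" by simp
  ultimately show ?thesis by (simp add: int_iter_def funpow_Suc_right del: funpow.simps)
qed

lemma kexp_nat:
  assumes X: "X \<in> borel_measurable M" and \<omega>: "\<omega> \<in> space M"
  shows "kexp M T \<kappa> (int k) X \<omega> = (\<integral>x. X ((inv_into (space M) T ^^ k) x) \<partial>cond_law ((T ^^ k) \<omega>))"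
proof -
  have "(\<lambda>x. X ((inv_into (space M) T ^^ k) x)) \<in> borel_measurable M"
    using X by measurable
  then show ?thesis
    unfolding kexp_def kernel_op_def cond_law_def int_iter_nat int_iter_neg
    by (subst integral_distr[OF inv_T_kernel_measurable[OF T_funpow_space[OF \<omega>]]]) auto
qed

lemma kexp_0:
  assumes "X \<in> borel_measurable M" "\<omega> \<in> space M"
  shows "kexp M T \<kappa> 0 X \<omega> = (\<integral>x. X x \<partial>cond_law \<omega>)"
  using kexp_nat[OF assms, of 0] by simp

lemma finite_measure_subalgebra_F: "subalgebra M F \<Longrightarrow> finite_measure_subalgebra M F"
  by unfold_locales

lemma cond_law_version:
  assumes A: "A \<in> sets M"
  shows "AE \<omega> in M. measure (cond_law \<omega>) A = real_cond_exp M F0 (indicator A) \<omega>"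
proof -
  define A' where "A' = inv_into (space M) T -` A \<inter> space M"
  have A': "A' \<in> sets M" unfolding A'_def by (rule measurable_sets[OF measurable_inv_T A])
  have "T -` A' \<inter> space M = A"
    using sets.sets_into_space[OF A] by (auto simp: A'_def T_space inv_T_T)
  with kernel_version[OF A'] have "AE \<omega> in M. measure (\<kappa> \<omega>) A' = real_cond_exp M F0 (indicator A) \<omega>"
    by simp
  then show ?thesis
  proof (rule AE_mp, intro AE_I2 impI)
    fix \<omega> assume \<omega>: "\<omega> \<in> space M" and eq: "measure (\<kappa> \<omega>) A' = real_cond_exp M F0 (indicator A) \<omega>"
    have "measure (cond_law \<omega>) A = measure (\<kappa> \<omega>) A'"
      unfolding cond_law_def A'_def
      by (subst measure_distr[OF inv_T_kernel_measurable[OF \<omega>] A])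
         (simp add: sets_eq_imp_space_eq[OF sets_kernel[OF \<omega>]])
    then show "measure (cond_law \<omega>) A = real_cond_exp M F0 (indicator A) \<omega>" using eq by simp
  qed
qed

text \<open>
  Disintegration of \<open>M\<close> restricted to a set \<open>B\<close> of \<open>F0\<close>. Stated as an identity of measures, it yields
  the defining property of the conditional expectation for all nonnegative functions at once.
\<close>
lemma bind_cond_law:
  assumes B: "B \<in> sets F0"
  shows "density M (indicator B) \<bind> cond_law = density M (indicator B)"
proof (rule measure_eqI)
  interpret F0: finite_measure_subalgebra M F0
    by (rule finite_measure_subalgebra_F[OF subalgebra_F0])
  have BM: "B \<in> sets M" using B subalgebra_F0 by (auto simp: subalgebra_def)
  have ne: "space (density M (indicator B)) \<noteq> {}" by (simp add: not_empty)
  have cl: "cond_law \<in> measurable (density M (indicator B)) (subprob_algebra M)"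
    using cond_law_measurable_M by (simp cong: measurable_cong_sets)
  have s: "sets (density M (indicator B) \<bind> cond_law) = sets M"
    by (rule sets_bind[OF _ ne]) simp
  then show "sets (density M (indicator B) \<bind> cond_law) = sets (density M (indicator B))" by simp
  fix A assume "A \<in> sets (density M (indicator B) \<bind> cond_law)"
  then have A: "A \<in> sets M" using s by simp
  have [measurable]: "(\<lambda>\<omega>. emeasure (cond_law \<omega>) A) \<in> borel_measurable M"
    using measurable_compose[OF cond_law_measurable_M measurable_emeasure_subprob_algebra[OF A]] .
  have "emeasure (density M (indicator B) \<bind> cond_law) A = (\<integral>\<^sup>+\<omega>. emeasure (cond_law \<omega>) A \<partial>density M (indicator B))"
    by (rule emeasure_bind[OF ne cl A])
  also have "\<dots> = (\<integral>\<^sup>+\<omega>. indicator B \<omega> * emeasure (cond_law \<omega>) A \<partial>M)"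
    using BM by (intro nn_integral_density) auto
  also have "\<dots> = (\<integral>\<^sup>+\<omega>. ennreal (indicator B \<omega> * real_cond_exp M F0 (indicator A) \<omega>) \<partial>M)"
  proof (rule nn_integral_cong_AE, rule AE_mp[OF cond_law_version[OF A]], intro AE_I2 impI)
    fix \<omega> assume \<omega>: "\<omega> \<in> space M" and eq: "measure (cond_law \<omega>) A = real_cond_exp M F0 (indicator A) \<omega>"
    interpret P: prob_space "cond_law \<omega>" by (rule prob_space_cond_law[OF \<omega>])
    show "indicator B \<omega> * emeasure (cond_law \<omega>) A = ennreal (indicator B \<omega> * real_cond_exp M F0 (indicator A) \<omega>)"
      by (simp add: P.emeasure_eq_measure eq indicator_def)
  qed
  also have "\<dots> = ennreal (\<integral>\<omega>. indicator B \<omega> * real_cond_exp M F0 (indicator A) \<omega> \<partial>M)"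
  proof (rule nn_integral_eq_integral)
    have iA: "integrable M (indicator A :: _ \<Rightarrow> real)" using A by (simp add: emeasure_eq_measure)
    show "integrable M (\<lambda>\<omega>. indicator B \<omega> * real_cond_exp M F0 (indicator A) \<omega>)"
      using integrable_mult_indicator[OF BM F0.real_cond_exp_int(1)[OF iA]] by simp
    have "AE \<omega> in M. 0 \<le> real_cond_exp M F0 (indicator A) \<omega>"
      using A by (intro F0.real_cond_exp_pos) auto
    then show "AE \<omega> in M. 0 \<le> indicator B \<omega> * real_cond_exp M F0 (indicator A) \<omega>" by eventually_elim simp
  qed
  also have "(\<integral>\<omega>. indicator B \<omega> * real_cond_exp M F0 (indicator A) \<omega> \<partial>M) = (\<integral>\<omega>. indicator B \<omega> * indicator A \<omega> \<partial>M)"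
    using F0.real_cond_exp_intA[of "indicator A" B] A B
    by (simp add: set_lebesgue_integral_def emeasure_eq_measure)
  also have "\<dots> = measure M (B \<inter> A)"
    using A BM by (simp flip: indicator_inter_arith)
  finally show "emeasure (density M (indicator B) \<bind> cond_law) A = emeasure (density M (indicator B)) A"
    using A BM by (simp add: emeasure_density emeasure_eq_measure mult.commute[of "indicator B _"] nn_integral_restrict_space Int_commute flip: indicator_inter_arith)
qed

lemma nn_integral_cond_law:
  assumes B: "B \<in> sets F0" and X: "X \<in> borel_measurable M"
  shows "(\<integral>\<^sup>+\<omega>. indicator B \<omega> * (\<integral>\<^sup>+x. X x \<partial>cond_law \<omega>) \<partial>M) = (\<integral>\<^sup>+\<omega>. indicator B \<omega> * X \<omega> \<partial>M)"
proof -
  have BM: "B \<in> sets M" using B subalgebra_F0 by (auto simp: subalgebra_def)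
  have cl: "cond_law \<in> measurable (density M (indicator B)) (subprob_algebra M)"
    using cond_law_measurable_M by (simp cong: measurable_cong_sets)
  have m: "(\<lambda>\<omega>. \<integral>\<^sup>+x. X x \<partial>cond_law \<omega>) \<in> borel_measurable M"
    using measurable_compose[OF cond_law_measurable_M nn_integral_measurable_subprob_algebra[OF X]] .
  have "(\<integral>\<^sup>+\<omega>. indicator B \<omega> * (\<integral>\<^sup>+x. X x \<partial>cond_law \<omega>) \<partial>M) = (\<integral>\<^sup>+\<omega>. \<integral>\<^sup>+x. X x \<partial>cond_law \<omega> \<partial>density M (indicator B))"
    using BM m by (intro nn_integral_density[symmetric]) auto
  also have "\<dots> = (\<integral>\<^sup>+x. X x \<partial>(density M (indicator B) \<bind> cond_law))"
    by (rule nn_integral_bind[OF X cl, symmetric])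
  also have "\<dots> = (\<integral>\<^sup>+\<omega>. indicator B \<omega> * X \<omega> \<partial>M)"
    unfolding bind_cond_law[OF B] using BM X by (intro nn_integral_density) auto
  finally show ?thesis .
qed

text \<open>
  The conditional probabilities of a null set average to its probability.
\<close>
lemma AE_cond_law:
  assumes X: "AE x in M. Q x"
  shows "AE \<omega> in M. AE x in cond_law \<omega>. Q x"
proof -
  obtain N where N: "{x \<in> space M. \<not> Q x} \<subseteq> N" "emeasure M N = 0" and NM: "N \<in> sets M"
    using AE_E[OF X] by blast
  have "(\<integral>\<^sup>+\<omega>. emeasure (cond_law \<omega>) N \<partial>M) = 0"
    using nn_integral_cond_law[OF sets.top, of "indicator N"] N NM
    by (simp add: space_F0 cong: nn_integral_cong_simp) 
  moreover have "(\<lambda>\<omega>. emeasure (cond_law \<omega>) N) \<in> borel_measurable M"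
    using measurable_compose[OF cond_law_measurable_M measurable_emeasure_subprob_algebra[OF NM]] .
  ultimately have "AE \<omega> in M. emeasure (cond_law \<omega>) N = 0"
    by (simp add: nn_integral_0_iff_AE)
  then show ?thesis
  proof eventually_elim
    case (elim \<omega>)
    then have "N \<in> null_sets (cond_law \<omega>)" using NM by auto
    then show ?case by (rule AE_I') (use N in auto)
  qed
qed

lemma cond_law_integrable:
  assumes X: "integrable M (X :: 'a \<Rightarrow> real)"
  shows "AE \<omega> in M. integrable (cond_law \<omega>) X"
proof -
  have [measurable]: "X \<in> borel_measurable M" using X by auto
  have m: "(\<lambda>\<omega>. \<integral>\<^sup>+x. ennreal (norm (X x)) \<partial>cond_law \<omega>) \<in> borel_measurable M"
    by (rule measurable_compose[OF cond_law_measurable_M nn_integral_measurable_subprob_algebra]) measurable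
  have "(\<integral>\<^sup>+\<omega>. (\<integral>\<^sup>+x. ennreal (norm (X x)) \<partial>cond_law \<omega>) \<partial>M) = (\<integral>\<^sup>+\<omega>. ennreal (norm (X \<omega>)) \<partial>M)"
    using nn_integral_cond_law[OF sets.top, of "\<lambda>x. ennreal (norm (X x))"]
    by (simp add: space_F0 cong: nn_integral_cong_simp)
  also have "\<dots> < \<infinity>" using X by (simp add: integrable_iff_bounded)
  finally have "AE \<omega> in M. (\<integral>\<^sup>+x. ennreal (norm (X x)) \<partial>cond_law \<omega>) \<noteq> \<infinity>"
    using m by (intro nn_integral_PInf_AE) auto
  then show ?thesis
    by eventually_elim (auto simp: integrable_iff_bounded top.not_eq_extremum cong: measurable_cong_sets)
qed

lemma cond_law_integral_measurable:
  fixes X :: "'a \<Rightarrow> 'b::{banach, second_countable_topology}"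
  assumes "X \<in> borel_measurable M"
  shows "(\<lambda>\<omega>. \<integral>x. X x \<partial>cond_law \<omega>) \<in> borel_measurable F0"
  using measurable_compose[OF measurable_prob_algebraD[OF cond_law_measurable] integral_measurable_subprob_algebra[OF assms]] .

lemma cond_law_integral_nonneg:
  assumes X: "integrable M (X :: 'a \<Rightarrow> real)" and pos: "\<And>x. 0 \<le> X x" and B: "B \<in> sets F0"
  shows "(\<integral>\<^sup>+\<omega>. ennreal (indicator B \<omega> * (\<integral>x. X x \<partial>cond_law \<omega>)) \<partial>M) = ennreal (\<integral>\<omega>. indicator B \<omega> * X \<omega> \<partial>M)"
proof -
  have [measurable]: "X \<in> borel_measurable M" using X by auto
  have BM: "B \<in> sets M" using B subalgebra_F0 by (auto simp: subalgebra_def)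
  have "(\<integral>\<^sup>+\<omega>. ennreal (indicator B \<omega> * (\<integral>x. X x \<partial>cond_law \<omega>)) \<partial>M) = (\<integral>\<^sup>+\<omega>. indicator B \<omega> * (\<integral>\<^sup>+x. X x \<partial>cond_law \<omega>) \<partial>M)"
  proof (rule nn_integral_cong_AE, rule AE_mp[OF cond_law_integrable[OF X]], intro AE_I2 impI)
    fix \<omega> assume "integrable (cond_law \<omega>) X"
    then have "(\<integral>\<^sup>+x. X x \<partial>cond_law \<omega>) = ennreal (\<integral>x. X x \<partial>cond_law \<omega>)"
      using pos by (intro nn_integral_eq_integral) auto
    then show "ennreal (indicator B \<omega> * (\<integral>x. X x \<partial>cond_law \<omega>)) = indicator B \<omega> * (\<integral>\<^sup>+x. X x \<partial>cond_law \<omega>)"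
      by (simp add: indicator_def)
  qed
  also have "\<dots> = (\<integral>\<^sup>+\<omega>. indicator B \<omega> * ennreal (X \<omega>) \<partial>M)"
    by (rule nn_integral_cond_law[OF B]) measurable
  also have "\<dots> = (\<integral>\<^sup>+\<omega>. ennreal (indicator B \<omega> * X \<omega>) \<partial>M)"
    by (intro nn_integral_cong) (simp add: indicator_def)
  also have "\<dots> = ennreal (\<integral>\<omega>. indicator B \<omega> * X \<omega> \<partial>M)"
    using pos integrable_mult_indicator[OF BM X] by (intro nn_integral_eq_integral) auto
  finally show ?thesis .
qed

lemma cond_law_integral_nonneg_version:
  assumes X: "integrable M (X :: 'a \<Rightarrow> real)" and pos: "\<And>x. 0 \<le> X x"
  shows "integrable M (\<lambda>\<omega>. \<integral>x. X x \<partial>cond_law \<omega>)"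
    "AE \<omega> in M. (\<integral>x. X x \<partial>cond_law \<omega>) = real_cond_exp M F0 X \<omega>"
proof -
  interpret F0: finite_measure_subalgebra M F0
    by (rule finite_measure_subalgebra_F[OF subalgebra_F0])
  define g where "g \<omega> = (\<integral>x. X x \<partial>cond_law \<omega>)" for \<omega>
  have g: "0 \<le> g \<omega>" for \<omega> unfolding g_def using pos by (auto intro: Bochner_Integration.integral_nonneg)
  have gF: "g \<in> borel_measurable F0" unfolding g_def using X by (intro cond_law_integral_measurable) auto
  then have gM [measurable]: "g \<in> borel_measurable M" by (rule measurable_from_subalg[OF subalgebra_F0])
  have int_g: "integrable M g"
  proof (rule integrableI_bounded)
    have "(\<integral>\<^sup>+\<omega>. ennreal (norm (g \<omega>)) \<partial>M) = (\<integral>\<^sup>+\<omega>. ennreal (indicator (space F0) \<omega> * g \<omega>) \<partial>M)"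
      using g by (intro nn_integral_cong) (auto simp: space_F0)
    also have "\<dots> < \<infinity>" using cond_law_integral_nonneg[OF X pos sets.top] by (simp add: g_def)
    finally show "(\<integral>\<^sup>+\<omega>. ennreal (norm (g \<omega>)) \<partial>M) < \<infinity>" .
  qed simp
  then show "integrable M (\<lambda>\<omega>. \<integral>x. X x \<partial>cond_law \<omega>)" by (simp only: g_def[abs_def])
  have "AE \<omega> in M. real_cond_exp M F0 X \<omega> = g \<omega>"
  proof (rule F0.real_cond_exp_charact)
    fix B assume B: "B \<in> sets F0"
    then have BM: "B \<in> sets M" using subalgebra_F0 by (auto simp: subalgebra_def)
    have iB: "integrable M (\<lambda>\<omega>. indicator B \<omega> * g \<omega>)" using integrable_mult_indicator[OF BM int_g] by simp
    have "ennreal (\<integral>\<omega>. indicator B \<omega> * g \<omega> \<partial>M) = (\<integral>\<^sup>+\<omega>. ennreal (indicator B \<omega> * g \<omega>) \<partial>M)"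
      using iB g by (intro nn_integral_eq_integral[symmetric]) auto
    also have "\<dots> = ennreal (\<integral>\<omega>. indicator B \<omega> * X \<omega> \<partial>M)"
      unfolding g_def by (rule cond_law_integral_nonneg[OF X pos B])
    finally have "(\<integral>\<omega>. indicator B \<omega> * g \<omega> \<partial>M) = (\<integral>\<omega>. indicator B \<omega> * X \<omega> \<partial>M)"
      using g pos by (subst (asm) ennreal_inj) (auto intro!: Bochner_Integration.integral_nonneg)
    then show "(\<integral>\<omega>\<in>B. X \<omega> \<partial>M) = (\<integral>\<omega>\<in>B. g \<omega> \<partial>M)" by (simp add: set_lebesgue_integral_def)
  qed (use X int_g gF in auto)
  then show "AE \<omega> in M. (\<integral>x. X x \<partial>cond_law \<omega>) = real_cond_exp M F0 X \<omega>"
    by eventually_elim (simp add: g_def)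
qed

lemma cond_law_integral_version:
  assumes X: "integrable M (X :: 'a \<Rightarrow> real)"
  shows "integrable M (\<lambda>\<omega>. \<integral>x. X x \<partial>cond_law \<omega>)"
    "AE \<omega> in M. (\<integral>x. X x \<partial>cond_law \<omega>) = real_cond_exp M F0 X \<omega>"
proof -
  interpret F0: finite_measure_subalgebra M F0
    by (rule finite_measure_subalgebra_F[OF subalgebra_F0])
  have p: "integrable M (\<lambda>x. max 0 (X x))" "integrable M (\<lambda>x. max 0 (- X x))" using X by auto
  note v1 = cond_law_integral_nonneg_version[OF p(1) max.cobounded1] and v2 = cond_law_integral_nonneg_version[OF p(2) max.cobounded1]
  have X_eq: "X = (\<lambda>x. max 0 (X x) - max 0 (- X x))" by auto
  have eq: "AE \<omega> in M. (\<integral>x. X x \<partial>cond_law \<omega>) = (\<integral>x. max 0 (X x) \<partial>cond_law \<omega>) - (\<integral>x. max 0 (- X x) \<partial>cond_law \<omega>)"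
    using cond_law_integrable[OF p(1)] cond_law_integrable[OF p(2)]
  proof eventually_elim
    case (elim \<omega>)
    then show ?case by (subst X_eq) (rule Bochner_Integration.integral_diff)
  qed
  have m: "(\<lambda>\<omega>. \<integral>x. X x \<partial>cond_law \<omega>) \<in> borel_measurable M"
    by (rule measurable_from_subalg[OF subalgebra_F0 cond_law_integral_measurable]) (use X in auto)
  show "integrable M (\<lambda>\<omega>. \<integral>x. X x \<partial>cond_law \<omega>)"
    by (rule integrable_cong_AE_imp[OF Bochner_Integration.integrable_diff[OF v1(1) v2(1)] m]) (use eq in auto)
  have d: "AE \<omega> in M. real_cond_exp M F0 X \<omega> = real_cond_exp M F0 (\<lambda>x. max 0 (X x)) \<omega> - real_cond_exp M F0 (\<lambda>x. max 0 (- X x)) \<omega>"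
    using F0.real_cond_exp_diff[OF p] X_eq by simp
  show "AE \<omega> in M. (\<integral>x. X x \<partial>cond_law \<omega>) = real_cond_exp M F0 X \<omega>"
    using eq d v1(2) v2(2) by eventually_elim auto
qed

definition F :: "nat \<Rightarrow> 'a measure" where
  "F k = vimage_algebra (space M) (T ^^ k) F0"

lemma space_F [simp]: "space (F k) = space M"
  by (simp add: F_def)

lemma T_funpow_F [measurable]: "T ^^ k \<in> measurable (F k) F0"
  unfolding F_def by (rule measurable_vimage_algebra1) (auto simp: space_F0 T_funpow_space)

lemma sets_F: "sets (F k) = {(T ^^ k) -` A \<inter> space M | A. A \<in> sets F0}"
  unfolding F_def by (rule sets_vimage_algebra2) (auto simp: space_F0 T_funpow_space)

lemma F_Suc: "sets (F k) \<subseteq> sets (F (Suc k))"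
proof
  fix S assume "S \<in> sets (F k)"
  then obtain A where A: "A \<in> sets F0" "S = (T ^^ k) -` A \<inter> space M" by (auto simp: sets_F)
  have "sets (vimage_algebra (space M) T F0) = {T -` A \<inter> space M | A. A \<in> sets F0}"
    by (rule sets_vimage_algebra2) (auto simp: space_F0 T_space)
  then obtain B where B: "B \<in> sets F0" "A = T -` B \<inter> space M" using A F0_subset_vimage by auto
  have "S = (T ^^ Suc k) -` B \<inter> space M" using A B by (auto simp: T_funpow_space)
  then show "S \<in> sets (F (Suc k))" using B unfolding sets_F by blast
qed

lemma F_mono: "j \<le> k \<Longrightarrow> sets (F j) \<subseteq> sets (F k)"
  using lift_Suc_mono_le[of "\<lambda>k. sets (F k)", OF F_Suc] .

lemma sets_F_0: "sets (F 0) = sets F0"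
proof -
  have "(T ^^ 0) -` A \<inter> space M = A" if "A \<in> sets F0" for A
    using sets.sets_into_space[OF that] by (auto simp: space_F0)
  then have "{(T ^^ 0) -` A \<inter> space M |A. A \<in> sets F0} = {A |A. A \<in> sets F0}"
    by (intro Collect_cong ex_cong1) (auto simp del: funpow.simps)
  then show ?thesis unfolding sets_F by simp
qed

lemma subalgebra_F: "subalgebra M (F k)"
proof -
  have "T ^^ k \<in> measurable M F0"
    using T_funpow_measurable[of k] subalgebra_F0
    by (auto simp: measurable_def subalgebra_def)
  then have "sets (F k) \<subseteq> sets M" by (auto simp: sets_F intro: measurable_sets)
  then show ?thesis by (simp add: subalgebra_def)
qed

lemma subalgebra_F_F0: "subalgebra (F k) F0"
  using F_mono[of 0 k] by (auto simp: subalgebra_def space_F0 sets_F_0)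

lemma measurable_F_mono:
  assumes "j \<le> k" "X \<in> measurable (F j) N"
  shows "X \<in> measurable (F k) N"
  by (rule measurable_from_subalg[OF _ assms(2)]) (use F_mono[OF assms(1)] in \<open>auto simp: subalgebra_def\<close>)

lemma integral_T_funpow:
  assumes "X \<in> borel_measurable M"
  shows "(\<integral>x. X ((T ^^ k) x) \<partial>M) = (\<integral>x. (X x :: real) \<partial>M)"
  using integral_distr[OF T_funpow_measurable assms, of k] by (simp add: distr_T_funpow)

lemma integrable_T_funpow:
  assumes "integrable M X"
  shows "integrable M (\<lambda>x. X ((T ^^ k) x) :: real)"
  using integrable_distr[OF T_funpow_measurable, of k X] assms by (simp add: distr_T_funpow)

lemma integrable_inv_T_funpow:
  assumes "integrable M X"
  shows "integrable M (\<lambda>x. X ((inv_into (space M) T ^^ k) x) :: real)"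
proof -
  have m: "X \<in> borel_measurable M" using assms by auto
  have "integrable (distr M M (T ^^ k)) (\<lambda>x. X ((inv_into (space M) T ^^ k) x))
    \<longleftrightarrow> integrable M (\<lambda>x. X ((inv_into (space M) T ^^ k) ((T ^^ k) x)))"
    using m by (intro integrable_distr_eq) auto
  also have "\<dots> \<longleftrightarrow> integrable M X"
    using inv_T_T_funpow by (intro Bochner_Integration.integrable_cong) auto
  finally show ?thesis using assms by (simp add: distr_T_funpow)
qed

lemma kexp_measurable_F:
  assumes X: "X \<in> borel_measurable M"
  shows "kexp M T \<kappa> (int k) X \<in> borel_measurable (F k)"
proof -
  have m: "(\<lambda>x. X ((inv_into (space M) T ^^ k) x)) \<in> borel_measurable M"
    using X by measurable
  have "(\<lambda>\<omega>. \<integral>x. X ((inv_into (space M) T ^^ k) x) \<partial>cond_law ((T ^^ k) \<omega>)) \<in> borel_measurable (F k)"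
    using measurable_compose[OF T_funpow_F cond_law_integral_measurable[OF m]] .
  then show ?thesis
    by (subst measurable_cong[OF kexp_nat[OF X]]) auto
qed

lemma kexp_measurable [measurable]:
  assumes X: "X \<in> borel_measurable M"
  shows "kexp M T \<kappa> (int k) X \<in> borel_measurable M"
  by (rule measurable_from_subalg[OF subalgebra_F kexp_measurable_F[OF X]])

text \<open>
  The expectation operator at time \<open>k\<close> is the one at time \<open>0\<close> transported by \<open>T\<^sup>k\<close>, and \<open>T\<^sup>k\<close> preserves
  the measure, while \<open>F\<^sub>k\<close> consists of the preimages of sets of \<open>F0\<close> under \<open>T\<^sup>k\<close>.
\<close>
lemma kexp_version:
  assumes X: "integrable M X"
  shows "integrable M (kexp M T \<kappa> (int k) X)"
    and "AE \<omega> in M. real_cond_exp M (F k) X \<omega> = kexp M T \<kappa> (int k) X \<omega>"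
proof -
  interpret Fk: finite_measure_subalgebra M "F k"
    by (rule finite_measure_subalgebra_F[OF subalgebra_F])
  interpret F0: finite_measure_subalgebra M F0
    by (rule finite_measure_subalgebra_F[OF subalgebra_F0])
  \<comment> \<open>Both sides are pulled back to time \<open>0\<close>.\<close>
  define Z where "Z x = X ((inv_into (space M) T ^^ k) x)" for x
  define g where "g \<omega> = (\<integral>x. Z x \<partial>cond_law \<omega>)" for \<omega>
  have XM: "X \<in> borel_measurable M" using X by auto
  have Z: "integrable M Z" unfolding Z_def[abs_def] by (rule integrable_inv_T_funpow[OF X])
  have g_int: "integrable M g" and g_eq: "AE \<omega> in M. g \<omega> = real_cond_exp M F0 Z \<omega>"
    using cond_law_integral_version[OF Z] by (simp_all add: g_def[abs_def])
  have gM: "g \<in> borel_measurable M" using g_int by auto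
  have kexp_eq: "kexp M T \<kappa> (int k) X \<omega> = g ((T ^^ k) \<omega>)" if "\<omega> \<in> space M" for \<omega>
    unfolding kexp_nat[OF XM that] g_def Z_def ..
  show int: "integrable M (kexp M T \<kappa> (int k) X)"
    by (subst Bochner_Integration.integrable_cong[OF refl kexp_eq]) (use integrable_T_funpow[OF g_int] in auto)
  show "AE \<omega> in M. real_cond_exp M (F k) X \<omega> = kexp M T \<kappa> (int k) X \<omega>"
  proof (rule Fk.real_cond_exp_charact[OF _ X int kexp_measurable_F[OF XM]])
    fix S assume "S \<in> sets (F k)"
    then obtain B where B: "B \<in> sets F0" "S = (T ^^ k) -` B \<inter> space M" by (auto simp: sets_F)
    have BM: "B \<in> sets M" using B subalgebra_F0 by (auto simp: subalgebra_def)
    have ZM: "Z \<in> borel_measurable M" using Z by auto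
    have "(\<integral>\<omega>\<in>S. kexp M T \<kappa> (int k) X \<omega> \<partial>M) = (\<integral>\<omega>. indicator B ((T ^^ k) \<omega>) * g ((T ^^ k) \<omega>) \<partial>M)"
      unfolding set_lebesgue_integral_def by (intro Bochner_Integration.integral_cong) (auto simp: B kexp_eq indicator_def)
    also have "\<dots> = (\<integral>\<omega>. indicator B \<omega> * g \<omega> \<partial>M)"
      using BM gM by (intro integral_T_funpow) auto
    also have "\<dots> = (\<integral>\<omega>. indicator B \<omega> * real_cond_exp M F0 Z \<omega> \<partial>M)"
      using BM gM g_eq by (intro integral_cong_AE) auto
    also have "\<dots> = (\<integral>\<omega>. indicator B \<omega> * Z \<omega> \<partial>M)"
      using F0.real_cond_exp_intA[OF Z B(1)] by (simp add: set_lebesgue_integral_def)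
    also have "\<dots> = (\<integral>\<omega>. indicator B ((T ^^ k) \<omega>) * Z ((T ^^ k) \<omega>) \<partial>M)"
      using BM ZM by (intro integral_T_funpow[symmetric]) auto
    also have "\<dots> = (\<integral>\<omega>\<in>S. X \<omega> \<partial>M)"
      unfolding set_lebesgue_integral_def Z_def
      by (intro Bochner_Integration.integral_cong) (auto simp: B inv_T_T_funpow indicator_def)
    finally show "(\<integral>\<omega>\<in>S. X \<omega> \<partial>M) = (\<integral>\<omega>\<in>S. kexp M T \<kappa> (int k) X \<omega> \<partial>M)" ..
  qed
qed

text \<open>
  Combines \<open>E(\<Phi> X | F\<^sub>k) = \<Phi> E(X | F\<^sub>k)\<close> with the tower property for \<open>F0 \<subseteq> F\<^sub>k\<close>. The exceptional null set
  depends on \<open>\<Phi>\<close> and \<open>X\<close>.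
\<close>
lemma cond_law_tower:
  fixes \<Phi> :: "'a \<Rightarrow> real"
  assumes X: "integrable M X" and \<Phi>: "\<Phi> \<in> borel_measurable (F k)" "\<And>x. \<bar>\<Phi> x\<bar> \<le> c"
  shows "AE \<omega> in M. (\<integral>x. \<Phi> x * X x \<partial>cond_law \<omega>) = (\<integral>x. \<Phi> x * kexp M T \<kappa> (int k) X x \<partial>cond_law \<omega>)"
proof -
  interpret Fk: finite_measure_subalgebra M "F k"
    by (rule finite_measure_subalgebra_F[OF subalgebra_F])
  interpret F0: finite_measure_subalgebra M F0
    by (rule finite_measure_subalgebra_F[OF subalgebra_F0])
  have \<Phi>M: "\<Phi> \<in> borel_measurable M" by (rule measurable_from_subalg[OF subalgebra_F \<Phi>(1)])
  have i: "integrable M (\<lambda>x. \<Phi> x * Z x)" if "integrable M Z" for Z :: "'a \<Rightarrow> real"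
  proof (rule Bochner_Integration.integrable_bound)
    show "integrable M (\<lambda>x. c * Z x)" using that by simp
    show "(\<lambda>x. \<Phi> x * Z x) \<in> borel_measurable M" using \<Phi>M that by measurable
    show "AE x in M. norm (\<Phi> x * Z x) \<le> norm (c * Z x)"
    proof (rule AE_I2)
      fix x
      have "\<bar>\<Phi> x\<bar> \<le> \<bar>c\<bar>" using \<Phi>(2)[of x] by linarith
      then show "norm (\<Phi> x * Z x) \<le> norm (c * Z x)" by (simp add: abs_mult mult_right_mono)
    qed
  qed
  note kv = kexp_version[OF X, of k]
  note i1 = i[OF X] and i2 = i[OF kv(1)]
  have "AE x in M. real_cond_exp M (F k) (\<lambda>x. \<Phi> x * X x) x = \<Phi> x * kexp M T \<kappa> (int k) X x"
    using Fk.real_cond_exp_mult[OF \<Phi>(1) borel_measurable_integrable[OF X] i1] kv(2) by eventually_elim simp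
  then have "AE \<omega> in M. real_cond_exp M F0 (real_cond_exp M (F k) (\<lambda>x. \<Phi> x * X x)) \<omega>
    = real_cond_exp M F0 (\<lambda>x. \<Phi> x * kexp M T \<kappa> (int k) X x) \<omega>"
    by (rule F0.real_cond_exp_cong[OF _ borel_measurable_cond_exp2 borel_measurable_integrable[OF i2]])
  moreover have "AE \<omega> in M. real_cond_exp M F0 (real_cond_exp M (F k) (\<lambda>x. \<Phi> x * X x)) \<omega> = real_cond_exp M F0 (\<lambda>x. \<Phi> x * X x) \<omega>"
    by (rule F0.real_cond_exp_nested_subalg[OF subalgebra_F subalgebra_F_F0 i1])
  ultimately show ?thesis using cond_law_integral_version(2)[OF i1] cond_law_integral_version(2)[OF i2]
    by eventually_elim simp
qed

lemma cond_law_kexp: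
  assumes "integrable M X"
  shows "AE \<omega> in M. (\<integral>x. X x \<partial>cond_law \<omega>) = (\<integral>x. kexp M T \<kappa> (int k) X x \<partial>cond_law \<omega>)"
  using cond_law_tower[OF assms, of "\<lambda>_. 1" k 1] by simp

text \<open>
  For a rational \<open>q\<close> the conditional probability of \<open>h \<le> q\<close> is the indicator of that event, and
  the comparisons with all rationals determine a real number.
\<close>
lemma cond_law_const:
  assumes h: "h \<in> borel_measurable F0"
  shows "AE \<omega> in M. AE x in cond_law \<omega>. h x = (h \<omega> :: real)"
proof -
  interpret F0: finite_measure_subalgebra M F0
    by (rule finite_measure_subalgebra_F[OF subalgebra_F0])
  have hM: "h \<in> borel_measurable M" by (rule measurable_from_subalg[OF subalgebra_F0 h])
  have "AE \<omega> in M. measure (cond_law \<omega>) {x \<in> space M. h x \<le> real_of_rat q} = indicator {x \<in> space M. h x \<le> real_of_rat q} \<omega>" for q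
  proof -
    have S: "{x \<in> space M. h x \<le> real_of_rat q} \<in> sets F0"
      using h unfolding space_F0[symmetric] by measurable
    then have SM: "{x \<in> space M. h x \<le> real_of_rat q} \<in> sets M"
      using subalgebra_F0 by (auto simp: subalgebra_def)
    have "AE \<omega> in M. real_cond_exp M F0 (indicator {x \<in> space M. h x \<le> real_of_rat q}) \<omega>
        = indicator {x \<in> space M. h x \<le> real_of_rat q} \<omega>"
      using S SM by (intro F0.real_cond_exp_F_meas) (auto simp: emeasure_eq_measure)
    then show ?thesis using cond_law_version[OF SM] by eventually_elim simp
  qed
  then have "AE \<omega> in M. \<forall>q. measure (cond_law \<omega>) {x \<in> space M. h x \<le> real_of_rat q} = indicator {x \<in> space M. h x \<le> real_of_rat q} \<omega>"
    by (simp add: AE_all_countable)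
  then show ?thesis
  proof (rule AE_mp[OF _ AE_I2[OF impI]])
    fix \<omega> assume \<omega>: "\<omega> \<in> space M"
      and eq: "\<forall>q. measure (cond_law \<omega>) {x \<in> space M. h x \<le> real_of_rat q} = indicator {x \<in> space M. h x \<le> real_of_rat q} \<omega>"
    interpret P: prob_space "cond_law \<omega>" by (rule prob_space_cond_law[OF \<omega>])
    have "AE x in cond_law \<omega>. (h x \<le> real_of_rat q) = (h \<omega> \<le> real_of_rat q)" for q
    proof -
      have S: "{x \<in> space M. h x \<le> real_of_rat q} \<in> sets (cond_law \<omega>)" using hM by simp
      show ?thesis
      proof (cases "h \<omega> \<le> real_of_rat q")
        case True
        then have "P.prob {x \<in> space M. h x \<le> real_of_rat q} = 1" using eq \<omega> by simp
        then show ?thesis using P.prob_eq_1[OF S] True by simp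
      next
        case False
        then have "P.prob {x \<in> space M. h x \<le> real_of_rat q} = 0" using eq \<omega> by simp
        then have "AE x in cond_law \<omega>. x \<notin> {x \<in> space M. h x \<le> real_of_rat q}" using P.prob_eq_0[OF S] by simp
        then show ?thesis using AE_space by eventually_elim (use False in auto)
      qed
    qed
    then have "AE x in cond_law \<omega>. \<forall>q. (h x \<le> real_of_rat q) = (h \<omega> \<le> real_of_rat q)"
      by (simp add: AE_all_countable)
    then show "AE x in cond_law \<omega>. h x = h \<omega>"
    proof eventually_elim
      case (elim x)
      show ?case
      proof (rule ccontr)
        assume "h x \<noteq> h \<omega>"
        then consider "h x < h \<omega>" | "h \<omega> < h x" by linarith
        then show False
        proof cases
          case 1
          then obtain q where "h x < real_of_rat q" "real_of_rat q < h \<omega>" using of_rat_dense by blast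
          then show False using elim[rule_format, of q] by auto
        next
          case 2
          then obtain q where "h \<omega> < real_of_rat q" "real_of_rat q < h x" using of_rat_dense by blast
          then show False using elim[rule_format, of q] by auto
        qed
      qed
    qed
  qed
qed

text \<open>
  Both sides are continuous in \<open>t\<close> by dominated convergence, so one null set for the rational
  parameters serves all real ones.
\<close>
lemma cond_law_tower_all_t:
  fixes h :: "real \<Rightarrow> 'a \<Rightarrow> real"
  assumes X: "integrable M X" and h: "\<And>t. h t \<in> borel_measurable (F k)"
    and cont: "\<And>x. continuous_on UNIV (\<lambda>t. h t x)" and bound: "\<And>t x. \<bar>h t x\<bar> \<le> exp (t\<^sup>2 * N / 2)" and N: "0 \<le> N"
  shows "AE \<omega> in M. \<forall>t. (\<integral>x. h t x * X x \<partial>cond_law \<omega>) = (\<integral>x. h t x * kexp M T \<kappa> (int k) X x \<partial>cond_law \<omega>)"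
proof -
  have hM: "h t \<in> borel_measurable (cond_law \<omega>)" for t \<omega>
    using measurable_from_subalg[OF subalgebra_F h[of t]] by (simp cong: measurable_cong_sets)
  have "AE \<omega> in M. \<forall>q. (\<integral>x. h (real_of_rat q) x * X x \<partial>cond_law \<omega>) = (\<integral>x. h (real_of_rat q) x * kexp M T \<kappa> (int k) X x \<partial>cond_law \<omega>)"
    unfolding AE_all_countable by (intro allI cond_law_tower[OF X h bound])
  then show ?thesis
    using cond_law_integrable[OF X] cond_law_integrable[OF kexp_version(1)[OF X, of k]]
  proof eventually_elim
    case (elim \<omega>)
    show ?case
    proof
      fix t
      show "(\<integral>x. h t x * X x \<partial>cond_law \<omega>) = (\<integral>x. h t x * kexp M T \<kappa> (int k) X x \<partial>cond_law \<omega>)"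
        by (rule real_eq_if_eq_on_rat[of "\<lambda>t. \<integral>x. h t x * X x \<partial>cond_law \<omega>"])
           (use elim in \<open>auto intro!: continuous_integral_weight[OF _ hM cont bound N]\<close>)
    qed
  qed
qed

lemma cond_law_tower_weight:
  fixes s v :: "'a \<Rightarrow> real"
  assumes X: "integrable M X" and s: "s \<in> borel_measurable (F k)" and v: "v \<in> borel_measurable (F k)" and N: "0 \<le> N"
  shows "AE \<omega> in M. \<forall>t. (\<integral>x. exp (\<i> * (t * s x) + complex_of_real (t\<^sup>2 / 2 * clip N (v x))) * complex_of_real (X x) \<partial>cond_law \<omega>)
     = (\<integral>x. exp (\<i> * (t * s x) + complex_of_real (t\<^sup>2 / 2 * clip N (v x))) * complex_of_real (kexp M T \<kappa> (int k) X x) \<partial>cond_law \<omega>)"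
proof -
  define h :: "(real \<Rightarrow> real) \<Rightarrow> real \<Rightarrow> 'a \<Rightarrow> real" where "h g t x = exp (t\<^sup>2 / 2 * clip N (v x)) * g (t * s x)" for g t x
  have E: "exp (t\<^sup>2 / 2 * clip N (v x)) \<le> exp (t\<^sup>2 * N / 2)" for t x
  proof -
    have "t\<^sup>2 / 2 * clip N (v x) \<le> t\<^sup>2 / 2 * N"
      using clip_bounds[OF N, of "v x"] by (intro mult_left_mono) auto
    then show ?thesis by simp
  qed
  have bound: "\<bar>h g t x\<bar> \<le> exp (t\<^sup>2 * N / 2)" if "\<And>y. \<bar>g y\<bar> \<le> 1" for g t x
    using mult_mono[OF E[of t x] that[of "t * s x"]] by (simp add: h_def abs_mult)
  have meas: "h g t \<in> borel_measurable (F k)" if [measurable]: "g \<in> borel_measurable borel" for g t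
    unfolding h_def[abs_def] using s v by measurable
  have cont: "continuous_on UNIV (\<lambda>t. h g t x)" if "continuous_on UNIV g" for g x
    unfolding h_def by (intro continuous_intros continuous_on_compose2[OF that]) auto
  have ad: "AE \<omega> in M. \<forall>t. (\<integral>x. h g t x * X x \<partial>cond_law \<omega>) = (\<integral>x. h g t x * kexp M T \<kappa> (int k) X x \<partial>cond_law \<omega>)"
    if "continuous_on UNIV g" "\<And>y. \<bar>g y\<bar> \<le> 1" for g
    by (rule cond_law_tower_all_t[OF X meas cont bound N]) (use that in \<open>auto intro: borel_measurable_continuous_onI\<close>)
  have cplx: "(\<integral>x. exp (\<i> * (t * s x) + complex_of_real (t\<^sup>2 / 2 * clip N (v x))) * complex_of_real (Z x) \<partial>cond_law \<omega>)
    = complex_of_real (\<integral>x. h cos t x * Z x \<partial>cond_law \<omega>) + \<i> * complex_of_real (\<integral>x. h sin t x * Z x \<partial>cond_law \<omega>)"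
    if Z: "integrable (cond_law \<omega>) Z" for t \<omega> Z
  proof -
    have i: "integrable (cond_law \<omega>) (\<lambda>x. h g t x * Z x)" if "continuous_on UNIV g" "\<And>y. \<bar>g y\<bar> \<le> 1" for g
    proof (rule Bochner_Integration.integrable_bound)
      show "integrable (cond_law \<omega>) (\<lambda>x. exp (t\<^sup>2 * N / 2) * Z x)" using Z by simp
      have "h g t \<in> borel_measurable (cond_law \<omega>)"
        using measurable_from_subalg[OF subalgebra_F meas[OF borel_measurable_continuous_onI[OF that(1)], of t]]
        by (simp cong: measurable_cong_sets)
      then show "(\<lambda>x. h g t x * Z x) \<in> borel_measurable (cond_law \<omega>)" using Z by measurable
      show "AE x in cond_law \<omega>. norm (h g t x * Z x) \<le> norm (exp (t\<^sup>2 * N / 2) * Z x)"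
        using bound[OF that(2)] by (auto simp: abs_mult intro!: mult_right_mono)
    qed
    have i_cos: "integrable (cond_law \<omega>) (\<lambda>x. h cos t x * Z x)" by (rule i) (auto intro!: continuous_intros)
    have i_sin: "integrable (cond_law \<omega>) (\<lambda>x. h sin t x * Z x)" by (rule i) (auto intro!: continuous_intros)
    have "(\<integral>x. exp (\<i> * (t * s x) + complex_of_real (t\<^sup>2 / 2 * clip N (v x))) * complex_of_real (Z x) \<partial>cond_law \<omega>)
      = (\<integral>x. complex_of_real (h cos t x * Z x) + \<i> * complex_of_real (h sin t x * Z x) \<partial>cond_law \<omega>)"
      by (intro Bochner_Integration.integral_cong refl) (simp add: complex_eq_iff h_def Re_exp Im_exp)
    also have "\<dots> = (\<integral>x. complex_of_real (h cos t x * Z x) \<partial>cond_law \<omega>) + (\<integral>x. \<i> * complex_of_real (h sin t x * Z x) \<partial>cond_law \<omega>)"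
      using i_cos i_sin by (intro Bochner_Integration.integral_add integrable_mult_right integrable_of_real)
    also have "\<dots> = complex_of_real (\<integral>x. h cos t x * Z x \<partial>cond_law \<omega>) + \<i> * complex_of_real (\<integral>x. h sin t x * Z x \<partial>cond_law \<omega>)"
      by (simp only: integral_mult_right_zero integral_complex_of_real)
    finally show ?thesis .
  qed
  have "AE \<omega> in M. \<forall>t. (\<integral>x. h cos t x * X x \<partial>cond_law \<omega>) = (\<integral>x. h cos t x * kexp M T \<kappa> (int k) X x \<partial>cond_law \<omega>)"
    by (rule ad) (auto intro!: continuous_intros)
  moreover have "AE \<omega> in M. \<forall>t. (\<integral>x. h sin t x * X x \<partial>cond_law \<omega>) = (\<integral>x. h sin t x * kexp M T \<kappa> (int k) X x \<partial>cond_law \<omega>)"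
    by (rule ad) (auto intro!: continuous_intros)
  ultimately show ?thesis using cond_law_integrable[OF X] cond_law_integrable[OF kexp_version(1)[OF X, of k]]
    by eventually_elim (simp only: cplx, simp)
qed

end

section \<open>The array of block sums\<close>

locale quenched_sequence = quenched_setting M T F0 \<kappa> for M :: "'a measure" and T F0 \<kappa> +
  fixes X0 :: "'a \<Rightarrow> real"
  assumes X0_F0: "X0 \<in> borel_measurable F0" and X0_sq: "integrable M (\<lambda>x. (X0 x)\<^sup>2)"
begin

abbreviation S :: "nat \<Rightarrow> 'a \<Rightarrow> real" where "S \<equiv> psum M T X0"
abbreviation D :: "nat \<Rightarrow> nat \<Rightarrow> 'a \<Rightarrow> real" where "D \<equiv> block_sum M T X0"

lemma X0_M: "X0 \<in> borel_measurable M"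
  by (rule measurable_from_subalg[OF subalgebra_F0 X0_F0])

lemma psum_eq: "S n x = (\<Sum>j=1..n. X0 ((T ^^ j) x))"
  by (simp add: psum_def stat_seq_def int_iter_nat)

lemma psum_F: "n \<le> k \<Longrightarrow> S n \<in> borel_measurable (F k)"
  unfolding psum_eq[abs_def]
  by (intro borel_measurable_sum measurable_F_mono[OF _ measurable_compose[OF T_funpow_F X0_F0]]) auto

lemma block_F: "p * i \<le> k \<Longrightarrow> D p i \<in> borel_measurable (F k)"
  unfolding block_sum_def[abs_def] by (intro borel_measurable_diff psum_F) (auto intro: order_trans[rotated])

lemma psum_M [measurable]: "S n \<in> borel_measurable M"
  by (rule measurable_from_subalg[OF subalgebra_F psum_F[OF order_refl]])

lemma block_M [measurable]: "D p i \<in> borel_measurable M"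
  by (rule measurable_from_subalg[OF subalgebra_F block_F[OF order_refl]])

lemma psum_sq: "integrable M (\<lambda>x. (S n x)\<^sup>2)"
proof (induction n)
  case (Suc n)
  have "S (Suc n) x = S n x + X0 ((T ^^ Suc n) x)" for x by (simp add: psum_eq del: funpow.simps)
  moreover have "(\<lambda>x. X0 ((T ^^ Suc n) x)) \<in> borel_measurable M"
    using X0_M T_funpow_measurable by (rule measurable_compose[rotated])
  ultimately show ?case
    using integrable_sq_add[OF psum_M _ Suc] integrable_T_funpow[OF X0_sq, of "Suc n"] by (simp del: funpow.simps)
qed (simp add: psum_eq)

lemma block_sq: "integrable M (\<lambda>x. (D p i x)\<^sup>2)"
proof -
  have "integrable M (\<lambda>x. (S (p * i) x + - S (p * (i - 1)) x)\<^sup>2)"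
    by (rule integrable_sq_add) (use psum_sq in auto)
  then show ?thesis by (simp add: block_sum_def)
qed

lemma block_integrable: "integrable M (D p i)"
  by (rule square_integrable_imp_integrable[OF block_M block_sq])

lemma block_pair_sq: "integrable M (\<lambda>x. (D p i x + D p j x)\<^sup>2)"
  by (rule integrable_sq_add) (use block_sq in auto)

text \<open>
  The array of the introduction with \<open>m\<close> blocks of length \<open>p\<close>, numbered from \<open>0\<close>: \<open>Yb m p i\<close> is the
  normalised block number \<open>i + 1\<close>, and the conditioning for index \<open>i\<close> is at time \<open>i * p\<close>, when the
  blocks before it are complete.
\<close>
definition Yb :: "nat \<Rightarrow> nat \<Rightarrow> nat \<Rightarrow> 'a \<Rightarrow> real" where
  "Yb m p i x = D p (i + 1) x / sqrt (real m * real p)"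

definition Ab :: "nat \<Rightarrow> nat \<Rightarrow> nat \<Rightarrow> 'a \<Rightarrow> real" where
  "Ab m p i x = kexp M T \<kappa> (int (i * p)) (\<lambda>y. (D p (i + 1) y + D p (i + 2) y)\<^sup>2) x / (real m * real p)"

definition Bb :: "nat \<Rightarrow> nat \<Rightarrow> nat \<Rightarrow> 'a \<Rightarrow> real" where
  "Bb m p i x = kexp M T \<kappa> (int (i * p)) (\<lambda>y. (D p (i + 2) y)\<^sup>2) x / (real m * real p)"

definition Cb :: "nat \<Rightarrow> nat \<Rightarrow> nat \<Rightarrow> 'a \<Rightarrow> real" where
  "Cb m p i x = kexp M T \<kappa> (int (i * p)) (D p (i + 2)) x / sqrt (real m * real p)"

lemma kexp_nonneg: "(\<And>x. 0 \<le> X x) \<Longrightarrow> 0 \<le> kexp M T \<kappa> k X \<omega>"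
  by (simp add: kexp_def kernel_op_def)

lemma Ab_nonneg: "0 \<le> Ab m p i x" and Bb_nonneg: "0 \<le> Bb m p i x"
  by (simp_all add: Ab_def Bb_def kexp_nonneg)

lemma Yb_sq: "(Yb m p i x)\<^sup>2 = (D p (i + 1) x)\<^sup>2 / (real m * real p)"
  "(Yb m p i x + Yb m p j x)\<^sup>2 = (D p (i + 1) x + D p (j + 1) x)\<^sup>2 / (real m * real p)"
  by (simp_all add: Yb_def power_divide flip: add_divide_distrib)

lemma Yb_F: "Suc l \<le> i \<Longrightarrow> Yb m p l \<in> borel_measurable (F (i * p))"
  unfolding Yb_def[abs_def] by (intro borel_measurable_divide block_F) (auto simp: mult.commute[of i p] simp del: mult_Suc_right)

lemma Ab_F: "l \<le> i \<Longrightarrow> Ab m p l \<in> borel_measurable (F (i * p))"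
  unfolding Ab_def[abs_def]
  by (intro borel_measurable_divide measurable_F_mono[OF _ kexp_measurable_F]) (auto intro!: mult_right_mono)

lemma Bb_F: "l \<le> i \<Longrightarrow> Bb m p l \<in> borel_measurable (F (i * p))"
  unfolding Bb_def[abs_def]
  by (intro borel_measurable_divide measurable_F_mono[OF _ kexp_measurable_F]) (auto intro!: mult_right_mono)

abbreviation Gb :: "nat \<Rightarrow> nat \<Rightarrow> nat \<Rightarrow> real \<Rightarrow> nat \<Rightarrow> 'a \<Rightarrow> complex" where
  "Gb m p N t i x \<equiv> lind_weight t (real N) (\<lambda>l. Yb m p l x) (\<lambda>l. Ab m p l x) (\<lambda>l. Bb m p l x) i"

abbreviation Tb :: "nat \<Rightarrow> nat \<Rightarrow> nat \<Rightarrow> nat \<Rightarrow> 'a \<Rightarrow> real" where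
  "Tb m p N i x \<equiv> min (Ab m p i x + Bb m p i x) (2 * real N)"

lemma weight_identities:
  assumes Z: "integrable M Z"
  shows "AE \<omega> in M. \<forall>m N. \<forall>t. (\<integral>x. Gb m p N t i x * complex_of_real (Z x) \<partial>cond_law \<omega>)
     = (\<integral>x. Gb m p N t i x * complex_of_real (kexp M T \<kappa> (int (i * p)) Z x) \<partial>cond_law \<omega>)" (is "AE \<omega> in M. \<forall>m N. ?Q m N \<omega>")
  unfolding AE_all_countable[where 'i=nat]
proof (intro allI)
  fix m N :: nat
  show "AE \<omega> in M. ?Q m N \<omega>" unfolding lind_weight_def
    by (rule cond_law_tower_weight[OF Z, where s="\<lambda>x. \<Sum>l<i. Yb m p l x" and v="\<lambda>x. \<Sum>l<i. Ab m p l x - Bb m p l x" and N="real N"])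
       (auto intro!: borel_measurable_sum borel_measurable_diff Yb_F Ab_F Bb_F)
qed

lemma trunc_identities:
  assumes Z: "integrable M Z"
  shows "AE \<omega> in M. \<forall>m N. (\<integral>x. Tb m p N i x * Z x \<partial>cond_law \<omega>)
     = (\<integral>x. Tb m p N i x * kexp M T \<kappa> (int (i * p)) Z x \<partial>cond_law \<omega>)" (is "AE \<omega> in M. \<forall>m N. ?Q m N \<omega>")
  unfolding AE_all_countable
proof (intro allI)
  fix m N :: nat
  show "AE \<omega> in M. ?Q m N \<omega>"
  proof (rule cond_law_tower[OF Z, where c="2 * real N"])
    show "(\<lambda>x. Tb m p N i x) \<in> borel_measurable (F (i * p))"
      using Ab_F[of i i m p] Bb_F[of i i m p] by measurable
    show "\<bar>Tb m p N i x\<bar> \<le> 2 * real N" for x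
      using Ab_nonneg[of m p i x] Bb_nonneg[of m p i x] by (auto simp: min_def)
  qed
qed

text \<open>
  One null set suffices: rows and truncation levels are countably many, and the dependence on \<open>t\<close>
  is continuous.
\<close>
lemma quenched_array:
  "AE \<omega> in M. \<forall>m p N t c. 0 \<le> c \<and> 3 * c + 1 \<le> real N \<longrightarrow>
     lindeberg_array (cond_law \<omega>) (Yb m p) (Ab m p) (Bb m p) (Cb m p) m t (real N) c"
proof -
  let ?Z1 = "\<lambda>p i y. (D p (i + 1) y + D p (i + 2) y)\<^sup>2" and ?Z2 = "\<lambda>p i y. (D p (i + 2) y)\<^sup>2" and ?Z3 = "\<lambda>p i. D p (i + 2)"
  have "AE \<omega> in M. \<forall>p i. integrable (cond_law \<omega>) (\<lambda>y. (D p i y)\<^sup>2)"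
    unfolding AE_all_countable using cond_law_integrable[OF block_sq] by blast
  moreover have "AE \<omega> in M. \<forall>p i. integrable (cond_law \<omega>) (kexp M T \<kappa> (int (i * p)) (?Z1 p i))
      \<and> integrable (cond_law \<omega>) (kexp M T \<kappa> (int (i * p)) (?Z2 p i)) \<and> integrable (cond_law \<omega>) (kexp M T \<kappa> (int (i * p)) (?Z3 p i))"
    unfolding AE_all_countable AE_conj_iff
    using cond_law_integrable[OF kexp_version(1)[OF block_pair_sq]] cond_law_integrable[OF kexp_version(1)[OF block_sq]]
      cond_law_integrable[OF kexp_version(1)[OF block_integrable]] by blast
  moreover have "AE \<omega> in M. \<forall>p i. (\<integral>x. ?Z2 p i x \<partial>cond_law \<omega>) = (\<integral>x. kexp M T \<kappa> (int (i * p)) (?Z2 p i) x \<partial>cond_law \<omega>)"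
    unfolding AE_all_countable by (intro allI cond_law_kexp block_sq)
  moreover have "AE \<omega> in M. \<forall>p i m N t. (\<integral>x. Gb m p N t i x * complex_of_real (?Z1 p i x) \<partial>cond_law \<omega>)
     = (\<integral>x. Gb m p N t i x * complex_of_real (kexp M T \<kappa> (int (i * p)) (?Z1 p i) x) \<partial>cond_law \<omega>)"
    by (subst AE_all_countable, rule allI, subst AE_all_countable, rule allI, rule weight_identities[OF block_pair_sq])
  moreover have "AE \<omega> in M. \<forall>p i m N t. (\<integral>x. Gb m p N t i x * complex_of_real (?Z2 p i x) \<partial>cond_law \<omega>)
     = (\<integral>x. Gb m p N t i x * complex_of_real (kexp M T \<kappa> (int (i * p)) (?Z2 p i) x) \<partial>cond_law \<omega>)"
    by (subst AE_all_countable, rule allI, subst AE_all_countable, rule allI, rule weight_identities[OF block_sq])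
  moreover have "AE \<omega> in M. \<forall>p i m N t. (\<integral>x. Gb m p N t i x * complex_of_real (?Z3 p i x) \<partial>cond_law \<omega>)
     = (\<integral>x. Gb m p N t i x * complex_of_real (kexp M T \<kappa> (int (i * p)) (?Z3 p i) x) \<partial>cond_law \<omega>)"
    by (subst AE_all_countable, rule allI, subst AE_all_countable, rule allI, rule weight_identities[OF block_integrable])
  moreover have "AE \<omega> in M. \<forall>p i m N. (\<integral>x. Tb m p N i x * ?Z1 p i x \<partial>cond_law \<omega>)
     = (\<integral>x. Tb m p N i x * kexp M T \<kappa> (int (i * p)) (?Z1 p i) x \<partial>cond_law \<omega>)"
    by (subst AE_all_countable, rule allI, subst AE_all_countable, rule allI, rule trunc_identities[OF block_pair_sq])
  moreover have "AE \<omega> in M. \<forall>p i m N. (\<integral>x. Tb m p N i x * ?Z2 p i x \<partial>cond_law \<omega>)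
     = (\<integral>x. Tb m p N i x * kexp M T \<kappa> (int (i * p)) (?Z2 p i) x \<partial>cond_law \<omega>)"
    by (subst AE_all_countable, rule allI, subst AE_all_countable, rule allI, rule trunc_identities[OF block_sq])
  ultimately show ?thesis using AE_space
  proof eventually_elim
    case (elim \<omega>)
    interpret P: prob_space "cond_law \<omega>" by (rule prob_space_cond_law[OF elim(9)])
    have Y: "Yb m p i \<in> borel_measurable (cond_law \<omega>)" for m p i
      unfolding Yb_def[abs_def] using block_M by (simp cong: measurable_cong_sets)
    show ?case
    proof (intro allI impI, unfold_locales)
      fix m p N :: nat and t c :: real and i :: nat
      show "integrable (cond_law \<omega>) (\<lambda>x. (Yb m p i x)\<^sup>2)" unfolding Yb_sq using elim(1) by simp
      show "integrable (cond_law \<omega>) (Ab m p i)" "integrable (cond_law \<omega>) (Bb m p i)" "integrable (cond_law \<omega>) (Cb m p i)"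
        unfolding Ab_def[abs_def] Bb_def[abs_def] Cb_def[abs_def] using elim(2) by simp_all
      define G where "G x = Gb m p N t i x" for x
      show "(\<integral>x. Gb m p N t i x * complex_of_real ((Yb m p i x + Yb m p (Suc i) x)\<^sup>2) \<partial>cond_law \<omega>) = (\<integral>x. Gb m p N t i x * complex_of_real (Ab m p i x) \<partial>cond_law \<omega>)"
        using elim(4)[THEN spec[of _ p], THEN spec[of _ i], THEN spec[of _ m], THEN spec[of _ N], THEN spec[of _ t]] unfolding Yb_sq G_def[symmetric]
        by (simp add: Ab_def del: of_real_power of_real_add)
      show "(\<integral>x. Gb m p N t i x * complex_of_real ((Yb m p (Suc i) x)\<^sup>2) \<partial>cond_law \<omega>) = (\<integral>x. Gb m p N t i x * complex_of_real (Bb m p i x) \<partial>cond_law \<omega>)"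
        using elim(5)[THEN spec[of _ p], THEN spec[of _ i], THEN spec[of _ m], THEN spec[of _ N], THEN spec[of _ t]] unfolding Yb_sq G_def[symmetric]
        by (simp add: Bb_def del: of_real_power of_real_add)
      show "(\<integral>x. Gb m p N t i x * complex_of_real (Yb m p (Suc i) x) \<partial>cond_law \<omega>) = (\<integral>x. Gb m p N t i x * complex_of_real (Cb m p i x) \<partial>cond_law \<omega>)"
        using elim(6)[THEN spec[of _ p], THEN spec[of _ i], THEN spec[of _ m], THEN spec[of _ N], THEN spec[of _ t]] unfolding G_def[symmetric]
        by (simp add: Cb_def Yb_def)
      define \<Theta> where "\<Theta> x = Tb m p N i x" for x
      show "(\<integral>x. Tb m p N i x * (Yb m p i x + Yb m p (Suc i) x)\<^sup>2 \<partial>cond_law \<omega>)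
        = (\<integral>x. Tb m p N i x * Ab m p i x \<partial>cond_law \<omega>)"
        using elim(7)[THEN spec[of _ p], THEN spec[of _ i], THEN spec[of _ m], THEN spec[of _ N]] unfolding Yb_sq \<Theta>_def[symmetric]
        by (simp add: Ab_def)
      show "(\<integral>x. Tb m p N i x * (Yb m p (Suc i) x)\<^sup>2 \<partial>cond_law \<omega>)
        = (\<integral>x. Tb m p N i x * Bb m p i x \<partial>cond_law \<omega>)"
        using elim(8)[THEN spec[of _ p], THEN spec[of _ i], THEN spec[of _ m], THEN spec[of _ N]] unfolding Yb_sq \<Theta>_def[symmetric]
        by (simp add: Bb_def)
      show "(\<integral>x. (Yb m p (Suc i) x)\<^sup>2 \<partial>cond_law \<omega>) = (\<integral>x. Bb m p i x \<partial>cond_law \<omega>)"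
        unfolding Yb_sq using elim(3)[THEN spec[of _ p], THEN spec[of _ i]] by (simp add: Bb_def)
    qed (use Y Ab_nonneg Bb_nonneg in auto)
  qed
qed

end

section \<open>From multiples of the number of blocks to all sample sizes\<close>

text \<open>
  The form in which the convergence conditions are used: strict smallness for large \<open>m\<close> and then
  for large \<open>p\<close>, without extended reals.
\<close>
lemma iterated_limsup_small:
  fixes f :: "nat \<Rightarrow> nat \<Rightarrow> real"
  assumes "(\<lambda>m. limsup (\<lambda>p. ereal (f m p))) \<longlonglongrightarrow> 0" "0 < \<delta>"
  shows "\<forall>\<^sub>F m in sequentially. \<forall>\<^sub>F p in sequentially. f m p < \<delta>"
proof -
  have "\<forall>\<^sub>F m in sequentially. limsup (\<lambda>p. ereal (f m p)) < ereal \<delta>"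
    by (rule order_tendstoD(2)[OF assms(1)]) (use assms(2) in simp)
  then show ?thesis
    by eventually_elim (auto dest!: Limsup_lessD)
qed

text \<open>
  The two sums differ by fewer than \<open>m\<close> terms, each \<open>o(sqrt n)\<close>. The change of normalisation
  multiplies the sum by a factor of relative size \<open>m / n\<close> away from \<open>1\<close>, and the crude bound
  \<open>s n = o(n sqrt n)\<close> suffices for it.
\<close>
lemma subsequence_normalised_sums:
  fixes x :: "nat \<Rightarrow> real"
  assumes x: "(\<lambda>n. x n / sqrt (real n)) \<longlonglongrightarrow> 0" and m: "0 < m"
  defines "s n \<equiv> \<Sum>j=1..n. x j"
  shows "(\<lambda>n. s (m * (n div m)) / sqrt (real (m * (n div m))) - s n / sqrt (real n)) \<longlonglongrightarrow> 0"
proof (rule LIMSEQ_I)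
  fix r :: real assume r: "0 < r"
  \<comment> \<open>The three error terms below are at most \<open>e * m\<close> each.\<close>
  define e where "e = r / (4 * real m)"
  have e: "0 < e" using r m by (simp add: e_def)
  obtain n0 where n0: "\<And>n. n0 \<le> n \<Longrightarrow> \<bar>x n / sqrt (real n)\<bar> < e"
    using LIMSEQ_D[OF x e] by auto
  define B where "B = (\<Sum>j\<le>n0. \<bar>x j\<bar>)"
  have B: "0 \<le> B" by (simp add: B_def sum_nonneg)
  have xb: "\<bar>x j\<bar> \<le> e * sqrt (real n)" if "n0 \<le> j" "1 \<le> j" "j \<le> n" for j n
  proof -
    have "\<bar>x j\<bar> \<le> e * sqrt (real j)" using n0[OF that(1)] that(2) by (simp add: field_simps)
    also have "\<dots> \<le> e * sqrt (real n)" using that e by (intro mult_left_mono) auto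
    finally show ?thesis .
  qed
  have sb: "\<bar>s n\<bar> \<le> B + real n * (e * sqrt (real n))" for n
  proof -
    have "\<bar>s n\<bar> \<le> (\<Sum>j=1..n. \<bar>x j\<bar>)" unfolding s_def by (rule sum_abs)
    also have "\<dots> \<le> (\<Sum>j=1..n. (if j \<le> n0 then \<bar>x j\<bar> else 0) + e * sqrt (real n))"
      using xb[of _ n] e by (intro sum_mono) auto
    also have "\<dots> = (\<Sum>j\<in>{1..n} \<inter> {..n0}. \<bar>x j\<bar>) + real n * (e * sqrt (real n))"
      by (subst sum.inter_restrict) (auto simp: sum.distrib)
    also have "(\<Sum>j\<in>{1..n} \<inter> {..n0}. \<bar>x j\<bar>) \<le> B" unfolding B_def by (intro sum_mono2) auto
    finally show ?thesis by simp
  qed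
  obtain n1 :: nat where n1: "B / e < real n1" using reals_Archimedean2 by blast
  show "\<exists>no. \<forall>n\<ge>no. norm (s (m * (n div m)) / sqrt (real (m * (n div m))) - s n / sqrt (real n) - 0) < r"
  proof (intro exI allI impI)
    fix n assume n: "n0 + m + n1 + 1 \<le> n"
    define q where "q = m * (n div m)"
    have q: "q \<le> n" "n < q + m"
    proof -
      have "n = q + n mod m" by (simp add: q_def)
      then show "q \<le> n" "n < q + m" using mod_less_divisor[OF m, of n] by linarith+
    qed
    have q1: "1 \<le> q" "n0 \<le> q" using q n by auto
    have sq: "0 < sqrt (real q)" "0 < sqrt (real n)" "sqrt (real q) \<le> sqrt (real n)" using q q1 by auto
    have diff: "\<bar>s q - s n\<bar> \<le> real m * (e * sqrt (real n))"
    proof -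
      have "{1..n} = {1..q} \<union> {q+1..n}" using q by auto
      then have "s n = s q + (\<Sum>j=q+1..n. x j)" unfolding s_def by (simp add: sum.union_disjoint)
      then have "\<bar>s q - s n\<bar> = \<bar>\<Sum>j=q+1..n. x j\<bar>" by simp
      also have "\<dots> \<le> (\<Sum>j=q+1..n. \<bar>x j\<bar>)" by (rule sum_abs)
      also have "\<dots> \<le> (\<Sum>j=q+1..n. e * sqrt (real n))" using q1 by (intro sum_mono xb) auto
      also have "\<dots> = real (n - q) * (e * sqrt (real n))" by simp
      also have "\<dots> \<le> real m * (e * sqrt (real n))" using q e by (intro mult_right_mono) auto
      finally show ?thesis .
    qed
    have scale: "1 / sqrt (real q) - 1 / sqrt (real n) \<le> real m / (real n * sqrt (real q))"
    proof -
      have "(sqrt (real n) - sqrt (real q)) * sqrt (real n) \<le> (sqrt (real n) - sqrt (real q)) * (sqrt (real n) + sqrt (real q))"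
        using sq by (intro mult_left_mono) auto
      also have "\<dots> = real n - real q" by (simp add: algebra_simps)
      also have "\<dots> \<le> real m" using q by linarith
      finally have "(sqrt (real n) - sqrt (real q)) * sqrt (real n) / (real n * sqrt (real q)) \<le> real m / (real n * sqrt (real q))"
        by (intro divide_right_mono) auto
      moreover have "1 / sqrt (real q) - 1 / sqrt (real n) = (sqrt (real n) - sqrt (real q)) * sqrt (real n) / (real n * sqrt (real q))"
        using sq q q1 by (simp add: field_simps)
      ultimately show ?thesis by simp
    qed
    have "s q / sqrt (real q) - s n / sqrt (real n) = (s q - s n) / sqrt (real n) + s q * (1 / sqrt (real q) - 1 / sqrt (real n))"
      by (simp add: algebra_simps diff_divide_distrib)
    also have "\<bar>\<dots>\<bar> \<le> \<bar>s q - s n\<bar> / sqrt (real n) + \<bar>s q\<bar> * (1 / sqrt (real q) - 1 / sqrt (real n))"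
    proof -
      have "0 \<le> 1 / sqrt (real q) - 1 / sqrt (real n)" using sq by (simp add: frac_le)
      then have "\<bar>s q * (1 / sqrt (real q) - 1 / sqrt (real n))\<bar> = \<bar>s q\<bar> * (1 / sqrt (real q) - 1 / sqrt (real n))"
        by (simp add: abs_mult)
      moreover have "\<bar>(s q - s n) / sqrt (real n)\<bar> = \<bar>s q - s n\<bar> / sqrt (real n)" by simp
      ultimately show ?thesis by (metis abs_triangle_ineq)
    qed
    also have "\<dots> \<le> real m * e + (B + real q * (e * sqrt (real q))) * (real m / (real n * sqrt (real q)))"
    proof (intro add_mono)
      show "\<bar>s q - s n\<bar> / sqrt (real n) \<le> real m * e" using diff sq by (simp add: field_simps)
      have "0 \<le> 1 / sqrt (real q) - 1 / sqrt (real n)" using sq by (simp add: frac_le)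
      then show "\<bar>s q\<bar> * (1 / sqrt (real q) - 1 / sqrt (real n)) \<le> (B + real q * (e * sqrt (real q))) * (real m / (real n * sqrt (real q)))"
        using sb[of q] scale B e by (intro mult_mono) auto
    qed
    also have "(B + real q * (e * sqrt (real q))) * (real m / (real n * sqrt (real q)))
      = B / sqrt (real q) * (real m / real n) + e * real m * (real q / real n)"
      using sq by (simp add: field_simps)
    also have "B / sqrt (real q) * (real m / real n) \<le> e * real m"
    proof -
      have "B / sqrt (real q) \<le> B" using B q1 by (simp add: divide_le_eq mult_le_cancel_left1)
      then have "B / sqrt (real q) * (real m / real n) \<le> B * (real m / real n)" by (intro mult_right_mono) auto
      also have "B \<le> e * real n"
      proof -
        have "B \<le> e * real n1" using n1 e by (simp add: field_simps)
        also have "\<dots> \<le> e * real n" using n e by (intro mult_left_mono) auto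
        finally show ?thesis .
      qed
      then have "B * (real m / real n) \<le> e * real n * (real m / real n)" by (intro mult_right_mono) auto
      also have "\<dots> = e * real m" using n by simp
      finally show ?thesis .
    qed
    also have "e * real m * (real q / real n) \<le> e * real m"
      using q q1 e by (intro mult_left_le) auto
    finally have "\<bar>s q / sqrt (real q) - s n / sqrt (real n)\<bar> \<le> 3 * (e * real m)" by (simp add: mult.commute)
    also have "\<dots> < r" using r m by (simp add: e_def)
    finally show "norm (s (m * (n div m)) / sqrt (real (m * (n div m))) - s n / sqrt (real n) - 0) < r"
      unfolding q_def by simp
  qed
qed

lemma sum_indicator_le:
  fixes z :: real
  assumes "0 \<le> z"
  shows "(\<Sum>n<k. if real n < z then 1 else 0) \<le> z + 1"
proof -
  have "(\<Sum>n<k. if real n < z then 1 else 0) = real (card {n. n < k \<and> real n < z})"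
    by (simp add: sum.If_cases Int_def)
  also have "card {n. n < k \<and> real n < z} \<le> card {..<nat \<lceil>z\<rceil>}"
    by (rule card_mono) (auto, linarith)
  also have "real (card {..<nat \<lceil>z\<rceil>}) \<le> z + 1" 
  proof -
    have "real (nat \<lceil>z\<rceil>) = real_of_int \<lceil>z\<rceil>" using assms by simp
    then show ?thesis by simp
  qed
  finally show ?thesis by simp
qed

context quenched_sequence
begin

text \<open>
  By stationarity the probability that \<open>X\<^sub>n\<^sup>2 > n \<delta>\<close> is that of \<open>X0\<^sup>2 / \<delta> > n\<close>, which is summable since
  \<open>X0\<^sup>2\<close> is integrable.
\<close>
lemma AE_small_increments: "AE x in M. (\<lambda>n. X0 ((T ^^ n) x) / sqrt (real n)) \<longlonglongrightarrow> 0"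
proof -
  note [measurable] = X0_M
  have ev: "AE x in M. \<forall>\<^sub>F n in sequentially. (X0 ((T ^^ n) x))\<^sup>2 \<le> real n / real (Suc k)" for k
  proof -
    define Z where "Z x = (X0 x)\<^sup>2 * real (Suc k)" for x
    have Z [measurable]: "Z \<in> borel_measurable M" unfolding Z_def[abs_def] by measurable
    have Zi: "integrable M Z" unfolding Z_def using X0_sq by simp
    define E where "E n = {x \<in> space M. real n < Z ((T ^^ n) x)}" for n
    define E0 where "E0 n = {x \<in> space M. real n < Z x}" for n
    have E: "E n \<in> sets M" and E0: "E0 n \<in> sets M" for n unfolding E_def E0_def by measurable
    have mE: "measure M (E n) = measure M (E0 n)" for n
    proof -
      have "measure M (E0 n) = measure (distr M M (T ^^ n)) (E0 n)" by (simp add: distr_T_funpow)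
      also have "\<dots> = measure M ((T ^^ n) -` E0 n \<inter> space M)" by (rule measure_distr[OF T_funpow_measurable E0])
      also have "(T ^^ n) -` E0 n \<inter> space M = E n" by (auto simp: E_def E0_def T_funpow_space)
      finally show ?thesis by simp
    qed
    have "AE x in M. \<forall>\<^sub>F n in sequentially. x \<in> space M - E n"
    proof (rule borel_cantelli_AE1[OF E])
      show "emeasure M (E n) < \<infinity>" for n by (simp add: emeasure_eq_measure)
      show "summable (\<lambda>n. measure M (E n))"
      proof (rule summableI_nonneg_bounded)
        show "0 \<le> measure M (E n)" for n by simp
        fix j
        have "(\<Sum>n<j. measure M (E n)) = (\<Sum>n<j. \<integral>x. indicator (E0 n) x \<partial>M)"
          unfolding mE using E0 sets.sets_into_space[OF E0] by (simp add: Int_absorb2)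
        also have "\<dots> = (\<integral>x. (\<Sum>n<j. indicator (E0 n) x) \<partial>M)"
          using E0 by (intro Bochner_Integration.integral_sum[symmetric]) (auto simp: emeasure_eq_measure)
        also have "\<dots> \<le> (\<integral>x. Z x + 1 \<partial>M)"
        proof (rule integral_mono)
          show "integrable M (\<lambda>x. \<Sum>n<j. indicat_real (E0 n) x)"
            using E0 by (intro Bochner_Integration.integrable_sum) (auto simp: emeasure_eq_measure)
          show "integrable M (\<lambda>x. Z x + 1)" using Zi by simp
          fix x assume x: "x \<in> space M"
          have "(\<Sum>n<j. indicat_real (E0 n) x) = (\<Sum>n<j. if real n < Z x then 1 else 0)"
            using x by (intro sum.cong) (auto simp: E0_def)
          also have "\<dots> \<le> Z x + 1" by (rule sum_indicator_le) (simp add: Z_def)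
          finally show "(\<Sum>n<j. indicat_real (E0 n) x) \<le> Z x + 1" .
        qed
        finally show "(\<Sum>n<j. measure M (E n)) \<le> (\<integral>x. Z x + 1 \<partial>M)" .
      qed
    qed
    then show ?thesis
    proof eventually_elim
      case (elim x)
      then show ?case
        by eventually_elim (auto simp: E_def Z_def field_simps not_less simp del: of_nat_Suc)
    qed
  qed
  have "AE x in M. \<forall>k. \<forall>\<^sub>F n in sequentially. (X0 ((T ^^ n) x))\<^sup>2 \<le> real n / real (Suc k)"
    unfolding AE_all_countable using ev by blast
  then show ?thesis
  proof eventually_elim
    case (elim x)
    show ?case
    proof (rule tendstoI)
      fix r :: real assume r: "0 < r"
      then obtain k where k: "1 / real (Suc k) < r\<^sup>2"
        using reals_Archimedean[of "r\<^sup>2"] by (auto simp: inverse_eq_divide)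
      from elim[THEN spec[of _ k]] eventually_gt_at_top[of 0]
      show "\<forall>\<^sub>F n in sequentially. dist (X0 ((T ^^ n) x) / sqrt (real n)) 0 < r"
      proof eventually_elim
        case (elim n)
        have "(X0 ((T ^^ n) x) / sqrt (real n))\<^sup>2 = (X0 ((T ^^ n) x))\<^sup>2 / real n"
          using elim by (simp add: power_divide)
        also have "\<dots> \<le> 1 / real (Suc k)" using elim by (simp add: field_simps del: of_nat_Suc)
        also have "\<dots> < r\<^sup>2" by (rule k)
        finally have "\<bar>X0 ((T ^^ n) x) / sqrt (real n)\<bar>\<^sup>2 < r\<^sup>2" by (simp only: power2_abs)
        then have "\<bar>X0 ((T ^^ n) x) / sqrt (real n)\<bar> < r" by (rule power_less_imp_less_base) (use r in simp)
        then show ?case by simp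
      qed
    qed
  qed
qed

end

section \<open>Convergence of the characteristic functions\<close>

lemma sum_shift_2: "(\<Sum>i=2..m+1. f i) = (\<Sum>i<m. f (i + 2 :: nat))"
  by (rule sum.reindex_bij_witness[of _ "\<lambda>i. i + 2" "\<lambda>i. i - 2"]) (auto simp del: add_2_eq_Suc add_2_eq_Suc')

lemma sum_shift_1: "(\<Sum>i=1..m. f i) = (\<Sum>i<m. f (i + 1 :: nat))"
  by (rule sum.reindex_bij_witness[of _ "\<lambda>i. i + 1" "\<lambda>i. i - 1"]) auto

context quenched_sequence
begin

lemma C1_expression:
  assumes \<omega>: "\<omega> \<in> space M"
  shows "1 / sqrt (real m * real p) * (\<Sum>i=2..m+1. kexp M T \<kappa> 0 (\<lambda>x. \<bar>kexp M T \<kappa> (int ((i - 2) * p)) (D p i) x\<bar>) \<omega>)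
    = (\<Sum>i<m. \<integral>x. \<bar>Cb m p i x\<bar> \<partial>cond_law \<omega>)"
proof -
  have "kexp M T \<kappa> 0 (\<lambda>x. \<bar>kexp M T \<kappa> (int (i * p)) (D p (i + 2)) x\<bar>) \<omega>
    = (\<integral>x. \<bar>kexp M T \<kappa> (int (i * p)) (D p (i + 2)) x\<bar> \<partial>cond_law \<omega>)" for i
    by (rule kexp_0[OF _ \<omega>]) (intro borel_measurable_abs kexp_measurable block_M)
  then show ?thesis
    unfolding sum_shift_2 Cb_def by (simp add: sum_distrib_left del: of_nat_mult)
qed

text \<open>
  The variable \<open>h\<close> will be \<open>\<eta>\<close> or \<open>2 \<eta>\<close>, which the conditional law does not see as random.
\<close>
lemma C2_expression:
  fixes h :: "'a \<Rightarrow> real"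
  assumes \<omega>: "\<omega> \<in> space M" and h: "h \<in> borel_measurable M" "AE x in cond_law \<omega>. h x = h \<omega>"
    and Z: "\<And>i. Z i \<in> borel_measurable M"
  shows "kexp M T \<kappa> 0 (\<lambda>x. \<bar>(\<Sum>i=1..m. 1 / (real m * real p) * kexp M T \<kappa> (int ((i - 1) * p)) (Z i) x) - h x\<bar>) \<omega>
    = (\<integral>x. \<bar>(\<Sum>i<m. kexp M T \<kappa> (int (i * p)) (Z (i + 1)) x / (real m * real p)) - h \<omega>\<bar> \<partial>cond_law \<omega>)"
proof -
  have m: "(\<lambda>x. (\<Sum>i=1..m. 1 / (real m * real p) * kexp M T \<kappa> (int ((i - 1) * p)) (Z i) x)) \<in> borel_measurable M"
    by (intro borel_measurable_sum borel_measurable_times borel_measurable_const kexp_measurable Z)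
  have "kexp M T \<kappa> 0 (\<lambda>x. \<bar>(\<Sum>i=1..m. 1 / (real m * real p) * kexp M T \<kappa> (int ((i - 1) * p)) (Z i) x) - h x\<bar>) \<omega>
    = (\<integral>x. \<bar>(\<Sum>i=1..m. 1 / (real m * real p) * kexp M T \<kappa> (int ((i - 1) * p)) (Z i) x) - h x\<bar> \<partial>cond_law \<omega>)"
    by (rule kexp_0[OF _ \<omega>]) (intro borel_measurable_abs borel_measurable_diff m h)
  also have "\<dots> = (\<integral>x. \<bar>(\<Sum>i=1..m. 1 / (real m * real p) * kexp M T \<kappa> (int ((i - 1) * p)) (Z i) x) - h \<omega>\<bar> \<partial>cond_law \<omega>)"
  proof (rule integral_cong_AE)
    show "AE x in cond_law \<omega>. \<bar>(\<Sum>i=1..m. 1 / (real m * real p) * kexp M T \<kappa> (int ((i - 1) * p)) (Z i) x) - h x\<bar>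
      = \<bar>(\<Sum>i=1..m. 1 / (real m * real p) * kexp M T \<kappa> (int ((i - 1) * p)) (Z i) x) - h \<omega>\<bar>"
      using h(2) by eventually_elim simp
  qed (use m h(1) in \<open>simp_all cong: measurable_cong_sets\<close>)
  finally show ?thesis unfolding sum_shift_1 by (simp del: of_nat_mult)
qed

text \<open>
  The array has \<open>m + 1\<close> variables because each block is paired with its successor, so the Lindeberg
  condition is applied with \<open>m + 1\<close> blocks. The change from \<open>m\<close> to \<open>m + 1\<close> in the two normalisations
  costs a factor \<open>2\<close> in the sum and a factor \<open>2\<close> in the threshold.
\<close>
lemma C3_expression:
  assumes \<omega>: "\<omega> \<in> space M" and sq: "\<And>i. integrable (cond_law \<omega>) (\<lambda>x. (D p i x)\<^sup>2)"
    and m: "0 < m" and p: "0 < p" and \<epsilon>: "0 < \<epsilon>"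
  shows "(\<Sum>i\<le>m. \<integral>x. tail_sq (2 * \<epsilon>) (Yb m p i x) \<partial>cond_law \<omega>)
    \<le> 2 * (1 / real (Suc m) * (\<Sum>i=1..Suc m. 1 / real p * kexp M T \<kappa> 0
         (\<lambda>x. (D p i x)\<^sup>2 * indicator {y. \<bar>D p i y\<bar> / sqrt (real p) > \<epsilon> * sqrt (real (Suc m))} x) \<omega>))"
proof -
  define V where "V i x = (D p i x)\<^sup>2 * indicator {y. \<bar>D p i y\<bar> / sqrt (real p) > \<epsilon> * sqrt (real (Suc m))} x" for i x
  have Vm: "V i \<in> borel_measurable M" for i
    unfolding V_def[abs_def] by measurable
  have Vi: "integrable (cond_law \<omega>) (V i)" for i
    by (rule Bochner_Integration.integrable_bound[OF sq[of i]]) (use Vm in \<open>auto simp: V_def indicator_def cong: measurable_cong_sets\<close>)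
  have le: "tail_sq (2 * \<epsilon>) (Yb m p i x) \<le> 2 * (1 / real (Suc m) * (1 / real p * V (i + 1) x))" for i x
  proof (cases "2 * \<epsilon> < \<bar>Yb m p i x\<bar>")
    case True
    have "sqrt (real (Suc m)) \<le> sqrt (4 * real m)" using m by (intro real_sqrt_le_mono) simp
    also have "\<dots> = 2 * sqrt (real m)" by (simp add: real_sqrt_mult)
    finally have "\<epsilon> * sqrt (real (Suc m)) \<le> \<epsilon> * (2 * sqrt (real m))" using \<epsilon> by (intro mult_left_mono) auto
    also have "\<dots> = (2 * \<epsilon>) * sqrt (real m)" by simp
    also have "\<dots> < \<bar>Yb m p i x\<bar> * sqrt (real m)" using True m by (intro mult_strict_right_mono) auto
    also have "\<dots> = \<bar>D p (i + 1) x\<bar> / sqrt (real p)"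
      using m p by (simp add: Yb_def real_sqrt_mult field_simps)
    finally have V: "V (i + 1) x = (D p (i + 1) x)\<^sup>2" by (simp add: V_def)
    have "tail_sq (2 * \<epsilon>) (Yb m p i x) = 1 / real m * (1 / real p * (D p (i + 1) x)\<^sup>2)"
      using True by (simp add: tail_sq_def Yb_sq)
    also have "\<dots> \<le> 2 / real (Suc m) * (1 / real p * (D p (i + 1) x)\<^sup>2)"
      using m by (intro mult_right_mono) (auto simp: field_simps)
    finally show ?thesis unfolding V by simp
  next
    case False
    then show ?thesis by (simp add: tail_sq_def V_def)
  qed
  have "(\<Sum>i\<le>m. \<integral>x. tail_sq (2 * \<epsilon>) (Yb m p i x) \<partial>cond_law \<omega>)
    \<le> (\<Sum>i\<le>m. 2 * (1 / real (Suc m) * (1 / real p * (\<integral>x. V (i + 1) x \<partial>cond_law \<omega>))))"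
  proof (rule sum_mono)
    fix i
    have "(\<integral>x. tail_sq (2 * \<epsilon>) (Yb m p i x) \<partial>cond_law \<omega>) \<le> (\<integral>x. 2 * (1 / real (Suc m) * (1 / real p * V (i + 1) x)) \<partial>cond_law \<omega>)"
    proof (rule integral_mono')
      show "integrable (cond_law \<omega>) (\<lambda>x. 2 * (1 / real (Suc m) * (1 / real p * V (i + 1) x)))"
        by (intro integrable_mult_right Vi)
      show "0 \<le> 2 * (1 / real (Suc m) * (1 / real p * V (i + 1) x))" for x
        by (simp add: V_def)
    qed (rule le)
    then show "(\<integral>x. tail_sq (2 * \<epsilon>) (Yb m p i x) \<partial>cond_law \<omega>) \<le> 2 * (1 / real (Suc m) * (1 / real p * (\<integral>x. V (i + 1) x \<partial>cond_law \<omega>)))"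
      by (simp only: integral_mult_right_zero)
  qed
  also have "\<dots> = 2 * (1 / real (Suc m) * (\<Sum>i=1..Suc m. 1 / real p * (\<integral>x. V i x \<partial>cond_law \<omega>)))"
    unfolding sum_shift_1 by (simp only: sum_distrib_left lessThan_Suc_atMost)
  finally have "(\<Sum>i\<le>m. \<integral>x. tail_sq (2 * \<epsilon>) (Yb m p i x) \<partial>cond_law \<omega>)
    \<le> 2 * (1 / real (Suc m) * (\<Sum>i=1..Suc m. 1 / real p * kexp M T \<kappa> 0 (V i) \<omega>))"
    by (simp only: kexp_0[OF Vm \<omega>])
  then show ?thesis unfolding V_def[abs_def] .
qed

text \<open>
  The bound of \<open>char_bound\<close> has five terms; \<open>\<epsilon>\<close> is fixed first, since the Lindeberg term is
  multiplied by \<open>1 + 1 / \<epsilon>\<close>, and then \<open>m\<close> and \<open>p\<close> are taken large.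
\<close>
lemma block_char_limit:
  assumes arr: "\<And>m p. lindeberg_array (cond_law \<omega>) (Yb m p) (Ab m p) (Bb m p) (Cb m p) m t N c"
    and A: "\<And>\<delta>. 0 < \<delta> \<Longrightarrow> \<forall>\<^sub>F m in sequentially. \<forall>\<^sub>F p in sequentially. (\<integral>x. \<bar>(\<Sum>i<m. Ab m p i x) - 2 * c\<bar> \<partial>cond_law \<omega>) < \<delta>"
    and B: "\<And>\<delta>. 0 < \<delta> \<Longrightarrow> \<forall>\<^sub>F m in sequentially. \<forall>\<^sub>F p in sequentially. (\<integral>x. \<bar>(\<Sum>i<m. Bb m p i x) - c\<bar> \<partial>cond_law \<omega>) < \<delta>"
    and C: "\<And>\<delta>. 0 < \<delta> \<Longrightarrow> \<forall>\<^sub>F m in sequentially. \<forall>\<^sub>F p in sequentially. (\<Sum>i<m. \<integral>x. \<bar>Cb m p i x\<bar> \<partial>cond_law \<omega>) < \<delta>"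
    and L: "\<And>e. 0 < e \<Longrightarrow> \<exists>\<epsilon>>0. \<epsilon> \<le> e \<and>
       (\<forall>\<delta>>0. \<forall>\<^sub>F m in sequentially. \<forall>\<^sub>F p in sequentially. (\<Sum>i\<le>m. \<integral>x. tail_sq \<epsilon> (Yb m p i x) \<partial>cond_law \<omega>) < \<delta>)"
    and r: "0 < r"
  shows "\<exists>m>0. \<forall>\<^sub>F p in sequentially.
    cmod ((\<integral>x. iexp (t * (S (m * p) x / sqrt (real (m * p)))) \<partial>cond_law \<omega>) * exp (t\<^sup>2 * c / 2) - 1) < r"
proof -
  interpret arr0: lindeberg_array "cond_law \<omega>" "Yb m p" "Ab m p" "Bb m p" "Cb m p" m t N c for m p by (rule arr)
  define K where "K = array_const t N + 1"
  have K: "0 < K" "array_const t N \<le> K" using array_const_nonneg[OF arr0.N(2), of t] by (auto simp: K_def)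
  \<comment> \<open>Each of the five terms of the bound will be smaller than \<open>d\<close>.\<close>
  define d where "d = r / (5 * K)"
  have d: "0 < d" using r K by (simp add: d_def)
  obtain \<epsilon> where \<epsilon>: "0 < \<epsilon>" "\<epsilon> \<le> min 1 (d / 2)"
    and Le: "\<And>\<delta>. 0 < \<delta> \<Longrightarrow> \<forall>\<^sub>F m in sequentially. \<forall>\<^sub>F p in sequentially. (\<Sum>i\<le>m. \<integral>x. tail_sq \<epsilon> (Yb m p i x) \<partial>cond_law \<omega>) < \<delta>"
    using L[of "min 1 (d / 2)"] d by auto
  \<comment> \<open>The Lindeberg term carries the factor \<open>1 + 1 / \<epsilon>\<close>.\<close>
  define l where "l = d / (1 + 1 / \<epsilon>)"
  have \<epsilon>1: "0 < 1 + 1 / \<epsilon>" using \<epsilon> by (simp add: add_pos_pos)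
  have l: "0 < l" using d \<epsilon>1 by (simp add: l_def)
  have "\<forall>\<^sub>F m in sequentially. 0 < m \<and> (\<forall>\<^sub>F p in sequentially. (\<integral>x. \<bar>(\<Sum>i<m. Ab m p i x) - 2 * c\<bar> \<partial>cond_law \<omega>) < d)
    \<and> (\<forall>\<^sub>F p in sequentially. (\<integral>x. \<bar>(\<Sum>i<m. Bb m p i x) - c\<bar> \<partial>cond_law \<omega>) < d)
    \<and> (\<forall>\<^sub>F p in sequentially. (\<Sum>i<m. \<integral>x. \<bar>Cb m p i x\<bar> \<partial>cond_law \<omega>) < d)
    \<and> (\<forall>\<^sub>F p in sequentially. (\<Sum>i\<le>m. \<integral>x. tail_sq \<epsilon> (Yb m p i x) \<partial>cond_law \<omega>) < l)"
    using A[OF d] B[OF d] C[OF d] Le[OF l] by (intro eventually_conj eventually_gt_at_top)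
  then obtain m where m: "0 < m"
    and ev: "\<forall>\<^sub>F p in sequentially. (\<integral>x. \<bar>(\<Sum>i<m. Ab m p i x) - 2 * c\<bar> \<partial>cond_law \<omega>) < d"
      "\<forall>\<^sub>F p in sequentially. (\<integral>x. \<bar>(\<Sum>i<m. Bb m p i x) - c\<bar> \<partial>cond_law \<omega>) < d"
      "\<forall>\<^sub>F p in sequentially. (\<Sum>i<m. \<integral>x. \<bar>Cb m p i x\<bar> \<partial>cond_law \<omega>) < d"
      "\<forall>\<^sub>F p in sequentially. (\<Sum>i\<le>m. \<integral>x. tail_sq \<epsilon> (Yb m p i x) \<partial>cond_law \<omega>) < l"
    using eventually_happens'[OF sequentially_bot] by blast
  from ev have "\<forall>\<^sub>F p in sequentially.
    cmod ((\<integral>x. iexp (t * (S (m * p) x / sqrt (real (m * p)))) \<partial>cond_law \<omega>) * exp (t\<^sup>2 * c / 2) - 1) < r"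
  proof eventually_elim
    case (elim p)
    have sumY: "(\<Sum>i<m. Yb m p i x) = S (m * p) x / sqrt (real (m * p))" for x
    proof -
      have "(\<Sum>i<m. Yb m p i x) = (\<Sum>i<m. S (p * Suc i) x - S (p * i) x) / sqrt (real m * real p)"
        by (simp add: Yb_def block_sum_def sum_divide_distrib)
      also have "(\<Sum>i<m. S (p * Suc i) x - S (p * i) x) = S (p * m) x - S (p * 0) x"
        by (rule sum_lessThan_telescope)
      finally show ?thesis by (simp add: psum_eq[of 0] mult.commute)
    qed
    have "cmod ((\<integral>x. iexp (t * (\<Sum>i<m. Yb m p i x)) \<partial>cond_law \<omega>) * exp (t\<^sup>2 * c / 2) - 1)
      \<le> array_const t N * ((\<integral>x. \<bar>(\<Sum>i<m. Ab m p i x) - 2 * c\<bar> \<partial>cond_law \<omega>) + (\<integral>x. \<bar>(\<Sum>i<m. Bb m p i x) - c\<bar> \<partial>cond_law \<omega>)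
        + (\<Sum>i<m. \<integral>x. \<bar>Cb m p i x\<bar> \<partial>cond_law \<omega>) + \<epsilon> + (1 + 1 / \<epsilon>) * (\<Sum>i\<le>m. \<integral>x. tail_sq \<epsilon> (Yb m p i x) \<partial>cond_law \<omega>))"
      using arr0.char_bound[of \<epsilon> m p] \<epsilon> by (simp add: arr0.\<delta>A_def arr0.\<delta>B_def arr0.\<delta>C_def arr0.\<Lambda>_def)
    also have "\<dots> \<le> K * ((\<integral>x. \<bar>(\<Sum>i<m. Ab m p i x) - 2 * c\<bar> \<partial>cond_law \<omega>) + (\<integral>x. \<bar>(\<Sum>i<m. Bb m p i x) - c\<bar> \<partial>cond_law \<omega>)
        + (\<Sum>i<m. \<integral>x. \<bar>Cb m p i x\<bar> \<partial>cond_law \<omega>) + \<epsilon> + (1 + 1 / \<epsilon>) * (\<Sum>i\<le>m. \<integral>x. tail_sq \<epsilon> (Yb m p i x) \<partial>cond_law \<omega>))"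
      using K \<epsilon> by (intro mult_right_mono add_nonneg_nonneg mult_nonneg_nonneg sum_nonneg Bochner_Integration.integral_nonneg) auto
    also have "\<dots> < K * (d + d + d + d + d)"
    proof (rule mult_strict_left_mono[OF _ K(1)])
      have "(1 + 1 / \<epsilon>) * (\<Sum>i\<le>m. \<integral>x. tail_sq \<epsilon> (Yb m p i x) \<partial>cond_law \<omega>) < (1 + 1 / \<epsilon>) * l"
        using elim(4) \<epsilon>1 by (rule mult_strict_left_mono)
      also have "(1 + 1 / \<epsilon>) * l = d" using \<epsilon>1 by (simp add: l_def)
      finally show "(\<integral>x. \<bar>(\<Sum>i<m. Ab m p i x) - 2 * c\<bar> \<partial>cond_law \<omega>) + (\<integral>x. \<bar>(\<Sum>i<m. Bb m p i x) - c\<bar> \<partial>cond_law \<omega>)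
        + (\<Sum>i<m. \<integral>x. \<bar>Cb m p i x\<bar> \<partial>cond_law \<omega>) + \<epsilon> + (1 + 1 / \<epsilon>) * (\<Sum>i\<le>m. \<integral>x. tail_sq \<epsilon> (Yb m p i x) \<partial>cond_law \<omega>) < d + d + d + d + d"
        using elim(1-3) \<epsilon> d by (intro add_strict_mono) auto
    qed
    also have "\<dots> = r" using K by (simp add: d_def field_simps)
    finally show ?case unfolding sumY .
  qed
  with m show ?thesis by blast
qed

text \<open>
  Along \<open>n = m p\<close> the limit is known up to an arbitrarily small error for a suitable \<open>m\<close>. Replacing
  \<open>n\<close> by \<open>m * (n div m)\<close> changes the normalised sum by a quantity that tends to \<open>0\<close> pathwise, hence
  the characteristic function by one that tends to \<open>0\<close> by dominated convergence.
\<close>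
lemma char_limit:
  assumes P: "prob_space (cond_law \<omega>)"
    and incr: "AE x in cond_law \<omega>. (\<lambda>n. X0 ((T ^^ n) x) / sqrt (real n)) \<longlonglongrightarrow> 0"
    and c: "0 \<le> c"
    and block: "\<And>r. 0 < r \<Longrightarrow> \<exists>m>0. \<forall>\<^sub>F p in sequentially.
      cmod ((\<integral>x. iexp (t * (S (m * p) x / sqrt (real (m * p)))) \<partial>cond_law \<omega>) * exp (t\<^sup>2 * c / 2) - 1) < r"
  shows "(\<lambda>n. \<integral>x. iexp (t * (S n x / sqrt (real n))) \<partial>cond_law \<omega>) \<longlonglongrightarrow> complex_of_real (exp (- (t\<^sup>2 * c / 2)))"
proof -
  interpret P: prob_space "cond_law \<omega>" by (rule P)
  define \<phi> where "\<phi> n = (\<integral>x. iexp (t * (S n x / sqrt (real n))) \<partial>cond_law \<omega>)" for n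
  define E where "E = exp (t\<^sup>2 * c / 2)"
  have E: "0 < E" by (simp add: E_def)
  have SM [measurable]: "S n \<in> borel_measurable (cond_law \<omega>)" for n
    using psum_M by (simp cong: measurable_cong_sets)
  have ie: "integrable (cond_law \<omega>) (\<lambda>x. iexp (t * (S n x / sqrt (real n))))" for n
    by (rule P.integrable_const_bound[where B=1]) (auto simp: norm_exp_i_times simp flip: of_real_mult of_real_divide)
  have approx: "(\<lambda>n. \<phi> (m * (n div m)) - \<phi> n) \<longlonglongrightarrow> 0" if m: "0 < m" for m
  proof -
    have "(\<lambda>n. \<integral>x. iexp (t * (S (m * (n div m)) x / sqrt (real (m * (n div m))))) - iexp (t * (S n x / sqrt (real n))) \<partial>cond_law \<omega>)
      \<longlonglongrightarrow> (\<integral>x. 0 \<partial>cond_law \<omega>)"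
    proof (rule integral_dominated_convergence[where w="\<lambda>_. 2"])
      show "AE x in cond_law \<omega>. (\<lambda>n. iexp (t * (S (m * (n div m)) x / sqrt (real (m * (n div m))))) - iexp (t * (S n x / sqrt (real n)))) \<longlonglongrightarrow> 0"
        using incr
      proof eventually_elim
        case (elim x)
        have lim: "(\<lambda>n. \<bar>t\<bar> * \<bar>S (m * (n div m)) x / sqrt (real (m * (n div m))) - S n x / sqrt (real n)\<bar>) \<longlonglongrightarrow> 0"
          using tendsto_mult_right_zero[OF tendsto_rabs_zero[OF subsequence_normalised_sums[OF elim m]]]
          unfolding psum_eq[symmetric] .
        show ?case
        proof (rule Lim_null_comparison[OF _ lim], rule always_eventually, rule allI)
          fix n
          define u v where "u = t * (S (m * (n div m)) x / sqrt (real (m * (n div m))))" and "v = t * (S n x / sqrt (real n))"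
          have "iexp u - iexp v = iexp v * (iexp (u - v) - 1)"
            by (simp add: algebra_simps flip: exp_add)
          also have "cmod \<dots> = cmod (iexp (u - v) - 1)" by (simp add: norm_mult)
          also have "\<dots> \<le> \<bar>u - v\<bar>" using iexp_approx1[of "u - v" 0] by simp
          also have "\<dots> = \<bar>t\<bar> * \<bar>S (m * (n div m)) x / sqrt (real (m * (n div m))) - S n x / sqrt (real n)\<bar>"
            unfolding u_def v_def by (simp only: abs_mult flip: right_diff_distrib)
          finally show "cmod (iexp (t * (S (m * (n div m)) x / sqrt (real (m * (n div m))))) - iexp (t * (S n x / sqrt (real n))))
            \<le> \<bar>t\<bar> * \<bar>S (m * (n div m)) x / sqrt (real (m * (n div m))) - S n x / sqrt (real n)\<bar>"
            unfolding u_def v_def .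
        qed
      qed
      show "AE x in cond_law \<omega>. cmod (iexp (t * (S (m * (n div m)) x / sqrt (real (m * (n div m))))) - iexp (t * (S n x / sqrt (real n)))) \<le> 2" for n
      proof (rule AE_I2)
        fix x
        show "cmod (iexp (t * (S (m * (n div m)) x / sqrt (real (m * (n div m))))) - iexp (t * (S n x / sqrt (real n)))) \<le> 2"
          by (rule order_trans[OF norm_triangle_ineq4]) (simp add: norm_exp_i_times del: of_real_mult of_real_divide)
      qed
    qed auto
    then show ?thesis unfolding Bochner_Integration.integral_diff[OF ie ie] \<phi>_def[symmetric] by simp
  qed
  have "(\<lambda>n. \<phi> n * E) \<longlonglongrightarrow> 1"
  proof (rule tendstoI)
    fix r :: real assume r: "0 < r"
    obtain m where m: "0 < m" and b: "\<forall>\<^sub>F p in sequentially. cmod (\<phi> (m * p) * E - 1) < r / 2"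
      using block[of "r / 2"] r unfolding \<phi>_def E_def by auto
    have "\<forall>\<^sub>F n in sequentially. cmod (\<phi> (m * (n div m)) * E - 1) < r / 2"
      by (rule eventually_compose_filterlim[OF b filterlim_at_top_div_const_nat[OF m]])
    moreover have "\<forall>\<^sub>F n in sequentially. cmod (\<phi> (m * (n div m)) - \<phi> n) < r / (2 * E)"
      using tendstoD[OF approx[OF m], of "r / (2 * E)"] r E by (simp add: dist_norm)
    ultimately show "\<forall>\<^sub>F n in sequentially. dist (\<phi> n * E) 1 < r"
    proof eventually_elim
      case (elim n)
      have "\<phi> n * E - 1 = (\<phi> (m * (n div m)) * E - 1) - (\<phi> (m * (n div m)) - \<phi> n) * E" by (simp add: algebra_simps)
      also have "cmod \<dots> \<le> cmod (\<phi> (m * (n div m)) * E - 1) + cmod (\<phi> (m * (n div m)) - \<phi> n) * E"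
        using E by (intro order_trans[OF norm_triangle_ineq4]) (simp add: norm_mult)
      also have "\<dots> < r / 2 + r / (2 * E) * E"
        using elim E by (intro add_strict_mono mult_strict_right_mono) auto
      also have "\<dots> = r" using E by simp
      finally show ?case by (simp add: dist_norm)
    qed
  qed
  then have "(\<lambda>n. \<phi> n * E * complex_of_real (exp (- (t\<^sup>2 * c / 2)))) \<longlonglongrightarrow> 1 * complex_of_real (exp (- (t\<^sup>2 * c / 2)))"
    by (rule tendsto_mult_right)
  moreover have "\<phi> n * E * complex_of_real (exp (- (t\<^sup>2 * c / 2))) = \<phi> n" for n
  proof -
    have "E * exp (- (t\<^sup>2 * c / 2)) = 1" by (simp add: E_def flip: exp_add)
    then show ?thesis by (simp only: mult.assoc of_real_mult[symmetric] of_real_1 mult_1_right)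
  qed
  ultimately show ?thesis unfolding \<phi>_def[symmetric] by (simp only: mult_1_left)
qed

end

section \<open>The quenched central limit theorem\<close>

lemma scaled_normal_limit:
  fixes Z :: "nat \<Rightarrow> 'a \<Rightarrow> real" and c :: real
  assumes P: "prob_space P" and Z: "\<And>n. Z n \<in> borel_measurable P" and c: "0 \<le> c"
    and char: "\<And>t. (\<lambda>n. \<integral>x. iexp (t * Z n x) \<partial>P) \<longlonglongrightarrow> complex_of_real (exp (- (t\<^sup>2 * c / 2)))"
    and f: "continuous_on UNIV f" "bounded (range (f :: real \<Rightarrow> real))"
  shows "(\<lambda>n. \<integral>x. f (Z n x) \<partial>P) \<longlonglongrightarrow> (\<integral>x. f (x * sqrt c) * std_normal_density x \<partial>lborel)"
proof -
  interpret prob_space P by (rule P)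
  define Q where "Q n = distr P borel (Z n)" for n
  define R where "R = distr std_normal_distribution borel (\<lambda>x. x * sqrt c)"
  interpret N: real_distribution std_normal_distribution by (rule real_dist_normal_dist)
  have Q: "real_distribution (Q n)" for n unfolding Q_def using Z by (rule real_distribution_distr)
  have R: "real_distribution R" unfolding R_def by (rule N.real_distribution_distr) simp
  have "weak_conv_m Q R"
  proof (rule levy_continuity[OF Q R])
    fix t
    have "char (Q n) t = (\<integral>x. iexp (t * Z n x) \<partial>P)" for n
      unfolding char_def Q_def using Z by (subst integral_distr) auto
    moreover have "char R t = complex_of_real (exp (- (t\<^sup>2 * c / 2)))"
    proof -
      have "char R t = (\<integral>x. iexp (t * (x * sqrt c)) \<partial>std_normal_distribution)"
        unfolding char_def R_def by (subst integral_distr) auto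
      also have "\<dots> = char std_normal_distribution (t * sqrt c)"
        unfolding char_def by (simp add: ac_simps)
      also have "\<dots> = complex_of_real (exp (- (t\<^sup>2 * c / 2)))"
        unfolding char_std_normal_distribution using c by (simp add: power_mult_distrib)
      finally show ?thesis .
    qed
    ultimately show "(\<lambda>n. char (Q n) t) \<longlonglongrightarrow> char R t" using char by simp
  qed
  moreover obtain K where K: "\<And>x. norm (f x) \<le> K" using f(2) by (auto simp: bounded_iff)
  moreover have fc: "isCont f x" for x using f(1) by (simp add: continuous_on_eq_continuous_at)
  ultimately have lim: "(\<lambda>n. integral\<^sup>L (Q n) f) \<longlonglongrightarrow> integral\<^sup>L R f"
    by (intro weak_conv_imp_integral_bdd_continuous_conv[OF Q R])
  have fM [measurable]: "f \<in> borel_measurable borel" by (rule borel_measurable_continuous_onI[OF f(1)])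
  have "integral\<^sup>L (Q n) f = (\<integral>x. f (Z n x) \<partial>P)" for n
    unfolding Q_def using Z by (intro integral_distr) auto
  moreover have "integral\<^sup>L R f = (\<integral>x. f (x * sqrt c) * std_normal_density x \<partial>lborel)"
  proof -
    have "integral\<^sup>L R f = (\<integral>x. f (x * sqrt c) \<partial>std_normal_distribution)"
      unfolding R_def by (intro integral_distr) auto
    also have "\<dots> = (\<integral>x. std_normal_density x * f (x * sqrt c) \<partial>lborel)"
      by (subst integral_density) (auto simp: normal_density_nonneg)
    finally show ?thesis by (simp add: mult.commute)
  qed
  ultimately show ?thesis using lim by simp
qed

theorem proposition4p1:
  fixes M :: "'a measure" and T :: "'a \<Rightarrow> 'a" and F0 :: "'a measure"
    and \<kappa> :: "'a \<Rightarrow> 'a measure" and X0 \<eta> :: "'a \<Rightarrow> real"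
  assumes setting: "quenched_setting M T F0 \<kappa>"
    and X0_measurable: "X0 \<in> borel_measurable F0"
    and X0_square_integrable: "integrable M (\<lambda>\<omega>. (X0 \<omega>)\<^sup>2)"
    and X0_centered: "(\<integral>\<omega>. X0 \<omega> \<partial>M) = 0"
    and C1: "AE \<omega> in M.
      (\<lambda>m. limsup (\<lambda>p. ereal (1 / sqrt (real m * real p) *
          (\<Sum>i=2..m+1. kexp M T \<kappa> 0
             (\<lambda>x. \<bar>kexp M T \<kappa> (int ((i - 2) * p)) (block_sum M T X0 p i) x\<bar>) \<omega>))))
        \<longlonglongrightarrow> 0"
    and \<eta>_measurable: "\<eta> \<in> borel_measurable F0"
    and \<eta>_invariant: "AE \<omega> in M. \<eta> (T \<omega>) = \<eta> \<omega>"
    and C2_first: "AE \<omega> in M.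
      (\<lambda>m. limsup (\<lambda>p. ereal (kexp M T \<kappa> 0
          (\<lambda>x. \<bar>(\<Sum>i=1..m. 1 / (real m * real p) *
             kexp M T \<kappa> (int ((i - 1) * p)) (\<lambda>y. (block_sum M T X0 p (i + 1) y)\<^sup>2) x)
             - \<eta> x\<bar>) \<omega>)))
        \<longlonglongrightarrow> 0"
    and C2_second: "AE \<omega> in M.
      (\<lambda>m. limsup (\<lambda>p. ereal (kexp M T \<kappa> 0
          (\<lambda>x. \<bar>(\<Sum>i=1..m. 1 / (real m * real p) *
             kexp M T \<kappa> (int ((i - 1) * p))
               (\<lambda>y. (block_sum M T X0 p i y + block_sum M T X0 p (i + 1) y)\<^sup>2) x)
             - 2 * \<eta> x\<bar>) \<omega>)))
        \<longlonglongrightarrow> 0"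
    and C3: "\<And>\<epsilon>::real. \<epsilon> > 0 \<Longrightarrow> AE \<omega> in M.
      (\<lambda>m. limsup (\<lambda>p. ereal (1 / real m *
          (\<Sum>i=1..m. 1 / real p * kexp M T \<kappa> 0
             (\<lambda>x. (block_sum M T X0 p i x)\<^sup>2 *
               indicator {y. \<bar>block_sum M T X0 p i y\<bar> / sqrt (real p) > \<epsilon> * sqrt (real m)} x)
             \<omega>))))
        \<longlonglongrightarrow> 0"
  shows "AE \<omega> in M. \<forall>f::real \<Rightarrow> real. continuous_on UNIV f \<and> bounded (range f) \<longrightarrow>
    (\<lambda>n. kexp M T \<kappa> 0 (\<lambda>x. f (psum M T X0 n x / sqrt (real n))) \<omega>)
      \<longlonglongrightarrow> (\<integral>x. f (x * sqrt (\<eta> \<omega>)) * std_normal_density x \<partial>lborel)"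
proof -
  interpret quenched_setting M T F0 \<kappa> by (rule setting)
  interpret quenched_sequence M T F0 \<kappa> X0
    by unfold_locales (rule X0_measurable X0_square_integrable)+
  have \<eta>M: "\<eta> \<in> borel_measurable M" by (rule measurable_from_subalg[OF subalgebra_F0 \<eta>_measurable])
  have "AE \<omega> in M. \<forall>k. (\<lambda>m. limsup (\<lambda>p. ereal (1 / real m *
          (\<Sum>i=1..m. 1 / real p * kexp M T \<kappa> 0
             (\<lambda>x. (block_sum M T X0 p i x)\<^sup>2 *
               indicator {y. \<bar>block_sum M T X0 p i y\<bar> / sqrt (real p) > (1 / real (Suc k)) * sqrt (real m)} x)
             \<omega>)))) \<longlonglongrightarrow> 0"
    unfolding AE_all_countable by (intro allI C3) simp
  moreover have "AE \<omega> in M. \<forall>p i. integrable (cond_law \<omega>) (\<lambda>x. (block_sum M T X0 p i x)\<^sup>2)"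
    unfolding AE_all_countable using cond_law_integrable[OF block_sq] by blast
  ultimately show ?thesis
    using C1 C2_first C2_second quenched_array cond_law_const[OF \<eta>_measurable] AE_cond_law[OF AE_small_increments] AE_space
  proof eventually_elim
    case (elim \<omega>)
    note C3\<omega> = elim(1) and sq = elim(2) and C1\<omega> = elim(3) and C2a = elim(4) and C2b = elim(5)
      and arr = elim(6) and const = elim(7) and incr = elim(8) and \<omega> = elim(9)
    define c where "c = \<eta> \<omega>"
    have P: "prob_space (cond_law \<omega>)" by (rule prob_space_cond_law[OF \<omega>])
    interpret P: prob_space "cond_law \<omega>" by (rule P)
    have B: "\<forall>\<^sub>F m in sequentially. \<forall>\<^sub>F p in sequentially. (\<integral>x. \<bar>(\<Sum>i<m. Bb m p i x) - c\<bar> \<partial>cond_law \<omega>) < \<delta>"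
      if "0 < \<delta>" for \<delta>
    proof -
      have "kexp M T \<kappa> 0 (\<lambda>x. \<bar>(\<Sum>i=1..m. 1 / (real m * real p) *
             kexp M T \<kappa> (int ((i - 1) * p)) (\<lambda>y. (block_sum M T X0 p (i + 1) y)\<^sup>2) x) - \<eta> x\<bar>) \<omega>
        = (\<integral>x. \<bar>(\<Sum>i<m. Bb m p i x) - c\<bar> \<partial>cond_law \<omega>)" for m p
        by (subst C2_expression[OF \<omega> \<eta>M const]) (simp_all add: Bb_def c_def)
      with iterated_limsup_small[OF C2a that] show ?thesis by simp
    qed
    have A: "\<forall>\<^sub>F m in sequentially. \<forall>\<^sub>F p in sequentially. (\<integral>x. \<bar>(\<Sum>i<m. Ab m p i x) - 2 * c\<bar> \<partial>cond_law \<omega>) < \<delta>"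
      if "0 < \<delta>" for \<delta>
    proof -
      have "AE x in cond_law \<omega>. 2 * \<eta> x = 2 * \<eta> \<omega>" using const by eventually_elim simp
      then have "kexp M T \<kappa> 0 (\<lambda>x. \<bar>(\<Sum>i=1..m. 1 / (real m * real p) *
             kexp M T \<kappa> (int ((i - 1) * p)) (\<lambda>y. (block_sum M T X0 p i y + block_sum M T X0 p (i + 1) y)\<^sup>2) x) - 2 * \<eta> x\<bar>) \<omega>
        = (\<integral>x. \<bar>(\<Sum>i<m. Ab m p i x) - 2 * c\<bar> \<partial>cond_law \<omega>)" for m p
        using \<eta>M by (subst C2_expression[OF \<omega>, where h="\<lambda>x. 2 * \<eta> x"]) (simp_all add: Ab_def c_def)
      with iterated_limsup_small[OF C2b that] show ?thesis by simp
    qed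
    have C: "\<forall>\<^sub>F m in sequentially. \<forall>\<^sub>F p in sequentially. (\<Sum>i<m. \<integral>x. \<bar>Cb m p i x\<bar> \<partial>cond_law \<omega>) < \<delta>"
      if "0 < \<delta>" for \<delta>
      using iterated_limsup_small[OF C1\<omega> that] unfolding C1_expression[OF \<omega>] .
    have L: "\<exists>\<epsilon>>0. \<epsilon> \<le> e \<and> (\<forall>\<delta>>0. \<forall>\<^sub>F m in sequentially. \<forall>\<^sub>F p in sequentially. (\<Sum>i\<le>m. \<integral>x. tail_sq \<epsilon> (Yb m p i x) \<partial>cond_law \<omega>) < \<delta>)"
      if e: "0 < e" for e
    proof -
      obtain k where k: "1 / real (Suc k) < e / 2" using reals_Archimedean[of "e / 2"] e by (auto simp: inverse_eq_divide)
      define \<epsilon> where "\<epsilon> = 1 / real (Suc k)"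
      have \<epsilon>: "0 < \<epsilon>" "2 * \<epsilon> \<le> e" using k by (auto simp: \<epsilon>_def)
      define g where "g m p = 1 / real m * (\<Sum>i=1..m. 1 / real p * kexp M T \<kappa> 0
             (\<lambda>x. (block_sum M T X0 p i x)\<^sup>2 *
               indicator {y. \<bar>block_sum M T X0 p i y\<bar> / sqrt (real p) > \<epsilon> * sqrt (real m)} x) \<omega>)" for m p
      have g: "(\<lambda>m. limsup (\<lambda>p. ereal (g m p))) \<longlonglongrightarrow> 0"
        using C3\<omega>[THEN spec[of _ k]] unfolding g_def \<epsilon>_def .
      have "\<forall>\<^sub>F m in sequentially. \<forall>\<^sub>F p in sequentially. (\<Sum>i\<le>m. \<integral>x. tail_sq (2 * \<epsilon>) (Yb m p i x) \<partial>cond_law \<omega>) < \<delta>"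
        if \<delta>: "0 < \<delta>" for \<delta>
      proof -
        have "\<forall>\<^sub>F m in sequentially. \<forall>\<^sub>F p in sequentially. g (Suc m) p < \<delta> / 2"
          using iterated_limsup_small[OF g, of "\<delta> / 2"] \<delta>
            eventually_sequentially_Suc[of "\<lambda>m. \<forall>\<^sub>F p in sequentially. g m p < \<delta> / 2"] by simp
        then show ?thesis using eventually_gt_at_top[of 0]
        proof eventually_elim
          case (elim m)
          from elim(1) eventually_gt_at_top[of 0] show ?case
          proof eventually_elim
            case (elim p)
            have "(\<Sum>i\<le>m. \<integral>x. tail_sq (2 * \<epsilon>) (Yb m p i x) \<partial>cond_law \<omega>) \<le> 2 * g (Suc m) p"
              unfolding g_def by (rule C3_expression[OF \<omega> _ \<open>0 < m\<close> elim(2) \<epsilon>(1)]) (use sq in blast)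
            then show ?case using elim(1) by simp
          qed
        qed
      qed
      then show ?thesis using \<epsilon> by (intro exI[of _ "2 * \<epsilon>"]) auto
    qed
    \<comment> \<open>The sums of the nonnegative \<open>Bb m p i\<close> cannot approximate a negative number in mean.\<close>
    have c: "0 \<le> c"
    proof (rule ccontr)
      assume "\<not> 0 \<le> c"
      then have nc: "0 < - c" by simp
      from eventually_happens'[OF sequentially_bot B[OF nc]]
      obtain m where "\<forall>\<^sub>F p in sequentially. (\<integral>x. \<bar>(\<Sum>i<m. Bb m p i x) - c\<bar> \<partial>cond_law \<omega>) < - c" by blast
      from eventually_happens'[OF sequentially_bot this]
      obtain p where p: "(\<integral>x. \<bar>(\<Sum>i<m. Bb m p i x) - c\<bar> \<partial>cond_law \<omega>) < - c" by blast
      interpret a: lindeberg_array "cond_law \<omega>" "Yb m p" "Ab m p" "Bb m p" "Cb m p" m 0 "real 1" 0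
        using arr[THEN spec[of _ m], THEN spec[of _ p], THEN spec[of _ 1], THEN spec[of _ 0], THEN spec[of _ 0]] by simp
      have "(\<integral>x. - c \<partial>cond_law \<omega>) \<le> (\<integral>x. \<bar>(\<Sum>i<m. Bb m p i x) - c\<bar> \<partial>cond_law \<omega>)"
      proof (rule integral_mono)
        show "integrable (cond_law \<omega>) (\<lambda>x. \<bar>(\<Sum>i<m. Bb m p i x) - c\<bar>)"
          using a.B_int by (intro integrable_abs Bochner_Integration.integrable_diff Bochner_Integration.integrable_sum P.integrable_const) auto
        fix x
        have "0 \<le> (\<Sum>i<m. Bb m p i x)" using Bb_nonneg by (intro sum_nonneg) auto
        then show "- c \<le> \<bar>(\<Sum>i<m. Bb m p i x) - c\<bar>" by linarith
      qed simp
      then show False using p P.prob_space by simp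
    qed
    obtain N :: nat where N: "3 * c + 1 \<le> real N" using real_arch_simple by blast
    have arr': "lindeberg_array (cond_law \<omega>) (Yb m p) (Ab m p) (Bb m p) (Cb m p) m t (real N) c" for m p t
      using arr c N by blast
    have char: "(\<lambda>n. \<integral>x. iexp (t * (psum M T X0 n x / sqrt (real n))) \<partial>cond_law \<omega>) \<longlonglongrightarrow> complex_of_real (exp (- (t\<^sup>2 * c / 2)))" for t
      by (rule char_limit[OF P incr c block_char_limit[OF arr' A B C L]])
    show ?case
    proof (intro allI impI)
      fix f :: "real \<Rightarrow> real" assume f: "continuous_on UNIV f \<and> bounded (range f)"
      have fM: "f \<in> borel_measurable borel" using f by (intro borel_measurable_continuous_onI) simp
      have "kexp M T \<kappa> 0 (\<lambda>x. f (psum M T X0 n x / sqrt (real n))) \<omega> = (\<integral>x. f (psum M T X0 n x / sqrt (real n)) \<partial>cond_law \<omega>)" for n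
        by (rule kexp_0[OF _ \<omega>]) (intro measurable_compose[OF _ fM] borel_measurable_divide psum_M borel_measurable_const)
      moreover have "(\<lambda>n. \<integral>x. f (psum M T X0 n x / sqrt (real n)) \<partial>cond_law \<omega>)
        \<longlonglongrightarrow> (\<integral>x. f (x * sqrt c) * std_normal_density x \<partial>lborel)"
      proof (rule scaled_normal_limit[OF P _ c char])
        show "(\<lambda>x. psum M T X0 n x / sqrt (real n)) \<in> borel_measurable (cond_law \<omega>)" for n
          using psum_M by (simp cong: measurable_cong_sets)
      qed (use f in auto)
      ultimately show "(\<lambda>n. kexp M T \<kappa> 0 (\<lambda>x. f (psum M T X0 n x / sqrt (real n))) \<omega>)
        \<longlonglongrightarrow> (\<integral>x. f (x * sqrt (\<eta> \<omega>)) * std_normal_density x \<partial>lborel)"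
        by (simp add: c_def)
    qed
  qed
qed

end
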